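(* Let $1\rightarrow N\rightarrow G\rightarrow K\rightarrow 1$ be an extension (short exact sequence) of finite groups inducing a trivial outer action on $N$, such that $N$ is nilpotent of class two and $K$ is centerless. Then $G$ is stable if and only if $G\cong D_4\times K$, $K$ is complete, and $|K^{\mathrm{ab}}|$ is odd.
   Context: All groups are finite. A group $G$ is stable if $G\cong \operatorname{Aut}(G)$ (abstractly isomorphic). A group $K$ is centerless if $Z(K)$ is trivial. A group $K$ is complete if the conjugation map $c:K\rightarrow \operatorname{Aut}(K)$, $c(g)=c_g$ with $c_g(x)=gxg^{-1}$, is an isomorphism. $D_n$ denotes the dihedral group of order $2n$, so $D_4$ is the dihedral group of order eight. $K^{\mathrm{ab}}=K/K'$ is the abelianization of $K$. Identifying $N$ with its image in $G$, the induced outer action is the homomorphism $G\to \operatorname{Out}(N)=\operatorname{Aut}(N)/\operatorname{Inn}(N)$ (which factors through $K$) given by conjugation in $G$; it is trivial if for every $g\in G$ the automorphism $x\mapsto gxg^{-1}$ of $N$ is an inner automorphism of $N$. *)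

theory Defs
  imports "HOL-Algebra.Algebra"
begin

definition center :: "('a, 'm) monoid_scheme \<Rightarrow> 'a set"
  where "center G = {z \<in> carrier G. \<forall>x \<in> carrier G. z \<otimes>\<^bsub>G\<^esub> x = x \<otimes>\<^bsub>G\<^esub> z}"

definition centerless :: "('a, 'm) monoid_scheme \<Rightarrow> bool"
  where "centerless G \<longleftrightarrow> center G = {\<one>\<^bsub>G\<^esub>}"

text \<open>The restriction to the carrier is needed because \<^const>\<open>AutoGroup\<close> consists of
  extensional functions.\<close>

definition conj_aut :: "('a, 'm) monoid_scheme \<Rightarrow> 'a \<Rightarrow> 'a \<Rightarrow> 'a"
  where "conj_aut G g = (\<lambda>x \<in> carrier G. g \<otimes>\<^bsub>G\<^esub> x \<otimes>\<^bsub>G\<^esub> inv\<^bsub>G\<^esub> g)"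

definition stable_group :: "('a, 'm) monoid_scheme \<Rightarrow> bool"
  where "stable_group G \<longleftrightarrow> G \<cong> AutoGroup G"

definition complete_group :: "('a, 'm) monoid_scheme \<Rightarrow> bool"
  where "complete_group G \<longleftrightarrow> conj_aut G \<in> iso G (AutoGroup G)"

definition abelianization :: "('a, 'm) monoid_scheme \<Rightarrow> 'a set monoid"
  where "abelianization G = G Mod derived G (carrier G)"

definition commutator_subgroup :: "('a, 'm) monoid_scheme \<Rightarrow> 'a set \<Rightarrow> 'a set \<Rightarrow> 'a set"
  where "commutator_subgroup G H K =
    generate G {h \<otimes>\<^bsub>G\<^esub> k \<otimes>\<^bsub>G\<^esub> inv\<^bsub>G\<^esub> h \<otimes>\<^bsub>G\<^esub> inv\<^bsub>G\<^esub> k | h k. h \<in> H \<and> k \<in> K}"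

text \<open>Indexing starts at \<open>0\<close>, so index \<open>n\<close> is the term usually written \<open>\<gamma>\<close> with index \<open>n + 1\<close>,
  and the nilpotency class is the least \<open>c\<close> whose term is trivial.\<close>

primrec lower_central_series :: "('a, 'm) monoid_scheme \<Rightarrow> nat \<Rightarrow> 'a set" where
  "lower_central_series G 0 = carrier G"
| "lower_central_series G (Suc n) =
     commutator_subgroup G (lower_central_series G n) (carrier G)"

definition nilpotent_of_class :: "('a, 'm) monoid_scheme \<Rightarrow> nat \<Rightarrow> bool"
  where "nilpotent_of_class G c \<longleftrightarrow>
    lower_central_series G c = {\<one>\<^bsub>G\<^esub>} \<and>
    (\<forall>k < c. lower_central_series G k \<noteq> {\<one>\<^bsub>G\<^esub>})"

text \<open>The sequence \<open>1 \<longrightarrow> N \<longrightarrow> G \<longrightarrow> K \<longrightarrow> 1\<close> with maps \<open>i\<close> and \<open>p\<close>. The library predicate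
  \<^const>\<open>exact_seq\<close> would force the three groups to share one element type.\<close>

definition group_extension ::
  "('a, 'm) monoid_scheme \<Rightarrow> ('a \<Rightarrow> 'b) \<Rightarrow> ('b, 'n) monoid_scheme \<Rightarrow>
   ('b \<Rightarrow> 'c) \<Rightarrow> ('c, 'k) monoid_scheme \<Rightarrow> bool"
  where "group_extension N i G p K \<longleftrightarrow>
    group N \<and> group G \<and> group K \<and>
    i \<in> mon N G \<and> p \<in> epi G K \<and> i ` carrier N = kernel G K p"

definition Inn :: "('a, 'm) monoid_scheme \<Rightarrow> ('a \<Rightarrow> 'a) set"
  where "Inn G = conj_aut G ` carrier G"

definition OutGroup :: "('a, 'm) monoid_scheme \<Rightarrow> ('a \<Rightarrow> 'a) set monoid"
  where "OutGroup G = AutoGroup G Mod Inn G"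

text \<open>Conjugation by \<open>g\<close> in \<open>G\<close>, transported to \<open>N\<close> along the injection \<open>i\<close>.\<close>

definition extension_aut ::
  "('a, 'm) monoid_scheme \<Rightarrow> ('a \<Rightarrow> 'b) \<Rightarrow> ('b, 'n) monoid_scheme \<Rightarrow> 'b \<Rightarrow> 'a \<Rightarrow> 'a"
  where "extension_aut N i G g =
    (\<lambda>x \<in> carrier N. inv_into (carrier N) i (g \<otimes>\<^bsub>G\<^esub> i x \<otimes>\<^bsub>G\<^esub> inv\<^bsub>G\<^esub> g))"

definition outer_action ::
  "('a, 'm) monoid_scheme \<Rightarrow> ('a \<Rightarrow> 'b) \<Rightarrow> ('b, 'n) monoid_scheme \<Rightarrow> 'b \<Rightarrow> ('a \<Rightarrow> 'a) set"
  where "outer_action N i G g = Inn N #>\<^bsub>AutoGroup N\<^esub> extension_aut N i G g"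

definition trivial_outer_action ::
  "('a, 'm) monoid_scheme \<Rightarrow> ('a \<Rightarrow> 'b) \<Rightarrow> ('b, 'n) monoid_scheme \<Rightarrow> bool"
  where "trivial_outer_action N i G \<longleftrightarrow>
    (\<forall>g \<in> carrier G. outer_action N i G g = \<one>\<^bsub>OutGroup N\<^esub>)"

text \<open>The dihedral group of order \<open>2 n\<close>, for \<open>n \<ge> 1\<close>. The pair \<open>(a, s)\<close> is the rotation \<open>r\<close> to
  the power \<open>a\<close>, followed on the right by the reflection if \<open>s\<close> holds; the sign in the product
  comes from \<open>f r = inv r f\<close> for a reflection \<open>f\<close>.\<close>

definition dihedral_group :: "nat \<Rightarrow> (int \<times> bool) monoid"
  where "dihedral_group n =
    \<lparr>carrier = {0..<int n} \<times> UNIV,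
     monoid.mult = (\<lambda>(a, s) (b, t). ((if s then a - b else a + b) mod int n, s \<noteq> t)),
     one = (0, False)\<rparr>"

lemma group_dihedral_group:
  assumes "n \<ge> 1"
  shows "group (dihedral_group n)"
proof (rule groupI)
  fix x assume "x \<in> carrier (dihedral_group n)"
  then show "\<exists>y \<in> carrier (dihedral_group n).
      y \<otimes>\<^bsub>dihedral_group n\<^esub> x = \<one>\<^bsub>dihedral_group n\<^esub>"
    using assms
    by (intro bexI[of _ "(if snd x then fst x else (- fst x) mod int n, snd x)"])
       (auto simp: dihedral_group_def mod_simps)
qed (use assms in \<open>auto simp: dihedral_group_def mod_simps algebra_simps\<close>)

lemma order_dihedral_group: "order (dihedral_group n) = 2 * n"
  by (simp add: order_def dihedral_group_def card_cartesian_product)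

end

theory Submission
  imports Defs
begin

text \<open>Since \<open>K\<close> is centerless and the outer action is trivial, \<open>G\<close> is the product of the image of \<open>N\<close> and
  its centralizer \<open>C\<close>, these meet in \<open>Z(G) = Z(N)\<close>, and \<open>N\<close> is the second center of \<open>G\<close>.

  Let \<open>G\<close> be stable and transport everything along an isomorphism from \<open>Aut G\<close> to \<open>G\<close>. The
  automorphisms given by conjugation with elements of \<open>C\<close> form a normal subgroup isomorphic to
  \<open>C/Z(G)\<close>, that is, to \<open>K\<close>. Its image \<open>L\<close> in \<open>G\<close> meets the second center trivially, and \<open>L\<close> has
  the order of \<open>G/N\<close>. So \<open>G = N \<times> L\<close>, and \<open>N\<close> is the centralizer of \<open>L\<close>. As automorphisms of the
  factor \<open>N\<close> commute with conjugation by \<open>C\<close>, the group \<open>Aut N\<close> embeds into \<open>N\<close>.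

  The core of the proof is therefore a statement on a finite group \<open>N\<close> of class two alone
  (\<open>dihedral_if_contains_automorphism_group\<close>): if \<open>Aut N\<close> embeds into \<open>N\<close>, then \<open>N\<close> is
  dihedral of order eight. Write \<open>Z\<close> for the center and \<open>e\<close> for the exponent of \<open>N/Z\<close>. Every
  homomorphism \<open>f\<close> from \<open>N/Z\<close> to \<open>Z\<close> gives an automorphism \<open>g \<mapsto> g f(g)\<close>, so \<open>N\<close> contains an
  abelian subgroup isomorphic to \<open>Hom(N/Z, Z)\<close>. Counting characters shows that this group is large,
  while the commutator form bounds the abelian subgroups of \<open>N\<close>
  (\<open>abelian_subgroup_bound\<close>). The two bounds can only be reconciled if \<open>N/Z\<close> has order \<open>e^2\<close>,
  the elements of \<open>Z\<close> of order dividing \<open>e\<close> form a cyclic group, and all these automorphisms are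
  inner. It follows that all automorphisms fix the commutators, and that some \<open>w\<close> has order
  \<open>e\<close> both in \<open>N\<close> and modulo \<open>Z\<close>. Then \<open>N\<close> is a semidirect product of an abelian normal subgroup by
  \<open>\<langle>w\<rangle>\<close>, and inversion on the normal subgroup extends to an automorphism of \<open>N\<close>. This automorphism
  fixes commutators, so \<open>e = 2\<close>; its image in \<open>N\<close> is an involution commuting with \<open>w\<close>, which
  forces it to be inner, so it fixes \<open>Z\<close> and \<open>Z\<close> has order two.

  Completeness of \<open>K\<close> is read off from the automorphisms of the factor \<open>L\<close>; a homomorphism
  from \<open>K\<close> onto a group of order two would give an automorphism of \<open>G\<close> that is trivial on \<open>N\<close>, moves
  \<open>L\<close> and commutes with all inner automorphisms. But such an automorphism has to be
  conjugation by an element of \<open>N\<close>, which fixes \<open>L\<close>.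

  Conversely, for complete \<open>K\<close> with abelianization of odd order, both factors of \<open>D_4 \<times> K\<close> are
  preserved by every automorphism (\<open>stable_dihedral_times_complete\<close>), \<open>Aut D_4\<close> is isomorphic to
  \<open>D_4\<close>, and \<open>Aut K\<close> to \<open>K\<close>.\<close>

section \<open>Counting characters\<close>

text \<open>Lagrange for a union \<open>S\<close> of cosets of \<open>H\<close>: a function whose fibres on \<open>S\<close> are exactly these cosets
  counts them.\<close>

lemma (in group) card_eq_card_image_times:
  assumes H: "subgroup H G" and S: "finite S" "S \<subseteq> carrier G"
    and closed: "\<And>h x. h \<in> H \<Longrightarrow> x \<in> S \<Longrightarrow> h \<otimes> x \<in> S"
    and fib: "\<And>x y. x \<in> S \<Longrightarrow> y \<in> S \<Longrightarrow> f x = f y \<longleftrightarrow> x \<otimes> inv y \<in> H"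
  shows "card S = card (f ` S) * card H"
proof -
  have Hc: "\<And>h. h \<in> H \<Longrightarrow> h \<in> carrier G"
    using H by (meson subgroup.mem_carrier)
  have Sc: "\<And>x. x \<in> S \<Longrightarrow> x \<in> carrier G"
    using S by auto
  have fibre: "card {x \<in> S. f x = v} = card H" if v: "v \<in> f ` S" for v
  proof -
    from v obtain y where y: "y \<in> S" "v = f y" by auto
    have yc: "y \<in> carrier G" using Sc y by blast
    have "bij_betw (\<lambda>h. h \<otimes> y) H {x \<in> S. f x = v}"
    proof (rule bij_betw_imageI)
      show "inj_on (\<lambda>h. h \<otimes> y) H"
        using yc by (auto intro!: inj_onI simp: Hc)
      show "(\<lambda>h. h \<otimes> y) ` H = {x \<in> S. f x = v}"
      proof (intro equalityI subsetI)
        fix x assume "x \<in> (\<lambda>h. h \<otimes> y) ` H"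
        then obtain h where h: "h \<in> H" "x = h \<otimes> y" by auto
        have "x \<in> S" using closed h y by blast
        moreover have "x \<otimes> inv y = h" using h yc Hc[of h] by (simp add: m_assoc)
        ultimately show "x \<in> {x \<in> S. f x = v}"
          using fib[of x y] h y by simp
      next
        fix x assume "x \<in> {x \<in> S. f x = v}"
        then have x: "x \<in> S" "f x = f y" using y by auto
        then have "x \<otimes> inv y \<in> H" using fib y by blast
        moreover have "x = x \<otimes> inv y \<otimes> y" using Sc[OF x(1)] yc by (simp add: m_assoc)
        ultimately show "x \<in> (\<lambda>h. h \<otimes> y) ` H" by blast
      qed
    qed
    then show ?thesis by (simp add: bij_betw_same_card)
  qed
  have "card S = (\<Sum>v \<in> f ` S. card {x \<in> S. f x = v})"
    using sum.image_gen[OF S(1), of "\<lambda>_. 1::nat" f] by simp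
  also have "\<dots> = card (f ` S) * card H" using fibre by simp
  finally show ?thesis .
qed

text \<open>A character is a homomorphism to the integers modulo \<open>n\<close>. It is required to be extensional so that
  the characters with prescribed values on \<open>T\<close> form a finite set.\<close>

definition char_extensions ::
  "('a, 'm) monoid_scheme \<Rightarrow> nat \<Rightarrow> 'a set \<Rightarrow> ('a \<Rightarrow> int) \<Rightarrow> ('a \<Rightarrow> int) set"
  where "char_extensions G n T \<chi> =
    {\<psi> \<in> hom G (integer_mod_group n). \<psi> \<in> extensional (carrier G) \<and> (\<forall>t \<in> T. \<psi> t = \<chi> t)}"

lemma hom_integer_mod_group_iff:
  assumes "n > 0"
  shows "\<psi> \<in> hom G (integer_mod_group n) \<longleftrightarrow>
    (\<forall>x \<in> carrier G. 0 \<le> \<psi> x \<and> \<psi> x < int n) \<and>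
    (\<forall>x \<in> carrier G. \<forall>y \<in> carrier G. \<psi> (x \<otimes>\<^bsub>G\<^esub> y) = (\<psi> x + \<psi> y) mod int n)"
  unfolding hom_def using assms by (simp add: carrier_integer_mod_group Pi_iff)

lemma (in group) char_int_pow:
  assumes "\<psi> \<in> hom G (integer_mod_group n)" "x \<in> carrier G"
  shows "\<psi> (x [^] (i :: int)) = (i * \<psi> x) mod int n"
proof -
  have "\<psi> (x [^] i) = \<psi> x [^]\<^bsub>integer_mod_group n\<^esub> i"
    using assms by (intro hom_int_pow group_integer_mod_group) auto
  then show ?thesis by (simp add: int_pow_integer_mod_group)
qed

lemma finite_char_extensions:
  assumes "finite (carrier G)" "n > 0"
  shows "finite (char_extensions G n T \<chi>)"
proof (rule finite_subset)
  show "char_extensions G n T \<chi> \<subseteq> carrier G \<rightarrow>\<^sub>E {0..<int n}"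
    using assms by (auto simp: char_extensions_def hom_integer_mod_group_iff PiE_iff extensional_def)
  show "finite (carrier G \<rightarrow>\<^sub>E {0..<int n})"
    using assms by (intro finite_PiE) auto
qed

text \<open>These are the possible values of an extended character at a new element whose first power in the
  old subgroup is the \<open>k\<close>-th.\<close>

lemma card_linear_congruence_solutions:
  fixes k n :: nat and m :: int
  assumes "n > 0" "k dvd n" and m: "(int (n div k) * m) mod int n = 0"
  shows "card {d. 0 \<le> d \<and> d < int n \<and> (int k * d) mod int n = m mod int n} = k"
proof -
  from \<open>k dvd n\<close> obtain q where q: "n = k * q" by auto
  have pos: "k > 0" "q > 0" using \<open>n > 0\<close> q by auto
  have "int k * int q dvd int q * m" using m q pos by (simp add: mod_eq_0_iff_dvd)
  then have "int k dvd m" using pos by (simp add: mult.commute)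
  then obtain m' where m': "m = int k * m'" by auto
  have eq: "{d. 0 \<le> d \<and> d < int n \<and> (int k * d) mod int n = m mod int n}
     = (\<lambda>j. m' mod int q + int q * int j) ` {..<k}" (is "?A = ?B")
  proof (intro equalityI subsetI)
    fix d assume d: "d \<in> ?A"
    then have "int k * (d mod int q) = int k * (m' mod int q)"
      using q m' unfolding mult_mod_right by (simp only: of_nat_mult mem_Collect_eq)
    then have dm: "d mod int q = m' mod int q" using pos by simp
    have dd: "d = d mod int q + int q * (d div int q)" by simp
    have "d div int q \<ge> 0" using d pos by (simp add: pos_imp_zdiv_nonneg_iff)
    moreover have "d div int q < int k"
    proof (rule ccontr)
      assume "\<not> d div int q < int k"
      then have "int q * int k \<le> int q * (d div int q)" by (intro mult_left_mono) auto
      moreover have "0 \<le> d mod int q" using pos by simp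
      ultimately have "int q * int k \<le> d" using dd by linarith
      then show False using d q by (simp add: mult.commute)
    qed
    ultimately show "d \<in> ?B"
      using dd dm by (intro image_eqI[of _ _ "nat (d div int q)"]) auto
  next
    fix d assume "d \<in> ?B"
    then obtain j where j: "j < k" "d = m' mod int q + int q * int j" by auto
    have r: "0 \<le> m' mod int q" "m' mod int q < int q" using pos by auto
    have "int q * int j \<le> int q * (int k - 1)" using j pos by (intro mult_left_mono) auto
    then have "d < int n" using j r q by (simp add: algebra_simps)
    moreover have "(int k * d) mod int n = m mod int n"
    proof -
      have "(int k * d) mod int n = int k * (d mod int q)"
        unfolding q of_nat_mult mult_mod_right ..
      also have "d mod int q = m' mod int q" using j by simp
      also have "int k * (m' mod int q) = m mod int n"
        unfolding q m' of_nat_mult mult_mod_right ..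
      finally show ?thesis .
    qed
    ultimately show "d \<in> ?A" using j r by simp
  qed
  have "inj_on (\<lambda>j. m' mod int q + int q * int j) {..<k}"
    using pos by (auto intro!: inj_onI)
  then show ?thesis unfolding eq by (simp add: card_image)
qed


lemma (in group) least_power_in_subgroup:
  assumes T: "subgroup T G" and a: "a \<in> carrier G" and n: "n > 0" "a [^] (n :: nat) \<in> T"
  obtains k :: nat where "k > 0" "\<And>i :: int. a [^] i \<in> T \<longleftrightarrow> int k dvd i"
proof -
  define k where "k = (LEAST k. k > 0 \<and> a [^] (k :: nat) \<in> T)"
  have k: "k > 0 \<and> a [^] k \<in> T"
    unfolding k_def by (rule LeastI[of _ n]) (use n in auto)
  have least: "k \<le> j" if "j > 0" "a [^] (j :: nat) \<in> T" for j
    unfolding k_def by (rule Least_le) (use that in auto)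
  have mult: "a [^] (int k * q) \<in> T" for q
  proof -
    have "a [^] (int k * q) = (a [^] int k) [^] q" using a by (simp add: int_pow_pow)
    moreover have "a [^] int k \<in> T" using k by (simp add: int_pow_int)
    ultimately show ?thesis using T a subgroup_int_pow_closed by metis
  qed
  have "a [^] i \<in> T \<longleftrightarrow> int k dvd i" for i :: int
  proof
    assume i: "a [^] i \<in> T"
    have "i = int k * (i div int k) + i mod int k" by simp
    then have "a [^] i = a [^] (int k * (i div int k)) \<otimes> a [^] (i mod int k)"
      using a by (metis int_pow_mult)
    then have "a [^] (i mod int k) = inv (a [^] (int k * (i div int k))) \<otimes> a [^] i"
      using a by (simp add: inv_solve_left)
    then have "a [^] (i mod int k) \<in> T"
      using i mult T by (simp add: subgroup.m_closed subgroup.m_inv_closed)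
    moreover define j where "j = nat (i mod int k)"
    moreover have j: "int j = i mod int k" "j < k" using k by (auto simp: j_def nat_less_iff)
    ultimately have "a [^] j \<in> T" by (metis int_pow_int)
    then have "j = 0" using least[of j] j by fastforce
    then show "int k dvd i" using j by auto
  next
    assume "int k dvd i"
    then show "a [^] i \<in> T" using mult by auto
  qed
  with k that show ?thesis by blast
qed

text \<open>The subgroup generated by \<open>T\<close> and \<open>a\<close> has this simple form whenever \<open>T\<close> contains all commutators.\<close>

definition adjoin :: "('a, 'm) monoid_scheme \<Rightarrow> 'a set \<Rightarrow> 'a \<Rightarrow> 'a set"
  where "adjoin G T a = {t \<otimes>\<^bsub>G\<^esub> a [^]\<^bsub>G\<^esub> (i :: int) | t i. t \<in> T}"

context group
begin

lemma commutator_swap: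
  assumes "x \<in> carrier G" "y \<in> carrier G"
  shows "x \<otimes> y = (x \<otimes> y \<otimes> inv x \<otimes> inv y) \<otimes> y \<otimes> x"
  using assms by (simp add: m_assoc)

lemma mult_int_pow_swap:
  assumes T: "subgroup T G" and a: "a \<in> carrier G"
    and comm: "\<forall>x \<in> carrier G. \<forall>y \<in> carrier G. x \<otimes> y \<otimes> inv x \<otimes> inv y \<in> T"
    and s: "s \<in> T" "t \<in> T"
  defines "u \<equiv> \<lambda>i :: int. a [^] i \<otimes> s \<otimes> inv (a [^] i) \<otimes> inv s"
  shows "t \<otimes> a [^] (i :: int) \<otimes> (s \<otimes> a [^] (j :: int)) = (t \<otimes> (u i \<otimes> s)) \<otimes> a [^] (i + j)"
    and "u i \<in> T"
proof -
  have c: "s \<in> carrier G" "t \<in> carrier G" using s T by (auto dest: subgroup.mem_carrier)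
  show "u i \<in> T" unfolding u_def using comm a c by simp
  have "a [^] i \<otimes> s = u i \<otimes> s \<otimes> a [^] i"
    unfolding u_def using a c by (intro commutator_swap) auto
  moreover have uc: "u i \<in> carrier G" unfolding u_def using a c by simp
  ultimately show "t \<otimes> a [^] i \<otimes> (s \<otimes> a [^] j) = (t \<otimes> (u i \<otimes> s)) \<otimes> a [^] (i + j)"
    using a c by (simp add: int_pow_mult m_assoc flip: m_assoc[of "a [^] i" s])
qed

lemma subgroup_adjoin:
  assumes T: "subgroup T G" and a: "a \<in> carrier G"
    and comm: "\<forall>x \<in> carrier G. \<forall>y \<in> carrier G. x \<otimes> y \<otimes> inv x \<otimes> inv y \<in> T"
  shows "subgroup (adjoin G T a) G" "T \<subseteq> adjoin G T a" "a \<in> adjoin G T a"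
proof -
  have Tc: "\<And>t. t \<in> T \<Longrightarrow> t \<in> carrier G" using T by (auto dest: subgroup.mem_carrier)
  have one: "\<one> \<in> T" using T by (rule subgroup.one_closed)
  show sub: "T \<subseteq> adjoin G T a"
    unfolding adjoin_def using Tc by (force intro: exI[of _ "0::int"])
  show "a \<in> adjoin G T a"
    unfolding adjoin_def using one a by (auto intro!: exI[of _ \<one>] exI[of _ "1::int"])
  have mult: "t \<otimes> a [^] i \<otimes> (s \<otimes> a [^] j) \<in> adjoin G T a"
    if "t \<in> T" "s \<in> T" for s t and i j :: int
    unfolding adjoin_def mult_int_pow_swap(1)[OF T a comm that(2,1)]
    using that mult_int_pow_swap(2)[OF T a comm that(2,1), of i]
    by (blast intro: subgroup.m_closed[OF T])
  show "subgroup (adjoin G T a) G"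
  proof (rule subgroupI)
    show "adjoin G T a \<subseteq> carrier G" unfolding adjoin_def using Tc a by auto
    show "adjoin G T a \<noteq> {}" using sub one by auto
  next
    fix g assume "g \<in> adjoin G T a"
    then obtain t i where g: "g = t \<otimes> a [^] (i::int)" "t \<in> T" unfolding adjoin_def by auto
    have "inv g = \<one> \<otimes> a [^] (-i) \<otimes> (inv t \<otimes> a [^] (0::int))"
      using g a Tc by (simp add: inv_mult_group int_pow_neg)
    then show "inv g \<in> adjoin G T a"
      using mult[of \<one> "inv t" "-i" 0] one g T by (simp add: subgroup.m_inv_closed)
  next
    fix g h assume "g \<in> adjoin G T a" "h \<in> adjoin G T a"
    then obtain t i s j where g: "g = t \<otimes> a [^] (i::int)" "t \<in> T"
      "h = s \<otimes> a [^] (j::int)" "s \<in> T" unfolding adjoin_def by blast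
    then show "g \<otimes> h \<in> adjoin G T a" using mult by simp
  qed
qed

lemma adjoin_quotient:
  assumes T: "subgroup T G" and a: "a \<in> carrier G" and ts: "t \<in> T" "s \<in> T"
    and k: "\<And>i :: int. a [^] i \<in> T \<longleftrightarrow> int k dvd i"
  shows "(t \<otimes> a [^] (i :: int)) \<otimes> inv (s \<otimes> a [^] (j :: int)) \<in> T \<longleftrightarrow> int k dvd i - j"
proof -
  have c: "s \<in> carrier G" "t \<in> carrier G" using ts T by (auto dest: subgroup.mem_carrier)
  have "(t \<otimes> a [^] i) \<otimes> inv (s \<otimes> a [^] j) = t \<otimes> a [^] (i - j) \<otimes> inv s"
    using a c by (simp add: inv_mult_group int_pow_diff m_assoc)
  moreover have "t \<otimes> a [^] (i - j) \<otimes> inv s \<in> T \<longleftrightarrow> a [^] (i - j) \<in> T"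
  proof
    assume "t \<otimes> a [^] (i - j) \<otimes> inv s \<in> T"
    then have "inv t \<otimes> (t \<otimes> a [^] (i - j) \<otimes> inv s) \<otimes> s \<in> T"
      using ts T by (simp add: subgroup.m_closed subgroup.m_inv_closed)
    then show "a [^] (i - j) \<in> T" using a c by (simp add: m_assoc flip: m_assoc[of "inv t" t])
  qed (use ts T in \<open>simp add: subgroup.m_closed subgroup.m_inv_closed\<close>)
  ultimately show ?thesis using k by simp
qed

lemma card_adjoin:
  assumes T: "subgroup T G" and a: "a \<in> carrier G" and fin: "finite (carrier G)"
    and comm: "\<forall>x \<in> carrier G. \<forall>y \<in> carrier G. x \<otimes> y \<otimes> inv x \<otimes> inv y \<in> T"
    and k: "k > 0" "\<And>i :: int. a [^] i \<in> T \<longleftrightarrow> int k dvd i"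
  shows "card (adjoin G T a) = k * card T"
proof -
  note ad = subgroup_adjoin[OF T a comm]
  define f where "f g = (SOME i :: int. \<exists>t \<in> T. g = t \<otimes> a [^] i) mod int k" for g
  have f: "f (t \<otimes> a [^] i) = i mod int k" if "t \<in> T" for t and i :: int
  proof -
    define j where "j = (SOME j :: int. \<exists>s \<in> T. t \<otimes> a [^] i = s \<otimes> a [^] j)"
    have "\<exists>s \<in> T. t \<otimes> a [^] i = s \<otimes> a [^] j"
      unfolding j_def by (rule someI[of _ i]) (use that in auto)
    then obtain s where s: "s \<in> T" "t \<otimes> a [^] i = s \<otimes> a [^] j" by auto
    have "t \<otimes> a [^] i \<otimes> inv (s \<otimes> a [^] j) \<in> T"
      unfolding s(2)[symmetric] using that a subgroup.mem_carrier[OF T, of t] subgroup.one_closed[OF T] by simp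
    then have "int k dvd i - j" using adjoin_quotient[OF T a that s(1) k(2)] by simp
    then have "j mod int k = i mod int k" by (simp add: mod_eq_dvd_iff dvd_diff_commute)
    then show ?thesis unfolding f_def j_def by simp
  qed
  have "card (adjoin G T a) = card (f ` adjoin G T a) * card T"
  proof (rule card_eq_card_image_times[OF T])
    show "adjoin G T a \<subseteq> carrier G" using ad(1) subgroup.subset by blast
    then show "finite (adjoin G T a)" using fin finite_subset by blast
    show "h \<otimes> x \<in> adjoin G T a" if "h \<in> T" "x \<in> adjoin G T a" for h x
      using that ad by (meson subgroup.m_closed subsetD)
    show "f x = f y \<longleftrightarrow> x \<otimes> inv y \<in> T" if "x \<in> adjoin G T a" "y \<in> adjoin G T a" for x y
    proof -
      from that obtain t i s j where g: "x = t \<otimes> a [^] (i::int)" "t \<in> T"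
        "y = s \<otimes> a [^] (j::int)" "s \<in> T" unfolding adjoin_def by auto
      show ?thesis unfolding g using f g adjoin_quotient[OF T a g(2,4) k(2)]
        by (simp add: mod_eq_dvd_iff)
    qed
  qed
  also have "f ` adjoin G T a = {0..<int k}"
  proof (intro equalityI subsetI)
    fix r assume "r \<in> f ` adjoin G T a"
    then obtain t i where "t \<in> T" "r = f (t \<otimes> a [^] (i::int))" unfolding adjoin_def by auto
    then show "r \<in> {0..<int k}" using f k by simp
  next
    fix r assume r: "r \<in> {0..<int k}"
    have "f (\<one> \<otimes> a [^] r) = r" using f[of \<one> r] subgroup.one_closed[OF T] r by simp
    moreover have "\<one> \<otimes> a [^] r \<in> adjoin G T a"
      unfolding adjoin_def using subgroup.one_closed[OF T] by blast
    ultimately show "r \<in> f ` adjoin G T a" by (metis imageI)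
  qed
  finally show ?thesis by simp
qed

text \<open>A character of \<open>T\<close> extends to \<open>T\<close> with \<open>a\<close> adjoined once a value \<open>d\<close> at \<open>a\<close> is
  chosen compatibly with the value at the first power of \<open>a\<close> lying in \<open>T\<close>.\<close>

lemma char_extends_to_adjoin:
  assumes T: "subgroup T G" and a: "a \<in> carrier G" and n: "n > 0"
    and comm: "\<forall>x \<in> carrier G. \<forall>y \<in> carrier G. x \<otimes> y \<otimes> inv x \<otimes> inv y \<in> T"
    and comm0: "\<forall>x \<in> carrier G. \<forall>y \<in> carrier G. \<chi> (x \<otimes> y \<otimes> inv x \<otimes> inv y) = 0"
    and \<chi>: "\<chi> \<in> hom (G\<lparr>carrier := T\<rparr>) (integer_mod_group n)"
    and k: "k > 0" "\<And>i :: int. a [^] i \<in> T \<longleftrightarrow> int k dvd i"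
    and d: "0 \<le> d" "d < int n" "(int k * d) mod int n = \<chi> (a [^] k)"
  obtains \<psi> where "\<psi> \<in> hom (G\<lparr>carrier := adjoin G T a\<rparr>) (integer_mod_group n)"
    "\<And>t. t \<in> T \<Longrightarrow> \<psi> t = \<chi> t" "\<psi> a = d"
    "\<And>t i. t \<in> T \<Longrightarrow> \<psi> (t \<otimes> a [^] (i :: int)) = (\<chi> t + i * d) mod int n"
proof -
  have Tc: "\<And>t. t \<in> T \<Longrightarrow> t \<in> carrier G" using T by (auto dest: subgroup.mem_carrier)
  have one: "\<one> \<in> T" using T by (rule subgroup.one_closed)
  note ad = subgroup_adjoin[OF T a comm]
  interpret T: group "G\<lparr>carrier := T\<rparr>" using T by (rule subgroup.subgroup_is_group) (rule is_group)
  have \<chi>r: "0 \<le> \<chi> t" "\<chi> t < int n" if "t \<in> T" for t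
    using \<chi> that hom_integer_mod_group_iff[OF n, of \<chi> "G\<lparr>carrier := T\<rparr>"] by auto
  have \<chi>m: "\<chi> (s \<otimes> t) = (\<chi> s + \<chi> t) mod int n" if "s \<in> T" "t \<in> T" for s t
    using \<chi> that hom_integer_mod_group_iff[OF n, of \<chi> "G\<lparr>carrier := T\<rparr>"] by auto
  have \<chi>0: "\<chi> \<one> = 0"
    using hom_one[OF \<chi> T.is_group group_integer_mod_group] by simp
  define rep where "rep g = (SOME p. fst p \<in> T \<and> g = fst p \<otimes> a [^] (snd p :: int))" for g
  define \<psi> where "\<psi> g = (\<chi> (fst (rep g)) + snd (rep g) * d) mod int n" for g
  have \<psi>: "\<psi> (t \<otimes> a [^] i) = (\<chi> t + i * d) mod int n" if t: "t \<in> T" for t and i :: int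
  proof -
    define g where "g = t \<otimes> a [^] i"
    obtain s j where sj: "rep g = (s, j)" by (cases "rep g")
    have "fst (rep g) \<in> T \<and> g = fst (rep g) \<otimes> a [^] snd (rep g)"
      unfolding rep_def by (rule someI[of _ "(t, i)"]) (use t g_def in auto)
    then have s: "s \<in> T" "t \<otimes> a [^] i = s \<otimes> a [^] j" using sj g_def by auto
    have st: "inv s \<otimes> t = a [^] (j - i)"
    proof -
      have "t = s \<otimes> a [^] j \<otimes> inv (a [^] i)"
        using s(2) t Tc a by (metis int_pow_closed inv_solve_right m_closed)
      then have "inv s \<otimes> t = inv s \<otimes> (s \<otimes> (a [^] j \<otimes> inv (a [^] i)))"
        using s Tc a by (simp add: m_assoc)
      also have "\<dots> = a [^] j \<otimes> inv (a [^] i)"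
        using s Tc a by (simp flip: m_assoc)
      finally show ?thesis using a by (simp add: int_pow_diff)
    qed
    have "a [^] (j - i) \<in> T"
      unfolding st[symmetric] using s t T by (simp add: subgroup.m_closed subgroup.m_inv_closed)
    then have "int k dvd j - i" using k by blast
    then obtain q where q: "j - i = int k * q" by auto
    have ak: "a [^] k \<in> T" using k(2)[of "int k"] by (simp add: int_pow_int)
    have "\<chi> (a [^] (j - i)) = (q * \<chi> (a [^] k)) mod int n"
    proof -
      have "a [^] (j - i) = (a [^] k) [^] q"
        unfolding q using a int_pow_pow[of a "int k" q] by (simp add: int_pow_int)
      also have "\<dots> = (a [^] k) [^]\<^bsub>G\<lparr>carrier := T\<rparr>\<^esub> q"
        using int_pow_consistent[OF T ak] by simp
      finally show ?thesis using T.char_int_pow[OF \<chi>, of "a [^] k" q] ak by simp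
    qed
    also have "\<dots> = (q * (int k * d)) mod int n" using d(3) by (metis mod_mult_right_eq)
    finally have e1: "\<chi> (a [^] (j - i)) = ((j - i) * d) mod int n"
      unfolding q by (simp add: algebra_simps)
    have "t = s \<otimes> a [^] (j - i)"
      using st s t Tc a by (metis int_pow_closed inv_solve_left m_closed inv_closed inv_inv)
    then have "\<chi> t = (\<chi> s + \<chi> (a [^] (j - i))) mod int n"
      using \<chi>m s \<open>a [^] (j - i) \<in> T\<close> by metis
    then have "\<chi> t = (\<chi> s + (j - i) * d) mod int n"
      using e1 by (simp add: mod_add_right_eq)
    then have "(\<chi> t + i * d) mod int n = (\<chi> s + (j - i) * d + i * d) mod int n"
      by (simp add: mod_add_left_eq)
    also have "\<dots> = (\<chi> s + j * d) mod int n"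
      by (simp add: algebra_simps)
    finally show ?thesis unfolding \<psi>_def using sj g_def by simp
  qed
  have \<psi>T: "\<psi> t = \<chi> t" if "t \<in> T" for t
    using \<psi>[OF that, of 0] that Tc \<chi>r[OF that] by simp
  have \<psi>a: "\<psi> a = d"
    using \<psi>[OF one, of 1] a \<chi>0 d by simp
  have "\<psi> \<in> hom (G\<lparr>carrier := adjoin G T a\<rparr>) (integer_mod_group n)"
    unfolding hom_integer_mod_group_iff[OF n]
  proof (intro conjI ballI)
    fix g assume "g \<in> carrier (G\<lparr>carrier := adjoin G T a\<rparr>)"
    show "0 \<le> \<psi> g" "\<psi> g < int n" unfolding \<psi>_def using n by auto
  next
    fix g h
    assume "g \<in> carrier (G\<lparr>carrier := adjoin G T a\<rparr>)" "h \<in> carrier (G\<lparr>carrier := adjoin G T a\<rparr>)"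
    then obtain t i s j where g: "g = t \<otimes> a [^] (i::int)" "t \<in> T"
      "h = s \<otimes> a [^] (j::int)" "s \<in> T" unfolding adjoin_def by auto
    define u where "u = a [^] i \<otimes> s \<otimes> inv (a [^] i) \<otimes> inv s"
    have u: "u \<in> T" "\<chi> u = 0" using comm comm0 a Tc g(4) unfolding u_def by auto
    have "g \<otimes> h = (t \<otimes> (u \<otimes> s)) \<otimes> a [^] (i + j)"
      unfolding g(1,3) u_def by (rule mult_int_pow_swap(1)[OF T a comm g(4,2)])
    moreover have ts: "t \<otimes> (u \<otimes> s) \<in> T" using u g T by (simp add: subgroup.m_closed)
    ultimately have "\<psi> (g \<otimes> h) = (\<chi> (t \<otimes> (u \<otimes> s)) + (i + j) * d) mod int n"
      using \<psi> by simp
    also have "\<chi> (t \<otimes> (u \<otimes> s)) = (\<chi> t + \<chi> s) mod int n"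
      using \<chi>m g u T \<chi>r by (simp add: subgroup.m_closed)
    also have "((\<chi> t + \<chi> s) mod int n + (i + j) * d) mod int n = (\<psi> g + \<psi> h) mod int n"
    proof -
      have "((\<chi> t + \<chi> s) mod int n + (i + j) * d) mod int n
          = ((\<chi> t + i * d) + (\<chi> s + j * d)) mod int n"
        unfolding mod_add_left_eq by (simp add: algebra_simps)
      then show ?thesis using \<psi> g by (simp add: mod_add_eq)
    qed
    finally show "\<psi> (g \<otimes>\<^bsub>G\<lparr>carrier := adjoin G T a\<rparr>\<^esub> h) = (\<psi> g + \<psi> h) mod int n" by simp
  qed
  with that \<psi>T \<psi>a \<psi> show ?thesis by blast
qed

end

text \<open>Adjoining an element \<open>a\<close> to \<open>T\<close> multiplies the order of \<open>T\<close> by the least \<open>k\<close> with \<open>a^k\<close> in \<open>T\<close>, and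
  splits the extensions according to their value at \<open>a\<close>, for which there are exactly \<open>k\<close> choices. So
  the number of extensions is the index of \<open>T\<close>. The hypotheses say that \<open>\<chi>\<close> does not notice
  commutators and \<open>n\<close>-th powers, as is necessary for a character that extends.\<close>

theorem (in group) card_char_extensions:
  assumes fin: "finite (carrier G)" and n: "n > 0"
    and "subgroup T G"
    and "\<forall>x \<in> carrier G. \<forall>y \<in> carrier G. x \<otimes> y \<otimes> inv x \<otimes> inv y \<in> T"
    and "\<forall>x \<in> carrier G. \<forall>y \<in> carrier G. \<chi> (x \<otimes> y \<otimes> inv x \<otimes> inv y) = 0"
    and "\<forall>x \<in> carrier G. x [^] n \<in> T \<and> \<chi> (x [^] n) = 0"
    and "\<chi> \<in> hom (G\<lparr>carrier := T\<rparr>) (integer_mod_group n)"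
  shows "card (char_extensions G n T \<chi>) * card T = order G"
  using assms(3-)
proof (induction "order G - card T" arbitrary: T \<chi> rule: less_induct)
  case less
  note T = less.prems(1) and comm = less.prems(2) and comm0 = less.prems(3)
    and pow = less.prems(4) and \<chi> = less.prems(5)
  note IH = less.hyps
  have Tsub: "T \<subseteq> carrier G" using T by (rule subgroup.subset)
  show ?case
  proof (cases "T = carrier G")
    case True
    have "char_extensions G n T \<chi> = {restrict \<chi> (carrier G)}"
      using \<chi> unfolding char_extensions_def True hom_integer_mod_group_iff[OF n]
      by (auto simp: extensional_def)
    then show ?thesis using True by (simp add: order_def)
  next
    case False
    then obtain a where a: "a \<in> carrier G" "a \<notin> T" using Tsub by blast
    obtain k :: nat where k: "k > 0" "\<And>i :: int. a [^] i \<in> T \<longleftrightarrow> int k dvd i"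
      using least_power_in_subgroup[OF T a(1) n] pow a(1) by blast
    have ak: "a [^] k \<in> T" using k(2)[of "int k"] by (simp add: int_pow_int)
    have kn: "k dvd n" using k(2)[of "int n"] pow a(1) by (simp add: int_pow_int)
    interpret T: group "G\<lparr>carrier := T\<rparr>" using T by (rule subgroup.subgroup_is_group) (rule is_group)
    have \<chi>r: "0 \<le> \<chi> t \<and> \<chi> t < int n" if "t \<in> T" for t
      using \<chi> that hom_integer_mod_group_iff[OF n, of \<chi> "G\<lparr>carrier := T\<rparr>"] by auto
    define D where "D = {d. 0 \<le> d \<and> d < int n \<and> (int k * d) mod int n = \<chi> (a [^] k) mod int n}"
    have "(int (n div k) * \<chi> (a [^] k)) mod int n = 0"
    proof -
      have "a [^] n = (a [^] k) [^] int (n div k)"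
        using a kn by (simp add: int_pow_int nat_pow_pow)
      also have "\<dots> = (a [^] k) [^]\<^bsub>G\<lparr>carrier := T\<rparr>\<^esub> int (n div k)"
        using int_pow_consistent[OF T ak] by simp
      finally have "\<chi> (a [^] n) = (int (n div k) * \<chi> (a [^] k)) mod int n"
        using T.char_int_pow[OF \<chi>, of "a [^] k" "int (n div k)"] ak by simp
      then show ?thesis using pow a by simp
    qed
    then have cardD: "card D = k"
      unfolding D_def by (rule card_linear_congruence_solutions[OF n kn])
    have "\<exists>\<psi>. \<psi> \<in> hom (G\<lparr>carrier := adjoin G T a\<rparr>) (integer_mod_group n) \<and>
        (\<forall>t \<in> T. \<psi> t = \<chi> t) \<and> \<psi> a = d \<and>
        (\<forall>t \<in> T. \<forall>i :: int. \<psi> (t \<otimes> a [^] i) = (\<chi> t + i * d) mod int n)" if "d \<in> D" for d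
    proof -
      have d: "0 \<le> d" "d < int n" "(int k * d) mod int n = \<chi> (a [^] k)"
        using that \<chi>r[OF ak] by (auto simp: D_def)
      show ?thesis
        by (rule char_extends_to_adjoin[OF T a(1) n comm comm0 \<chi> k d]) blast
    qed
    then obtain \<psi> where \<psi>: "\<And>d. d \<in> D \<Longrightarrow> \<psi> d \<in> hom (G\<lparr>carrier := adjoin G T a\<rparr>) (integer_mod_group n)"
      "\<And>d t. d \<in> D \<Longrightarrow> t \<in> T \<Longrightarrow> \<psi> d t = \<chi> t" "\<And>d. d \<in> D \<Longrightarrow> \<psi> d a = d"
      "\<And>d t i. d \<in> D \<Longrightarrow> t \<in> T \<Longrightarrow> \<psi> d (t \<otimes> a [^] (i :: int)) = (\<chi> t + i * d) mod int n"
      by metis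
    note ad = subgroup_adjoin[OF T a(1) comm]
    have adsub: "adjoin G T a \<subseteq> carrier G" using ad(1) by (rule subgroup.subset)
    have less: "card T < card (adjoin G T a)"
      using ad a adsub fin by (intro psubset_card_mono) (auto intro: finite_subset)
    have "card (adjoin G T a) \<le> order G"
      unfolding order_def using adsub fin by (rule card_mono[rotated])
    then have dec: "order G - card (adjoin G T a) < order G - card T" using less by simp
    have E: "card (char_extensions G n (adjoin G T a) (\<psi> d)) * card (adjoin G T a) = order G"
      if d: "d \<in> D" for d
      using comm comm0 pow ad \<psi>(2)[OF d]
      by (intro IH[OF dec ad(1) _ _ _ \<psi>(1)[OF d]]) auto
    have split: "char_extensions G n T \<chi> = (\<Union>d \<in> D. char_extensions G n (adjoin G T a) (\<psi> d))"
    proof (intro equalityI subsetI)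
      fix \<phi> assume "\<phi> \<in> char_extensions G n T \<chi>"
      then have \<phi>: "\<phi> \<in> hom G (integer_mod_group n)" "\<phi> \<in> extensional (carrier G)"
        "\<And>t. t \<in> T \<Longrightarrow> \<phi> t = \<chi> t" by (auto simp: char_extensions_def)
      note \<phi>h = \<phi>(1)[unfolded hom_integer_mod_group_iff[OF n]]
      have "\<chi> (a [^] k) = (int k * \<phi> a) mod int n"
        using char_int_pow[OF \<phi>(1) a(1), of "int k"] \<phi>(3)[OF ak] by (simp add: int_pow_int)
      then have d: "\<phi> a \<in> D" using \<phi>h a unfolding D_def by simp
      have "\<phi> g = \<psi> (\<phi> a) g" if "g \<in> adjoin G T a" for g
      proof -
        from that obtain t i where g: "g = t \<otimes> a [^] (i::int)" "t \<in> T" unfolding adjoin_def by auto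
        have "\<phi> g = (\<phi> t + \<phi> (a [^] i)) mod int n"
          unfolding g using \<phi>h a g Tsub by auto
        also have "\<dots> = (\<chi> t + i * \<phi> a) mod int n"
          using char_int_pow[OF \<phi>(1) a(1)] \<phi>(3) g by (simp add: mod_add_right_eq)
        finally show ?thesis using \<psi>(4)[OF d] g by simp
      qed
      then show "\<phi> \<in> (\<Union>d \<in> D. char_extensions G n (adjoin G T a) (\<psi> d))"
        using \<phi> d by (auto simp: char_extensions_def)
    next
      fix \<phi> assume "\<phi> \<in> (\<Union>d \<in> D. char_extensions G n (adjoin G T a) (\<psi> d))"
      then show "\<phi> \<in> char_extensions G n T \<chi>"
        using ad(2) \<psi>(2) by (auto simp: char_extensions_def)
    qed
    have finD: "finite D" using cardD k(1) by (metis card_ge_0_finite)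
    have "card (char_extensions G n T \<chi>) = (\<Sum>d \<in> D. card (char_extensions G n (adjoin G T a) (\<psi> d)))"
      unfolding split
    proof (rule card_UN_disjoint[OF finD])
      show "\<forall>d \<in> D. finite (char_extensions G n (adjoin G T a) (\<psi> d))"
        using finite_char_extensions[OF fin n] by blast
      show "\<forall>d \<in> D. \<forall>d' \<in> D. d \<noteq> d' \<longrightarrow> char_extensions G n (adjoin G T a) (\<psi> d) \<inter>
          char_extensions G n (adjoin G T a) (\<psi> d') = {}"
        using \<psi>(3) ad(3) by (force simp: char_extensions_def)
    qed
    then have "card (char_extensions G n T \<chi>) * card (adjoin G T a) = k * order G"
      using E cardD by (simp add: sum_distrib_right)
    then show ?thesis
      using card_adjoin[OF T a(1) fin comm k] k(1) by (simp add: ac_simps)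
  qed
qed

corollary (in group) char_extension_exists:
  assumes "finite (carrier G)" "n > 0" "subgroup T G"
    and "\<forall>x \<in> carrier G. \<forall>y \<in> carrier G. x \<otimes> y \<otimes> inv x \<otimes> inv y \<in> T"
    and "\<forall>x \<in> carrier G. \<forall>y \<in> carrier G. \<chi> (x \<otimes> y \<otimes> inv x \<otimes> inv y) = 0"
    and "\<forall>x \<in> carrier G. x [^] n \<in> T \<and> \<chi> (x [^] n) = 0"
    and "\<chi> \<in> hom (G\<lparr>carrier := T\<rparr>) (integer_mod_group n)"
  obtains \<psi> where "\<psi> \<in> hom G (integer_mod_group n)" "\<And>t. t \<in> T \<Longrightarrow> \<psi> t = \<chi> t"
proof -
  have "card (char_extensions G n T \<chi>) * card T > 0"
    unfolding card_char_extensions[OF assms] order_def using assms(1) by (auto simp: card_gt_0_iff)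
  then have "char_extensions G n T \<chi> \<noteq> {}" by auto
  then show ?thesis using that by (auto simp: char_extensions_def)
qed

corollary (in group) card_chars_trivial_on:
  assumes "finite (carrier G)" "n > 0" "subgroup T G"
    and "\<forall>x \<in> carrier G. \<forall>y \<in> carrier G. x \<otimes> y \<otimes> inv x \<otimes> inv y \<in> T"
    and "\<forall>x \<in> carrier G. x [^] n \<in> T"
  shows "card (char_extensions G n T (\<lambda>_. 0)) * card T = order G"
  using assms
  by (intro card_char_extensions) (auto simp: hom_def carrier_integer_mod_group)

section \<open>The exponent of a finite abelian group\<close>

lemma (in comm_group) ord_mult_coprime:
  assumes x: "x \<in> carrier G" and y: "y \<in> carrier G" and co: "coprime (ord x) (ord y)"
  shows "ord (x \<otimes> y) = ord x * ord y"
proof (rule dvd_antisym)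
  show "ord (x \<otimes> y) dvd ord x * ord y" using x y by (rule abelian_ord_mul_divides)
  have *: "ord u dvd m" if u: "u \<in> carrier G" "v \<in> carrier G" "coprime (ord u) (ord v)"
    "(u \<otimes> v) [^] (m :: nat) = \<one>" for u v m
  proof -
    have "u [^] (m * ord v) = (u [^] m \<otimes> v [^] m) [^] ord v"
    proof -
      have "v [^] (m * ord v) = (v [^] ord v) [^] m"
        using u by (simp only: nat_pow_pow mult.commute)
      then have "v [^] (m * ord v) = \<one>" using u by simp
      then show ?thesis using u(1,2) by (simp add: nat_pow_distrib nat_pow_pow)
    qed
    also have "u [^] m \<otimes> v [^] m = \<one>" using u by (simp add: nat_pow_distrib)
    finally have "ord u dvd m * ord v" using u by (simp add: pow_eq_id)
    then show ?thesis using u(3) by (simp add: coprime_dvd_mult_left_iff)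
  qed
  have "(x \<otimes> y) [^] ord (x \<otimes> y) = \<one>" using x y by simp
  then have "ord x dvd ord (x \<otimes> y)" "ord y dvd ord (x \<otimes> y)"
    using *[OF x y co] *[OF y x] co x y by (simp_all add: m_comm coprime_commute)
  then show "ord x * ord y dvd ord (x \<otimes> y)" using co by (simp add: divides_mult)
qed

text \<open>If the order of \<open>y\<close> does not divide the largest order, attained by \<open>x\<close>, then some prime occurs to a
  higher power in the order of \<open>y\<close>. Replacing the corresponding prime power part of \<open>x\<close> by that of
  \<open>y\<close> gives an element of larger order.\<close>

lemma (in comm_group) exists_ord_eq_exponent:
  assumes fin: "finite (carrier G)"
  obtains x where "x \<in> carrier G" "\<And>y. y \<in> carrier G \<Longrightarrow> ord y dvd ord x"
proof -
  have "finite (ord ` carrier G)" "ord ` carrier G \<noteq> {}" using fin by auto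
  from Max_in[OF this] obtain x where x: "x \<in> carrier G" "ord x = Max (ord ` carrier G)" by auto
  have max: "ord z \<le> ord x" if "z \<in> carrier G" for z
    unfolding x(2) using that fin by simp
  have pos: "ord z > 0" if "z \<in> carrier G" for z using that fin ord_ge_1 by fastforce
  have "ord y dvd ord x" if y: "y \<in> carrier G" for y
  proof (rule ccontr)
    assume "\<not> ord y dvd ord x"
    then obtain p :: nat where p: "Factorial_Ring.prime p" "multiplicity p (ord y) > multiplicity p (ord x)"
      using pos[OF x(1)] pos[OF y] by (metis multiplicity_le_imp_dvd not_le neq0_conv)
    define i where "i = multiplicity p (ord x)"
    define j where "j = multiplicity p (ord y)"
    obtain u where u: "ord x = p ^ i * u" "\<not> p dvd u"
      using multiplicity_decompose'[of "ord x" p] pos[OF x(1)] p(1) by (auto simp: i_def prime_nat_iff)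
    obtain v where v: "ord y = p ^ j * v" "\<not> p dvd v"
      using multiplicity_decompose'[of "ord y" p] pos[OF y] p(1) by (auto simp: j_def prime_nat_iff)
    have nz: "p ^ i \<noteq> 0" "v \<noteq> 0" using p v pos[OF y] by auto
    have ox: "ord (x [^] (p ^ i)) = u"
      using x(1) u nz by (subst ord_pow) auto
    have oy: "ord (y [^] v) = p ^ j"
      using y v nz by (subst ord_pow) auto
    have "coprime u (p ^ j)"
      using u(2) p(1) by (metis coprime_commute coprime_power_right_iff prime_imp_coprime)
    then have "ord (x [^] (p ^ i) \<otimes> y [^] v) = u * p ^ j"
      using ox oy x(1) y by (subst ord_mult_coprime) auto
    moreover have "p ^ i < p ^ j" using p prime_gt_1_nat[OF p(1)] by (simp add: i_def j_def)
    then have "u * p ^ i < u * p ^ j" using u pos[OF x(1)] by (intro mult_strict_left_mono) auto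
    ultimately show False using max[of "x [^] (p ^ i) \<otimes> y [^] v"] x(1) y u by simp
  qed
  with x that show ?thesis by blast
qed

section \<open>Groups of nilpotency class two\<close>

definition commutator :: "('a, 'm) monoid_scheme \<Rightarrow> 'a \<Rightarrow> 'a \<Rightarrow> 'a"
  where "commutator G x y = x \<otimes>\<^bsub>G\<^esub> y \<otimes>\<^bsub>G\<^esub> inv\<^bsub>G\<^esub> x \<otimes>\<^bsub>G\<^esub> inv\<^bsub>G\<^esub> y"

context group
begin

lemma commutator_closed [simp]:
  "x \<in> carrier G \<Longrightarrow> y \<in> carrier G \<Longrightarrow> commutator G x y \<in> carrier G"
  by (simp add: commutator_def)

lemma inv_mult_cancel_left [simp]:
  "x \<in> carrier G \<Longrightarrow> y \<in> carrier G \<Longrightarrow> inv x \<otimes> (x \<otimes> y) = y"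
  "x \<in> carrier G \<Longrightarrow> y \<in> carrier G \<Longrightarrow> x \<otimes> (inv x \<otimes> y) = y"
  by (simp_all flip: m_assoc)

lemma mult_inv_eq_one_iff:
  "x \<in> carrier G \<Longrightarrow> y \<in> carrier G \<Longrightarrow> x \<otimes> inv y = \<one> \<longleftrightarrow> x = y"
  by (metis inv_closed inv_equality inv_inv r_inv)

lemma mult_eq_commutator:
  "x \<in> carrier G \<Longrightarrow> y \<in> carrier G \<Longrightarrow> x \<otimes> y = commutator G x y \<otimes> (y \<otimes> x)"
  by (simp add: commutator_def m_assoc)

lemma commutator_eq_one_iff:
  assumes "x \<in> carrier G" "y \<in> carrier G"
  shows "commutator G x y = \<one> \<longleftrightarrow> x \<otimes> y = y \<otimes> x"
proof -
  have "x \<otimes> y = y \<otimes> x \<longleftrightarrow> commutator G x y \<otimes> (y \<otimes> x) = \<one> \<otimes> (y \<otimes> x)"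
    using mult_eq_commutator[OF assms] assms by simp
  also have "\<dots> \<longleftrightarrow> commutator G x y = \<one>"
    using assms by (intro right_cancel) auto
  finally show ?thesis by blast
qed

lemma commutator_swap_inv:
  "x \<in> carrier G \<Longrightarrow> y \<in> carrier G \<Longrightarrow> commutator G y x = inv (commutator G x y)"
  by (simp add: commutator_def inv_mult_group m_assoc)

lemma center_subset: "center G \<subseteq> carrier G"
  by (auto simp: center_def)

lemma center_closed [simp]: "z \<in> center G \<Longrightarrow> z \<in> carrier G"
  by (auto simp: center_def)

lemma center_commutes: "z \<in> center G \<Longrightarrow> g \<in> carrier G \<Longrightarrow> z \<otimes> g = g \<otimes> z"
  unfolding center_def by blast

lemma centerI:
  "z \<in> carrier G \<Longrightarrow> (\<And>g. g \<in> carrier G \<Longrightarrow> z \<otimes> g = g \<otimes> z) \<Longrightarrow> z \<in> center G"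
  unfolding center_def by blast

lemma subgroup_center: "subgroup (center G) G"
proof (rule subgroupI)
  show "center G \<subseteq> carrier G" by (rule center_subset)
  show "center G \<noteq> {}" by (metis centerI emptyE l_one one_closed r_one)
next
  fix z assume z: "z \<in> center G"
  have "inv z \<otimes> g = g \<otimes> inv z" if g: "g \<in> carrier G" for g
  proof -
    have "inv z \<otimes> g = inv z \<otimes> (g \<otimes> z) \<otimes> inv z" using z g by (simp add: m_assoc)
    also have "g \<otimes> z = z \<otimes> g" using z g by (simp add: center_commutes)
    finally show ?thesis using z g by (simp add: m_assoc)
  qed
  then show "inv z \<in> center G" using z by (simp add: centerI)
next
  fix z w assume z: "z \<in> center G" and w: "w \<in> center G"
  have "z \<otimes> w \<otimes> g = g \<otimes> (z \<otimes> w)" if g: "g \<in> carrier G" for g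
  proof -
    have "z \<otimes> w \<otimes> g = z \<otimes> (g \<otimes> w)" using z w g by (metis center_closed center_commutes m_assoc)
    also have "\<dots> = g \<otimes> (z \<otimes> w)" using z w g by (metis center_closed center_commutes m_assoc)
    finally show ?thesis .
  qed
  then show "z \<otimes> w \<in> center G" using z w by (simp add: centerI)
qed

lemmas center_mult [simp] = subgroup.m_closed[OF subgroup_center]
lemmas center_inv [simp] = subgroup.m_inv_closed[OF subgroup_center]
lemmas center_one [simp] = subgroup.one_closed[OF subgroup_center]

lemma center_nat_pow [simp]: "z \<in> center G \<Longrightarrow> z [^] (n :: nat) \<in> center G"
  by (induction n) auto

lemma center_int_pow [simp]: "z \<in> center G \<Longrightarrow> z [^] (n :: int) \<in> center G"
  by (rule subgroup_int_pow_closed[OF subgroup_center])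

lemma center_commutes_left:
  "z \<in> center G \<Longrightarrow> g \<in> carrier G \<Longrightarrow> h \<in> carrier G \<Longrightarrow> g \<otimes> (z \<otimes> h) = z \<otimes> (g \<otimes> h)"
  by (metis center_closed center_commutes m_assoc)

lemma commutator_center_right [simp]:
  "g \<in> carrier G \<Longrightarrow> z \<in> center G \<Longrightarrow> commutator G g z = \<one>"
  by (simp add: commutator_eq_one_iff center_commutes)

lemma commutator_center_left [simp]:
  "g \<in> carrier G \<Longrightarrow> z \<in> center G \<Longrightarrow> commutator G z g = \<one>"
  by (simp add: commutator_eq_one_iff center_commutes)

lemma commutator_self [simp]: "g \<in> carrier G \<Longrightarrow> commutator G g g = \<one>"
  by (simp add: commutator_eq_one_iff)

lemma center_iff_commutators:
  assumes "g \<in> carrier G"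
  shows "g \<in> center G \<longleftrightarrow> (\<forall>h \<in> carrier G. commutator G g h = \<one>)"
  using assms center_commutes centerI commutator_eq_one_iff by metis

end

text \<open>Since commutators are central, they are multiplicative in both arguments, and the commutator
  induces an alternating form on \<open>G/Z(G)\<close> with values in \<open>Z(G)\<close>. This form carries the whole argument.\<close>

locale class_two_group = group G for G (structure) +
  assumes finite_carrier [simp]: "finite (carrier G)"
    and commutator_central [simp]:
      "x \<in> carrier G \<Longrightarrow> y \<in> carrier G \<Longrightarrow> commutator G x y \<in> center G"
    and nonabelian: "center G \<noteq> carrier G"
begin

lemma commutator_mult_left:
  assumes "x \<in> carrier G" "y \<in> carrier G" "z \<in> carrier G"
  shows "commutator G (x \<otimes> y) z = commutator G x z \<otimes> commutator G y z"
proof -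
  have "(x \<otimes> y) \<otimes> z = commutator G x z \<otimes> commutator G y z \<otimes> (z \<otimes> (x \<otimes> y))"
  proof -
    have "(x \<otimes> y) \<otimes> z = x \<otimes> (commutator G y z \<otimes> (z \<otimes> y))"
      using assms mult_eq_commutator[of y z] by (simp add: m_assoc)
    also have "\<dots> = commutator G y z \<otimes> ((x \<otimes> z) \<otimes> y)"
      using assms center_commutes_left[of "commutator G y z" x "z \<otimes> y"] by (simp add: m_assoc)
    also have "\<dots> = commutator G y z \<otimes> (commutator G x z \<otimes> (z \<otimes> (x \<otimes> y)))"
      using assms mult_eq_commutator[of x z] by (simp add: m_assoc)
    finally show ?thesis
      using assms center_commutes[of "commutator G y z" "commutator G x z"] by (simp flip: m_assoc)
  qed
  moreover have "(x \<otimes> y) \<otimes> z = commutator G (x \<otimes> y) z \<otimes> (z \<otimes> (x \<otimes> y))"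
    using assms by (intro mult_eq_commutator) auto
  ultimately show ?thesis using assms by (metis commutator_closed m_closed right_cancel)
qed

lemma commutator_mult_right:
  assumes "x \<in> carrier G" "y \<in> carrier G" "z \<in> carrier G"
  shows "commutator G z (x \<otimes> y) = commutator G z x \<otimes> commutator G z y"
proof -
  have "commutator G z (x \<otimes> y) = inv (commutator G x z \<otimes> commutator G y z)"
    using assms commutator_swap_inv[of "x \<otimes> y" z] by (simp add: commutator_mult_left)
  also have "\<dots> = commutator G z y \<otimes> commutator G z x"
    using assms commutator_swap_inv[of x z] commutator_swap_inv[of y z] by (simp add: inv_mult_group)
  also have "\<dots> = commutator G z x \<otimes> commutator G z y"
    using assms by (intro center_commutes) auto
  finally show ?thesis .
qed

lemma commutator_hom_right: "z \<in> carrier G \<Longrightarrow> commutator G z \<in> hom G G"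
  by (auto simp: hom_def commutator_mult_right)

lemma commutator_hom_left: "z \<in> carrier G \<Longrightarrow> (\<lambda>x. commutator G x z) \<in> hom G G"
  by (auto simp: hom_def commutator_mult_left)

lemma commutator_int_pow_right:
  "x \<in> carrier G \<Longrightarrow> z \<in> carrier G \<Longrightarrow> commutator G z (x [^] (i :: int)) = commutator G z x [^] i"
  using hom_int_pow[OF commutator_hom_right _ is_group is_group] by simp

lemma commutator_int_pow_left:
  "x \<in> carrier G \<Longrightarrow> z \<in> carrier G \<Longrightarrow> commutator G (x [^] (i :: int)) z = commutator G x z [^] i"
  using hom_int_pow[OF commutator_hom_left _ is_group is_group] by simp

lemma commutator_inv_left:
  "x \<in> carrier G \<Longrightarrow> z \<in> carrier G \<Longrightarrow> commutator G (inv x) z = inv (commutator G x z)"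
  using group_hom.hom_inv[of G G "\<lambda>x. commutator G x z" x] commutator_hom_left
  by (auto simp: group_hom_def group_hom_axioms_def)

lemma mult_inv_in_center_iff:
  assumes "x \<in> carrier G" "y \<in> carrier G"
  shows "x \<otimes> inv y \<in> center G \<longleftrightarrow> (\<forall>h \<in> carrier G. commutator G x h = commutator G y h)"
proof -
  have "x \<otimes> inv y \<in> center G \<longleftrightarrow> (\<forall>h \<in> carrier G. commutator G (x \<otimes> inv y) h = \<one>)"
    by (rule center_iff_commutators) (use assms in simp)
  also have "\<dots> \<longleftrightarrow> (\<forall>h \<in> carrier G. commutator G x h = commutator G y h)"
    using assms by (intro ball_cong refl)
      (simp add: commutator_mult_left commutator_inv_left mult_inv_eq_one_iff)
  finally show ?thesis .
qed

end

text \<open>An element has full order if its order modulo the center is \<open>e\<close>, where \<open>e\<close> will be the exponent of the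
  quotient by the center.\<close>

definition full_order :: "('a, 'm) monoid_scheme \<Rightarrow> nat \<Rightarrow> 'a \<Rightarrow> bool"
  where "full_order G e g \<longleftrightarrow>
    g \<in> carrier G \<and> (\<forall>i :: int. g [^]\<^bsub>G\<^esub> i \<in> center G \<longleftrightarrow> int e dvd i)"

locale class_two_exponent = class_two_group +
  fixes e :: nat
  assumes exponent_pos: "e > 0"
    and pow_exponent_central: "g \<in> carrier G \<Longrightarrow> g [^] e \<in> center G"
    and exponent_attained: "\<exists>g. full_order G e g"

lemma (in class_two_group) exponent_exists: "\<exists>e. class_two_exponent G e"
proof -
  have nor: "center G \<lhd> G"
    by (rule normalI[OF subgroup_center]) (auto simp: r_coset_def l_coset_def center_commutes)
  interpret Z: normal "center G" G by (rule nor)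
  have "comm_group (G Mod center G)"
  proof (rule group.group_comm_groupI[OF Z.factorgroup_is_group])
    fix u v assume "u \<in> carrier (G Mod center G)" "v \<in> carrier (G Mod center G)"
    then obtain x y where xy: "x \<in> carrier G" "y \<in> carrier G" "u = center G #> x" "v = center G #> y"
      by (auto simp: carrier_FactGroup)
    have "center G #> (x \<otimes> y) = center G #> (commutator G x y \<otimes> (y \<otimes> x))"
      using xy by (simp add: mult_eq_commutator[of x y])
    also have "\<dots> = center G #> (y \<otimes> x)"
      using xy by (metis coset_mult_assoc center_subset commutator_central commutator_closed m_closed
          coset_join2 subgroup_center)
    finally show "u \<otimes>\<^bsub>G Mod center G\<^esub> v = v \<otimes>\<^bsub>G Mod center G\<^esub> u"
      using xy by (simp add: Z.rcos_sum)
  qed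
  then interpret Q: comm_group "G Mod center G" .
  have finQ: "finite (carrier (G Mod center G))" by (simp add: carrier_FactGroup)
  then obtain q where q: "q \<in> carrier (G Mod center G)"
    "\<And>r. r \<in> carrier (G Mod center G) \<Longrightarrow> Q.ord r dvd Q.ord q"
    by (rule Q.exists_ord_eq_exponent) blast
  obtain g where g: "g \<in> carrier G" "q = center G #> g" using q(1) by (auto simp: carrier_FactGroup)
  define e where "e = Q.ord q"
  have pow: "h [^] i \<in> center G \<longleftrightarrow> int (Q.ord (center G #> h)) dvd i"
    if h: "h \<in> carrier G" for h and i :: int
  proof -
    have hq: "center G #> h \<in> carrier (G Mod center G)" using h by (auto simp: carrier_FactGroup)
    have "h [^] i \<in> center G \<longleftrightarrow> center G #> (h [^] i) = center G"
      using h by (metis coset_join1 coset_join2 int_pow_closed subgroup_center center_subset)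
    also have "center G #> (h [^] i) = (center G #> h) [^]\<^bsub>G Mod center G\<^esub> i"
      using Z.FactGroup_int_pow[OF h] by simp
    also have "(\<dots> = center G) \<longleftrightarrow> int (Q.ord (center G #> h)) dvd i"
      using Q.int_pow_eq_id[OF hq, of i] by simp
    finally show ?thesis .
  qed
  have "class_two_exponent G e"
  proof
    show "e > 0" unfolding e_def using Q.ord_ge_1[OF finQ q(1)] by simp
    show "h [^] e \<in> center G" if h: "h \<in> carrier G" for h
    proof -
      have "int (Q.ord (center G #> h)) dvd int e"
        using q(2) h by (auto simp: e_def carrier_FactGroup)
      then show ?thesis using pow[OF h] by (metis int_pow_int)
    qed
    show "\<exists>g. full_order G e g"
      unfolding full_order_def e_def g(2) using pow[OF g(1)] g(1) by blast
  qed
  then show ?thesis ..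
qed

context class_two_exponent
begin

lemma commutator_pow_exponent [simp]:
  assumes "x \<in> carrier G" "y \<in> carrier G"
  shows "commutator G x y [^] e = \<one>"
proof -
  have "commutator G x y [^] e = commutator G (x [^] e) y"
    using commutator_int_pow_left[OF assms, of "int e"] by (simp add: int_pow_int)
  then show ?thesis using assms pow_exponent_central by simp
qed

text \<open>The commutators with a fixed element form a group whose exponent is the order of that
  element modulo the center.\<close>

lemma commutator_of_full_order:
  assumes g: "full_order G e g"
  obtains h where "h \<in> carrier G" "ord (commutator G g h) = e"
proof -
  from g have gc: "g \<in> carrier G" by (simp add: full_order_def)
  interpret f: group_hom G G "commutator G g"
    using commutator_hom_right[OF gc] by (simp add: group_hom_def group_hom_axioms_def)
  define T where "T = commutator G g ` carrier G"
  have T: "subgroup T G" unfolding T_def by (rule f.img_is_subgroup)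
  have TZ: "T \<subseteq> center G" unfolding T_def using gc by auto
  interpret T: group "G\<lparr>carrier := T\<rparr>" using T by (rule subgroup.subgroup_is_group) (rule is_group)
  interpret T: comm_group "G\<lparr>carrier := T\<rparr>"
    by (rule T.group_comm_groupI) (use TZ center_commutes center_closed in \<open>auto simp: subset_iff\<close>)
  have "finite (carrier (G\<lparr>carrier := T\<rparr>))" by (simp add: T_def)
  then obtain c where c: "c \<in> T" "\<And>t. t \<in> T \<Longrightarrow> T.ord t dvd T.ord c"
    by (rule T.exists_ord_eq_exponent) auto
  have ordT: "T.ord t = ord t" if "t \<in> T" for t
  proof (rule T.ord_unique[THEN iffD2])
    show "t \<in> carrier (G\<lparr>carrier := T\<rparr>)" using that by simp
    show "\<forall>n. t [^]\<^bsub>G\<lparr>carrier := T\<rparr>\<^esub> n = \<one>\<^bsub>G\<lparr>carrier := T\<rparr>\<^esub> \<longleftrightarrow> ord t dvd n"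
      using that TZ by (auto simp: pow_eq_id subset_iff simp flip: nat_pow_consistent)
  qed
  obtain h where h: "h \<in> carrier G" "c = commutator G g h" using c(1) by (auto simp: T_def)
  have "commutator G (g [^] ord c) k = \<one>" if k: "k \<in> carrier G" for k
  proof -
    have kT: "commutator G g k \<in> T" using k by (simp add: T_def)
    then have "ord (commutator G g k) dvd ord c" using c ordT by metis
    then have "commutator G g k [^] ord c = \<one>" using k gc by (simp add: pow_eq_id)
    then show ?thesis
      using commutator_int_pow_left[OF gc k, of "int (ord c)"] by (simp add: int_pow_int)
  qed
  then have "g [^] ord c \<in> center G" using center_iff_commutators[of "g [^] ord c"] gc by blast
  then have "e dvd ord c" using g by (metis full_order_def int_dvd_int_iff int_pow_int)
  moreover have "ord c dvd e" using h gc by (simp flip: pow_eq_id)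
  ultimately have "ord (commutator G g h) = e" using h by (simp add: dvd_antisym)
  with that h show ?thesis by blast
qed

end

section \<open>Central homomorphisms and abelian subgroups\<close>

text \<open>The kernel of such a character is a complement to the subgroup generated by \<open>c\<close>.\<close>

lemma (in comm_group) char_of_element_of_exponent_order:
  assumes fin: "finite (carrier G)" and n: "n > 1"
    and pow: "\<And>g. g \<in> carrier G \<Longrightarrow> g [^] n = \<one>"
    and c: "c \<in> carrier G" "ord c = n"
  obtains \<psi> where "\<psi> \<in> hom G (integer_mod_group n)" "\<psi> c = 1"
proof -
  have n0: "n > 0" using n by simp
  have comm: "\<forall>x \<in> carrier G. \<forall>y \<in> carrier G. x \<otimes> y \<otimes> inv x \<otimes> inv y = \<one>"
    by (metis inv_closed inv_mult_group l_inv m_assoc m_closed m_comm r_inv)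
  then have comm': "\<forall>x \<in> carrier G. \<forall>y \<in> carrier G. x \<otimes> y \<otimes> inv x \<otimes> inv y \<in> {\<one>}" by simp
  have k: "c [^] i \<in> {\<one>} \<longleftrightarrow> int n dvd i" for i :: int
    using c int_pow_eq_id by simp
  have hom0: "(\<lambda>_. 0) \<in> hom (G\<lparr>carrier := {\<one>}\<rparr>) (integer_mod_group n)"
    by (auto simp: hom_def carrier_integer_mod_group n0)
  obtain \<chi> where \<chi>: "\<chi> \<in> hom (G\<lparr>carrier := adjoin G {\<one>} c\<rparr>) (integer_mod_group n)"
    "\<And>t. t \<in> {\<one>} \<Longrightarrow> \<chi> t = 0" "\<chi> c = 1"
    by (rule char_extends_to_adjoin[OF triv_subgroup c(1) n0 comm' _ hom0 n0 k, of 1])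
      (use n in auto)
  note ad = subgroup_adjoin[OF triv_subgroup c(1) comm']
  obtain \<psi> where \<psi>: "\<psi> \<in> hom G (integer_mod_group n)" "\<And>t. t \<in> adjoin G {\<one>} c \<Longrightarrow> \<psi> t = \<chi> t"
    by (rule char_extension_exists[OF fin n0 ad(1) _ _ _ \<chi>(1)])
      (use comm pow ad(2) \<chi>(2) in auto)
  show ?thesis by (rule that[OF \<psi>(1)]) (use \<psi>(2) ad(3) \<chi>(3) in simp)
qed

definition central_homs :: "('a, 'm) monoid_scheme \<Rightarrow> ('a \<Rightarrow> 'a) set"
  where "central_homs G = {f \<in> hom G G. f \<in> extensional (carrier G) \<and>
    f ` carrier G \<subseteq> center G \<and> (\<forall>z \<in> center G. f z = \<one>\<^bsub>G\<^esub>)}"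

definition center_torsion :: "('a, 'm) monoid_scheme \<Rightarrow> nat \<Rightarrow> 'a set"
  where "center_torsion G e = {z \<in> center G. z [^]\<^bsub>G\<^esub> e = \<one>\<^bsub>G\<^esub>}"

lemma (in group) center_mult_distrib_int_pow:
  "z \<in> center G \<Longrightarrow> w \<in> center G \<Longrightarrow> (z \<otimes> w) [^] (i :: int) = z [^] i \<otimes> w [^] i"
  by (rule int_pow_mult_distrib) (auto simp: center_commutes)

lemma (in group) subgroup_center_torsion: "subgroup (center_torsion G e) G"
proof (rule subgroupI)
  show "center_torsion G e \<subseteq> carrier G" by (auto simp: center_torsion_def)
  have "\<one> \<in> center_torsion G e" by (simp add: center_torsion_def)
  then show "center_torsion G e \<noteq> {}" by blast
  show "inv z \<in> center_torsion G e" if "z \<in> center_torsion G e" for z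
    using that by (auto simp: center_torsion_def nat_pow_inv)
  show "z \<otimes> w \<in> center_torsion G e" if "z \<in> center_torsion G e" "w \<in> center_torsion G e" for z w
    using that center_mult_distrib_int_pow[of z w "int e"]
    by (auto simp: center_torsion_def int_pow_int)
qed

lemma (in group) int_pow_mod:
  assumes "z \<in> carrier G" "z [^] (n :: nat) = \<one>"
  shows "z [^] (i mod int n) = z [^] (i :: int)"
proof -
  have "int (ord z) dvd int n" using assms by (simp add: pow_eq_id)
  then have "int (ord z) dvd i mod int n - i"
    by (metis dvd_minus_mod dvd_trans minus_diff_eq dvd_minus_iff)
  then show ?thesis using assms by (simp add: int_pow_eq dvd_diff_commute)
qed

context class_two_exponent
begin

lemma exponent_gt_1: "e > 1"
proof (rule ccontr)
  assume "\<not> e > 1"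
  then have "e = 1" using exponent_pos by simp
  then have "carrier G \<subseteq> center G" using pow_exponent_central by auto
  then show False using nonabelian center_subset by blast
qed

lemma commutator_in_torsion [simp]:
  "x \<in> carrier G \<Longrightarrow> y \<in> carrier G \<Longrightarrow> commutator G x y \<in> center_torsion G e"
  by (simp add: center_torsion_def)

lemma commutators_in:
  assumes "center G \<subseteq> T"
  shows "\<forall>x \<in> carrier G. \<forall>y \<in> carrier G. x \<otimes> y \<otimes> inv x \<otimes> inv y \<in> T"
  using assms commutator_central unfolding commutator_def by blast

lemma char_of_center_torsion:
  assumes "c \<in> center_torsion G e" "ord c = e"
  obtains \<psi> where "\<psi> \<in> hom (G\<lparr>carrier := center_torsion G e\<rparr>) (integer_mod_group e)"
    "\<psi> c = 1"
proof -
  let ?T = "G\<lparr>carrier := center_torsion G e\<rparr>"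
  have sub: "center_torsion G e \<subseteq> center G" by (auto simp: center_torsion_def)
  interpret T: group ?T
    using subgroup_center_torsion by (rule subgroup.subgroup_is_group) (rule is_group)
  interpret T: comm_group ?T
    by (rule T.group_comm_groupI) (use sub center_commutes center_closed in \<open>auto simp: subset_iff\<close>)
  have fin: "finite (carrier ?T)"
    using sub center_subset by (auto intro: finite_subset[OF _ finite_carrier])
  have cT: "c \<in> carrier ?T" using assms by simp
  have "T.ord c = e"
    using T.ord_unique[OF cT, of e] assms sub
    by (auto simp: pow_eq_id subset_iff simp flip: nat_pow_consistent)
  then show ?thesis
    using T.char_of_element_of_exponent_order[OF fin exponent_gt_1 _ cT] that
    by (auto simp: center_torsion_def simp flip: nat_pow_consistent)
qed

lemma hom_comp_commutator:
  assumes \<psi>: "\<psi> \<in> hom (G\<lparr>carrier := center_torsion G e\<rparr>) (integer_mod_group e)"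
    and x: "x \<in> carrier G"
  shows "(\<lambda>g \<in> carrier G. \<psi> (commutator G x g)) \<in> hom G (integer_mod_group e)"
  using \<psi> x
  by (auto simp: hom_integer_mod_group_iff[OF exponent_pos] commutator_mult_right)

lemma pow_char_hom:
  assumes \<psi>: "\<psi> \<in> hom G (integer_mod_group e)" and z: "z \<in> center_torsion G e"
  shows "(\<lambda>g. z [^] \<psi> g) \<in> hom G G"
proof (rule homI)
  have zc: "z \<in> carrier G" "z [^] e = \<one>" using z by (auto simp: center_torsion_def)
  show "z [^] \<psi> g \<in> carrier G" for g using zc by simp
  show "z [^] \<psi> (g \<otimes> h) = z [^] \<psi> g \<otimes> z [^] \<psi> h" if "g \<in> carrier G" "h \<in> carrier G" for g h
  proof -
    have "\<psi> (g \<otimes> h) = (\<psi> g + \<psi> h) mod int e"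
      using \<psi> that by (simp add: hom_integer_mod_group_iff[OF exponent_pos, of \<psi> G])
    then show ?thesis using zc by (simp add: int_pow_mod int_pow_mult)
  qed
qed

text \<open>The commutator form restricted to \<open>x\<close> and \<open>y\<close> is a perfect pairing, so \<open>x\<close> and \<open>y\<close> are independent
  of order \<open>e\<close> modulo the center.\<close>

lemma pair_subgroup:
  assumes x: "x \<in> carrier G" and y: "y \<in> carrier G" and c: "ord (commutator G x y) = e"
  defines "S \<equiv> adjoin G (adjoin G (center G) x) y"
  shows "subgroup S G" "center G \<subseteq> S" "x \<in> S" "y \<in> S" "card S = e * e * card (center G)"
proof -
  define R where "R = adjoin G (center G) x"
  note R = subgroup_adjoin[OF subgroup_center x commutators_in[OF order_refl], folded R_def]
  note S = subgroup_adjoin[OF R(1) y commutators_in[OF R(2)], folded S_def[folded R_def]]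
  show "subgroup S G" "center G \<subseteq> S" "x \<in> S" "y \<in> S" using R S by auto
  have kx: "x [^] i \<in> center G \<longleftrightarrow> int e dvd i" for i :: int
  proof
    assume "x [^] i \<in> center G"
    then have "commutator G x y [^] i = \<one>"
      using commutator_int_pow_left[OF x y, of i] y by simp
    then show "int e dvd i" using x y c by (simp add: int_pow_eq_id)
  next
    assume "int e dvd i"
    then obtain q where "i = int e * q" by auto
    then have "x [^] i = (x [^] e) [^] q" using x by (simp add: int_pow_int flip: int_pow_pow)
    then show "x [^] i \<in> center G" using pow_exponent_central[OF x] by simp
  qed
  have cR: "card R = e * card (center G)"
    unfolding R_def
    by (rule card_adjoin[OF subgroup_center x finite_carrier commutators_in[OF order_refl] exponent_pos kx])
  have ky: "y [^] i \<in> R \<longleftrightarrow> int e dvd i" for i :: int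
  proof
    assume "y [^] i \<in> R"
    then obtain z j where z: "z \<in> center G" "y [^] i = z \<otimes> x [^] (j :: int)"
      unfolding R_def adjoin_def by auto
    have "commutator G x y [^] i = commutator G x (z \<otimes> x [^] j)"
      using commutator_int_pow_right[OF y x, of i] z by simp
    also have "\<dots> = \<one>" using x z by (simp add: commutator_mult_right commutator_int_pow_right)
    finally show "int e dvd i" using x y c by (simp add: int_pow_eq_id)
  next
    assume "int e dvd i"
    then obtain q where "i = int e * q" by auto
    then have "y [^] i = (y [^] e) [^] q" using y by (simp add: int_pow_int flip: int_pow_pow)
    then show "y [^] i \<in> R" using pow_exponent_central[OF y] R by auto
  qed
  show "card S = e * e * card (center G)"
    using card_adjoin[OF R(1) y finite_carrier commutators_in[OF R(2)] exponent_pos ky] cR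
    unfolding S_def R_def by simp
qed


lemma central_homI:
  assumes hom: "f \<in> hom G G" and ran: "\<And>g. g \<in> carrier G \<Longrightarrow> f g \<in> center G"
    and ker: "\<And>z. z \<in> center G \<Longrightarrow> f z = \<one>"
  shows "restrict f (carrier G) \<in> central_homs G"
  using assms unfolding central_homs_def hom_def by auto

lemma central_mult_hom:
  assumes "f \<in> hom G G" "h \<in> hom G G"
    and "\<And>g. g \<in> carrier G \<Longrightarrow> f g \<in> center G" "\<And>g. g \<in> carrier G \<Longrightarrow> h g \<in> center G"
  shows "(\<lambda>g. f g \<otimes> h g) \<in> hom G G"
proof (rule homI)
  show "f g \<otimes> h g \<in> carrier G" if "g \<in> carrier G" for g using assms that by simp
  show "f (g \<otimes> k) \<otimes> h (g \<otimes> k) = (f g \<otimes> h g) \<otimes> (f k \<otimes> h k)"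
    if gk: "g \<in> carrier G" "k \<in> carrier G" for g k
  proof -
    have "f k \<otimes> (h g \<otimes> h k) = h g \<otimes> (f k \<otimes> h k)"
      using assms(3,4) gk by (intro center_commutes_left) auto
    then show ?thesis
      using assms gk by (simp add: hom_mult[of _ G G] m_assoc)
  qed
qed

text \<open>Let \<open>\<mu>\<close> be a character of the torsion of the center with value \<open>1\<close> at \<open>[x, y]\<close>. The two characters
  \<open>g \<mapsto> \<mu> [x, g]\<close> and \<open>g \<mapsto> \<mu> [y, g]\<close> are dual to \<open>y\<close> and \<open>x\<close>. Multiples of them realize every
  pair of torsion values of a homomorphism from \<open>G/Z(G)\<close> to \<open>Z(G)\<close> at \<open>x\<close> and \<open>y\<close>, and such a
  homomorphism can still be varied by the characters that are trivial at \<open>x\<close>, at \<open>y\<close> and on the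
  center. The latter are counted by \<open>card_chars_trivial_on\<close>.\<close>

lemma card_central_homs_ge:
  assumes x: "x \<in> carrier G" and y: "y \<in> carrier G" and c: "ord (commutator G x y) = e"
  shows "card (center_torsion G e) ^ 2 * order G \<le> card (central_homs G) * (e * e * card (center G))"
proof -
  define c' where "c' = commutator G x y"
  define Z where "Z = center_torsion G e"
  define S where "S = adjoin G (adjoin G (center G) x) y"
  note S = pair_subgroup[OF x y c, folded S_def]
  define \<Psi> where "\<Psi> = char_extensions G e S (\<lambda>_. 0)"
  have c'Z: "c' \<in> Z" using x y by (simp add: c'_def Z_def)
  have Zc: "z \<in> center G" "z \<in> carrier G" "z [^] e = \<one>" if "z \<in> Z" for z
    using that by (auto simp: Z_def center_torsion_def)
  obtain \<mu> where \<mu>: "\<mu> \<in> hom (G\<lparr>carrier := Z\<rparr>) (integer_mod_group e)" "\<mu> c' = 1"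
    using char_of_center_torsion[of c'] c'Z c unfolding Z_def c'_def by blast
  interpret ZG: group "G\<lparr>carrier := Z\<rparr>"
    unfolding Z_def using subgroup_center_torsion by (rule subgroup.subgroup_is_group) (rule is_group)
  have \<mu>1: "\<mu> \<one> = 0"
    using hom_one[OF \<mu>(1) ZG.is_group group_integer_mod_group] by simp
  have \<mu>inv: "\<mu> (inv c') = (-1) mod int e"
  proof -
    have "\<mu> (inv c') = \<mu> (c' [^]\<^bsub>G\<lparr>carrier := Z\<rparr>\<^esub> (-1 :: int))"
      using int_pow_consistent[of Z c' "-1"] subgroup_center_torsion c'Z Zc(2)[OF c'Z]
      by (simp add: Z_def int_pow_neg)
    then show ?thesis using ZG.char_int_pow[OF \<mu>(1), of c' "-1"] c'Z \<mu>(2) by simp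
  qed
  define a where "a = (\<lambda>g \<in> carrier G. \<mu> (commutator G x g))"
  define b where "b = (\<lambda>g \<in> carrier G. \<mu> (commutator G y g))"
  have ab: "a \<in> hom G (integer_mod_group e)" "b \<in> hom G (integer_mod_group e)"
    unfolding a_def b_def using hom_comp_commutator \<mu>(1) x y by (auto simp: Z_def)
  have a0: "a z = 0" and b0: "b z = 0" if "z \<in> center G" for z
    using that x y \<mu>1 by (simp_all add: a_def b_def)
  have vals: "a x = 0" "a y = 1" "b y = 0" "b x = (-1) mod int e"
    using x y \<mu>(2) \<mu>1 \<mu>inv commutator_swap_inv[OF x y] by (simp_all add: a_def b_def c'_def)
  have \<Psi>: "\<psi> \<in> hom G (integer_mod_group e)" "\<psi> \<in> extensional (carrier G)"
    "\<And>s. s \<in> S \<Longrightarrow> \<psi> s = 0" if "\<psi> \<in> \<Psi>" for \<psi>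
    using that by (auto simp: \<Psi>_def char_extensions_def)
  define F where "F = (\<lambda>(z, w, \<psi>). \<lambda>g \<in> carrier G. z [^] a g \<otimes> w [^] b g \<otimes> c' [^] (\<psi> g :: int))"
  have F: "F (z, w, \<psi>) \<in> central_homs G" if z: "z \<in> Z" and w: "w \<in> Z" and \<psi>: "\<psi> \<in> \<Psi>" for z w \<psi>
    unfolding F_def prod.case
  proof (rule central_homI)
    note pc = pow_char_hom[folded Z_def]
    show "(\<lambda>g. z [^] a g \<otimes> w [^] b g \<otimes> c' [^] \<psi> g) \<in> hom G G"
      using z w c'Z \<Psi>(1)[OF \<psi>] ab Zc by (intro central_mult_hom pc) auto
    show "z [^] a g \<otimes> w [^] b g \<otimes> c' [^] \<psi> g \<in> center G" for g
      using z w c'Z Zc by simp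
    show "z [^] a g \<otimes> w [^] b g \<otimes> c' [^] \<psi> g = \<one>" if "g \<in> center G" for g
      using that a0 b0 \<Psi>(3)[OF \<psi>] S(2) by auto
  qed
  have inj: "inj_on F (Z \<times> Z \<times> \<Psi>)"
  proof (rule inj_onI)
    fix p q assume pq: "p \<in> Z \<times> Z \<times> \<Psi>" "q \<in> Z \<times> Z \<times> \<Psi>" "F p = F q"
    obtain z w \<psi> z' w' \<psi>' where p: "p = (z, w, \<psi>)" and q: "q = (z', w', \<psi>')"
      by (metis prod_cases3)
    have mem: "z \<in> Z" "w \<in> Z" "\<psi> \<in> \<Psi>" "z' \<in> Z" "w' \<in> Z" "\<psi>' \<in> \<Psi>" using pq p q by auto
    have Fy: "F (z, w, \<psi>) y = z" if "z \<in> Z" "w \<in> Z" "\<psi> \<in> \<Psi>" for z w \<psi>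
      using that y vals \<Psi>(3)[OF that(3) S(4)] Zc by (simp add: F_def)
    have Fx: "F (z, w, \<psi>) x = inv w" if "z \<in> Z" "w \<in> Z" "\<psi> \<in> \<Psi>" for z w \<psi>
      using that x vals \<Psi>(3)[OF that(3) S(3)] Zc by (simp add: F_def int_pow_mod int_pow_neg)
    have "z = z'" using Fy mem pq(3) p q by metis
    moreover have "inv w = inv w'" using Fx mem pq(3) p q by metis
    then have "w = w'" using mem Zc by (metis inv_inv)
    moreover have "\<psi> = \<psi>'"
    proof (rule extensionalityI[OF \<Psi>(2)[OF mem(3)] \<Psi>(2)[OF mem(6)]])
      fix g assume g: "g \<in> carrier G"
      have "F (z, w, \<psi>) g = F (z, w, \<psi>') g" using pq(3) p q \<open>z = z'\<close> \<open>w = w'\<close> by simp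
      then have "z [^] a g \<otimes> w [^] b g \<otimes> c' [^] \<psi> g = z [^] a g \<otimes> w [^] b g \<otimes> c' [^] \<psi>' g"
        using g by (simp add: F_def)
      then have "c' [^] \<psi> g = c' [^] \<psi>' g" using mem Zc c'Z by simp
      then have "int e dvd \<psi> g - \<psi>' g"
        using c Zc(2)[OF c'Z] by (simp add: int_pow_eq c'_def dvd_diff_commute)
      then have "\<psi> g mod int e = \<psi>' g mod int e" by (simp add: mod_eq_dvd_iff)
      then show "\<psi> g = \<psi>' g"
        using \<Psi>(1)[OF mem(3)] \<Psi>(1)[OF mem(6)] g
        by (simp add: hom_integer_mod_group_iff[OF exponent_pos])
    qed
    ultimately show "p = q" using p q by simp
  qed
  have fin: "finite (central_homs G)"
  proof (rule finite_subset)
    show "central_homs G \<subseteq> carrier G \<rightarrow>\<^sub>E carrier G"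
      by (auto simp: central_homs_def hom_def PiE_def)
    show "finite (carrier G \<rightarrow>\<^sub>E carrier G)" by (intro finite_PiE) auto
  qed
  have "card (Z \<times> Z \<times> \<Psi>) \<le> card (central_homs G)"
    using F fin inj by (intro card_inj_on_le[of F]) auto
  then have le: "card Z ^ 2 * card \<Psi> \<le> card (central_homs G)"
    by (simp add: card_cartesian_product power2_eq_square mult.assoc)
  have "card \<Psi> * card S = order G"
    unfolding \<Psi>_def
  proof (rule card_chars_trivial_on[OF finite_carrier exponent_pos S(1) commutators_in[OF S(2)]])
    show "\<forall>g \<in> carrier G. g [^] e \<in> S" using pow_exponent_central S(2) by blast
  qed
  then have "card Z ^ 2 * order G = card Z ^ 2 * card \<Psi> * card S" by (simp add: ac_simps)
  also have "\<dots> \<le> card (central_homs G) * card S" using le by (rule mult_right_mono) simp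
  finally show ?thesis using S(5) by (simp add: Z_def)
qed

end

context class_two_exponent
begin

text \<open>Write \<open>t\<close> for the number of elements of the center of order dividing \<open>e\<close>, and \<open>I\<close> for \<open>B Z(G)\<close>.
  As \<open>B\<close> has exponent \<open>e\<close>, it meets the center in at most \<open>t\<close> elements, so the lower bound on
  \<open>B\<close> makes \<open>I\<close> large: its index is at most \<open>e^2/t\<close>. The pairing of \<open>x\<close> and \<open>y\<close> shows that this
  index is at least \<open>e\<close>. As \<open>t\<close> is at least \<open>e\<close>, equality holds throughout, and the torsion of the
  center is cyclic. Now commutators with elements of \<open>I\<close> are characters of \<open>G/I\<close>, of which there are
  only \<open>e\<close>, which bounds the order of \<open>I\<close> modulo the center and hence the order of \<open>G\<close>.\<close>

lemma abelian_subgroup_bound: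
  assumes x: "x \<in> carrier G" and y: "y \<in> carrier G" and c: "ord (commutator G x y) = e"
    and B: "subgroup B G" and Bcomm: "\<And>b b'. b \<in> B \<Longrightarrow> b' \<in> B \<Longrightarrow> b \<otimes> b' = b' \<otimes> b"
    and Bexp: "\<And>b. b \<in> B \<Longrightarrow> b [^] e = \<one>"
    and large: "card (center_torsion G e) ^ 2 * order G \<le> card B * (e * e * card (center G))"
  shows "order G = e * e * card (center G)" "card (center_torsion G e) = e"
    "card B = e * e" "card (B \<inter> center G) = e"
proof -
  let ?Z = "center G" and ?T = "center_torsion G e"
  define I where "I = {b \<otimes> z | b z. b \<in> B \<and> z \<in> ?Z}"
  have Bc: "b \<in> carrier G" if "b \<in> B" for b using B that by (rule subgroup.mem_carrier)
  have BI: "B \<subseteq> I" unfolding I_def using Bc by (force intro: exI[of _ \<one>])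
  have ZI: "?Z \<subseteq> I"
    unfolding I_def using subgroup.one_closed[OF B] by (force intro: exI[of _ \<one>])
  have II: "b \<otimes> z \<in> I" if "b \<in> B" "z \<in> ?Z" for b z
    unfolding I_def using that by blast
  have mulI: "(b \<otimes> z) \<otimes> (b' \<otimes> z') = (b \<otimes> b') \<otimes> (z \<otimes> z')"
    if "b \<in> B" "z \<in> ?Z" "b' \<in> B" "z' \<in> ?Z" for b z b' z'
    using that Bc center_commutes_left[of z b' z'] by (simp add: m_assoc center_commutes)
  have Icomm: "u \<otimes> v = v \<otimes> u" if "u \<in> I" "v \<in> I" for u v
  proof -
    from that obtain b z b' z' where bz: "b \<in> B" "z \<in> ?Z" "b' \<in> B" "z' \<in> ?Z"
      "u = b \<otimes> z" "v = b' \<otimes> z'" unfolding I_def by blast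
    have "b \<otimes> b' = b' \<otimes> b" "z \<otimes> z' = z' \<otimes> z"
      using bz Bcomm center_commutes[of z z'] by auto
    then show ?thesis using bz mulI[of b z b' z'] mulI[of b' z' b z] by metis
  qed
  have I: "subgroup I G"
  proof (rule subgroupI)
    show "I \<subseteq> carrier G" unfolding I_def using Bc by auto
    show "I \<noteq> {}" using ZI center_one by blast
  next
    fix u assume "u \<in> I"
    then obtain b z where bz: "b \<in> B" "z \<in> ?Z" "u = b \<otimes> z" unfolding I_def by blast
    have "inv u = inv b \<otimes> inv z"
      using bz Bc center_commutes[of "inv z" "inv b"] by (simp add: inv_mult_group)
    then show "inv u \<in> I" using bz subgroup.m_inv_closed[OF B] II by simp
  next
    fix u v assume "u \<in> I" "v \<in> I"
    then obtain b z b' z' where bz: "b \<in> B" "z \<in> ?Z" "b' \<in> B" "z' \<in> ?Z"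
      "u = b \<otimes> z" "v = b' \<otimes> z'" unfolding I_def by blast
    then show "u \<otimes> v \<in> I"
      using mulI[of b z b' z'] subgroup.m_closed[OF B] II by simp
  qed
  have Ic: "u \<in> carrier G" if "u \<in> I" for u using I that by (rule subgroup.mem_carrier)
  have fin: "finite I" "finite B" "finite ?Z" "finite ?T"
    using Ic Bc center_subset by (auto intro!: finite_subset[OF _ finite_carrier] simp: center_torsion_def)
  define f where "f g = (\<lambda>h \<in> carrier G. commutator G g h)" for g
  have f: "f u = f v \<longleftrightarrow> u \<otimes> inv v \<in> ?Z" if "u \<in> carrier G" "v \<in> carrier G" for u v
    using mult_inv_in_center_iff[OF that] by (auto simp: f_def fun_eq_iff)
  have fI: "f ` I = f ` B"
  proof (intro equalityI subsetI)
    fix w assume "w \<in> f ` I"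
    then obtain b z where bz: "b \<in> B" "z \<in> ?Z" "w = f (b \<otimes> z)" unfolding I_def by blast
    have "f (b \<otimes> z) = f b"
      using bz Bc by (auto simp: f_def fun_eq_iff commutator_mult_left)
    then show "w \<in> f ` B" using bz by auto
  qed (use BI in auto)
  have cardI: "card I = card (f ` I) * card ?Z"
    using subgroup.m_closed[OF I] ZI Ic f
    by (intro card_eq_card_image_times[OF subgroup_center fin(1)]) auto
  have cardB: "card B = card (f ` B) * card (B \<inter> ?Z)"
  proof (rule card_eq_card_image_times[OF subgroups_Inter_pair[OF B subgroup_center] fin(2)])
    show "f u = f v \<longleftrightarrow> u \<otimes> inv v \<in> B \<inter> ?Z" if "u \<in> B" "v \<in> B" for u v
      using f that Bc subgroup.m_closed[OF B] subgroup.m_inv_closed[OF B] by auto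
  qed (use Bc subgroup.m_closed[OF B] in auto)
  have cardIB: "card I * card (B \<inter> ?Z) = card B * card ?Z"
    unfolding cardI cardB fI by simp
  have BZ_le: "card (B \<inter> ?Z) \<le> card ?T"
    using Bexp fin by (intro card_mono) (auto simp: center_torsion_def)
  have pos: "card I > 0" "card ?Z > 0" "order G > 0"
  proof -
    have "?Z \<noteq> {}" "I \<noteq> {}" "carrier G \<noteq> {}"
      using center_one subgroup.one_closed[OF I] one_closed by blast+
    then show "card I > 0" "card ?Z > 0" "order G > 0"
      using fin by (simp_all add: card_gt_0_iff order_def)
  qed
  have e2: "e > 0" by (rule exponent_pos)
  \<comment> \<open>If \<open>x^k\<close> is in \<open>I\<close> and \<open>y^l\<close> in \<open>I\<langle>x\<rangle>\<close>, then \<open>x^k\<close> and \<open>y^l\<close> commute, so \<open>[x, y]^(kl) = 1\<close> and \<open>e\<close>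
    divides \<open>kl\<close>. Adjoining \<open>x\<close> and \<open>y\<close> to \<open>I\<close> multiplies its order by \<open>kl\<close>.\<close>
  have index: "card I * e \<le> order G"
  proof -
    obtain k :: nat where k: "k > 0" "\<And>i :: int. x [^] i \<in> I \<longleftrightarrow> int k dvd i"
      using least_power_in_subgroup[OF I x e2] pow_exponent_central[OF x] ZI by blast
    define R where "R = adjoin G I x"
    note R = subgroup_adjoin[OF I x commutators_in[OF ZI], folded R_def]
    have cR: "card R = k * card I"
      unfolding R_def by (rule card_adjoin[OF I x finite_carrier commutators_in[OF ZI] k])
    have ZR: "?Z \<subseteq> R" using ZI R by blast
    obtain l :: nat where l: "l > 0" "\<And>i :: int. y [^] i \<in> R \<longleftrightarrow> int l dvd i"
      using least_power_in_subgroup[OF R(1) y e2] pow_exponent_central[OF y] ZR by blast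
    note S = subgroup_adjoin[OF R(1) y commutators_in[OF ZR]]
    have "card (adjoin G R y) = l * (k * card I)"
      using card_adjoin[OF R(1) y finite_carrier commutators_in[OF ZR] l] cR by simp
    moreover have "card (adjoin G R y) \<le> order G"
      unfolding order_def using subgroup.subset[OF S(1)] by (intro card_mono) auto
    moreover have "e dvd k * l"
    proof -
      have "y [^] int l \<in> R" using l(2)[of "int l"] by simp
      then obtain t i where t: "t \<in> I" "y [^] int l = t \<otimes> x [^] (i :: int)"
        unfolding R_def adjoin_def by blast
      have xk: "x [^] int k \<in> I" using k(2)[of "int k"] by simp
      have "commutator G (x [^] int k) (y [^] int l) = \<one>"
      proof -
        have "commutator G (x [^] int k) t = \<one>"
          using x t(1) Ic Icomm[OF xk t(1)] by (simp add: commutator_eq_one_iff del: int_pow_int)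
        moreover have "commutator G (x [^] int k) (x [^] i) = \<one>"
          using x by (simp only: commutator_int_pow_right commutator_int_pow_left commutator_self
              int_pow_closed int_pow_one)
        ultimately show ?thesis
          unfolding t(2) using x t(1) Ic by (simp add: commutator_mult_right)
      qed
      then have "(commutator G x y [^] int k) [^] int l = \<one>"
        using x y by (simp add: commutator_int_pow_right commutator_int_pow_left)
      then have "commutator G x y [^] (k * l) = \<one>"
        using x y by (simp add: int_pow_int nat_pow_pow)
      then show "e dvd k * l" using x y c by (simp add: pow_eq_id)
    qed
    then have "e \<le> k * l" using k l by (intro dvd_imp_le) auto
    then have "card I * e \<le> l * (k * card I)" by (simp add: mult.commute mult.left_commute)
    ultimately show ?thesis by linarith
  qed
  obtain \<mu> where \<mu>: "\<mu> \<in> hom (G\<lparr>carrier := ?T\<rparr>) (integer_mod_group e)" "\<mu> (commutator G x y) = 1"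
    using char_of_center_torsion[of "commutator G x y"] x y c by auto
  interpret T: group "G\<lparr>carrier := ?T\<rparr>"
    using subgroup_center_torsion by (rule subgroup.subgroup_is_group) (rule is_group)
  have \<mu>1: "\<mu> \<one> = 0"
    using hom_one[OF \<mu>(1) T.is_group group_integer_mod_group] by simp
  have "{0..<int e} \<subseteq> \<mu> ` ?T"
  proof
    fix r assume r: "r \<in> {0..<int e}"
    have "commutator G x y [^] r \<in> ?T"
      using x y subgroup_center_torsion by (intro subgroup_int_pow_closed) auto
    moreover have "\<mu> (commutator G x y [^] r) = r"
      using T.char_int_pow[OF \<mu>(1), of "commutator G x y" r] x y \<mu>(2) r
        int_pow_consistent[OF subgroup_center_torsion, of "commutator G x y" e r] by simp
    ultimately show "r \<in> \<mu> ` ?T" by (metis imageI)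
  qed
  then have e\<mu>: "e \<le> card (\<mu> ` ?T)" using fin card_mono[of "\<mu> ` ?T" "{0..<int e}"] by simp
  then have eT: "e \<le> card ?T" using card_image_le[OF fin(4), of \<mu>] by simp
  have chain: "card ?T ^ 2 * order G \<le> e * card ?T * order G"
  proof -
    have "card ?T ^ 2 * order G \<le> e * e * (card I * card (B \<inter> ?Z))"
      using large cardIB by (simp add: ac_simps)
    also have "\<dots> \<le> e * e * (card I * card ?T)" using BZ_le by simp
    also have "\<dots> = e * card ?T * (card I * e)" by simp
    also have "\<dots> \<le> e * card ?T * order G" using index by (rule mult_left_mono) simp
    finally show ?thesis .
  qed
  then have "card ?T * card ?T \<le> e * card ?T" using pos by (simp add: power2_eq_square)
  then have Te: "card ?T = e" using eT e2 by simp
  then show "card ?T = e" .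
  have "e * e * order G \<le> e * e * (card B * card ?Z)"
    using large unfolding Te by (simp add: power2_eq_square ac_simps)
  then have "order G \<le> card I * card (B \<inter> ?Z)" using e2 cardIB by simp
  moreover have "card I * card (B \<inter> ?Z) \<le> card I * e" using BZ_le Te by simp
  ultimately have eqs: "order G = card I * e" "card I * card (B \<inter> ?Z) = card I * e"
    using index by linarith+
  then show BZ: "card (B \<inter> ?Z) = e" using pos by simp
  \<comment> \<open>Commutators now lie in a cyclic group, so \<open>I/Z\<close> embeds into the dual of \<open>G/I\<close>.\<close>
  have "card I \<le> e * card ?Z"
  proof -
    define \<Psi> where "\<Psi> = char_extensions G e I (\<lambda>_. 0)"
    have "card \<Psi> * card I = order G" unfolding \<Psi>_def
    proof (rule card_chars_trivial_on[OF finite_carrier e2 I commutators_in[OF ZI]])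
      show "\<forall>g \<in> carrier G. g [^] e \<in> I" using pow_exponent_central ZI by blast
    qed
    then have card\<Psi>: "card \<Psi> = e" using eqs pos by simp
    have "inj_on \<mu> ?T"
    proof (rule eq_card_imp_inj_on[OF fin(4)])
      show "card (\<mu> ` ?T) = card ?T" using e\<mu> Te card_image_le[OF fin(4), of \<mu>] by simp
    qed
    then have \<mu>inj: "\<mu> u = \<mu> v \<longleftrightarrow> u = v" if "u \<in> ?T" "v \<in> ?T" for u v
      using that by (auto simp: inj_on_def)
    define d where "d v = (\<lambda>g \<in> carrier G. \<mu> (commutator G v g))" for v
    have "card I = card (d ` I) * card ?Z"
    proof (rule card_eq_card_image_times[OF subgroup_center fin(1)])
      show "d u = d v \<longleftrightarrow> u \<otimes> inv v \<in> ?Z" if "u \<in> I" "v \<in> I" for u v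
        using mult_inv_in_center_iff[OF Ic[OF that(1)] Ic[OF that(2)]] Ic[OF that(1)] Ic[OF that(2)]
        by (auto simp: d_def fun_eq_iff \<mu>inj)
    qed (use Ic subgroup.m_closed[OF I] ZI in auto)
    moreover have "d ` I \<subseteq> \<Psi>"
    proof
      fix \<psi> assume "\<psi> \<in> d ` I"
      then obtain v where v: "v \<in> I" "\<psi> = d v" by auto
      have "\<psi> t = 0" if t: "t \<in> I" for t
      proof -
        have "commutator G v t = \<one>" using v t Ic Icomm by (simp add: commutator_eq_one_iff)
        then show ?thesis using v t Ic \<mu>1 by (simp add: d_def)
      qed
      then show "\<psi> \<in> \<Psi>"
        using hom_comp_commutator[OF \<mu>(1)] v Ic by (auto simp: \<Psi>_def char_extensions_def d_def)
    qed
    then have "card (d ` I) \<le> e"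
      using card\<Psi> card_mono[of \<Psi> "d ` I"] finite_char_extensions[OF finite_carrier e2]
      by (simp add: \<Psi>_def)
    ultimately show ?thesis by simp
  qed
  then have up: "order G \<le> e * e * card ?Z" using eqs(1) by simp
  have "e * e * card ?Z \<le> order G"
    using pair_subgroup(1,5)[OF x y c] card_mono[OF finite_carrier subgroup.subset[OF pair_subgroup(1)[OF x y c]]]
    by (simp add: order_def)
  with up show ord: "order G = e * e * card ?Z" by simp
  have "card B * card ?Z = order G" using eqs cardIB by linarith
  then have "card B * card ?Z = e * e * card ?Z" using ord by simp
  then show "card B = e * e" using pos by simp
qed

end

section \<open>Automorphism groups\<close>

lemma (in group) auto_iff:
  "\<alpha> \<in> auto G \<longleftrightarrow> \<alpha> \<in> hom G G \<and> \<alpha> \<in> extensional (carrier G) \<and> bij_betw \<alpha> (carrier G) (carrier G)"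
  by (auto simp: auto_def Bij_def)

lemma carrier_AutoGroup [simp]: "carrier (AutoGroup G) = auto G"
  by (simp add: AutoGroup_def)

lemma one_AutoGroup: "\<one>\<^bsub>AutoGroup G\<^esub> = (\<lambda>x \<in> carrier G. x)"
  by (simp add: AutoGroup_def BijGroup_def)

lemma mult_AutoGroup:
  "\<alpha> \<in> auto G \<Longrightarrow> \<beta> \<in> auto G \<Longrightarrow> \<alpha> \<otimes>\<^bsub>AutoGroup G\<^esub> \<beta> = compose (carrier G) \<alpha> \<beta>"
  by (simp add: AutoGroup_def BijGroup_def auto_def)

lemma mult_AutoGroup_apply:
  "\<alpha> \<in> auto G \<Longrightarrow> \<beta> \<in> auto G \<Longrightarrow> x \<in> carrier G \<Longrightarrow> (\<alpha> \<otimes>\<^bsub>AutoGroup G\<^esub> \<beta>) x = \<alpha> (\<beta> x)"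
  by (simp add: mult_AutoGroup compose_def)

context group
begin

lemma auto_comp_closed: "\<alpha> \<in> auto G \<Longrightarrow> \<beta> \<in> auto G \<Longrightarrow> \<alpha> \<otimes>\<^bsub>AutoGroup G\<^esub> \<beta> \<in> auto G"
  using monoid.m_closed[OF group.is_monoid[OF AutoGroup]] by simp

lemma auto_closed: "\<alpha> \<in> auto G \<Longrightarrow> x \<in> carrier G \<Longrightarrow> \<alpha> x \<in> carrier G"
  by (auto simp: auto_iff hom_def)

lemma auto_mult:
  "\<alpha> \<in> auto G \<Longrightarrow> x \<in> carrier G \<Longrightarrow> y \<in> carrier G \<Longrightarrow> \<alpha> (x \<otimes> y) = \<alpha> x \<otimes> \<alpha> y"
  by (auto simp: auto_iff hom_def)

lemma auto_group_hom: "\<alpha> \<in> auto G \<Longrightarrow> group_hom G G \<alpha>"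
  by (simp add: auto_iff group_hom_def group_hom_axioms_def)

lemma auto_inv: "\<alpha> \<in> auto G \<Longrightarrow> x \<in> carrier G \<Longrightarrow> \<alpha> (inv x) = inv (\<alpha> x)"
  by (rule group_hom.hom_inv[OF auto_group_hom])

lemma auto_one: "\<alpha> \<in> auto G \<Longrightarrow> \<alpha> \<one> = \<one>"
  by (rule group_hom.hom_one[OF auto_group_hom])

lemma auto_inj: "\<alpha> \<in> auto G \<Longrightarrow> x \<in> carrier G \<Longrightarrow> y \<in> carrier G \<Longrightarrow> \<alpha> x = \<alpha> y \<longleftrightarrow> x = y"
  by (auto simp: auto_iff bij_betw_def inj_on_def)

lemma auto_surj:
  assumes "\<alpha> \<in> auto G" "y \<in> carrier G" obtains x where "x \<in> carrier G" "y = \<alpha> x"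
  using assms by (auto simp: auto_iff bij_betw_def)

lemma auto_eqI:
  "\<alpha> \<in> auto G \<Longrightarrow> \<beta> \<in> auto G \<Longrightarrow> (\<And>x. x \<in> carrier G \<Longrightarrow> \<alpha> x = \<beta> x) \<Longrightarrow> \<alpha> = \<beta>"
  by (auto simp: auto_iff intro: extensionalityI)

lemma auto_commutator:
  "\<alpha> \<in> auto G \<Longrightarrow> x \<in> carrier G \<Longrightarrow> y \<in> carrier G \<Longrightarrow>
    \<alpha> (commutator G x y) = commutator G (\<alpha> x) (\<alpha> y)"
  by (simp add: commutator_def auto_mult auto_inv auto_closed)

lemma finite_autoI:
  assumes "finite (carrier G)" "\<alpha> \<in> hom G G" "\<alpha> \<in> extensional (carrier G)"
    and "\<And>x. x \<in> carrier G \<Longrightarrow> \<alpha> x = \<one> \<Longrightarrow> x = \<one>"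
  shows "\<alpha> \<in> auto G"
proof -
  interpret \<alpha>: group_hom G G \<alpha> using assms by (simp add: group_hom_def group_hom_axioms_def)
  have "inj_on \<alpha> (carrier G)" using assms(4) by (intro \<alpha>.inj_on_one_iff[THEN iffD2]) auto
  then have "bij_betw \<alpha> (carrier G) (carrier G)"
    using endo_inj_surj[OF assms(1), of \<alpha>] \<alpha>.hom_closed by (simp add: bij_betw_def image_subset_iff)
  then show ?thesis using assms by (simp add: auto_iff)
qed

lemma center_auto: "\<alpha> \<in> auto G \<Longrightarrow> z \<in> center G \<Longrightarrow> \<alpha> z \<in> center G"
proof (rule centerI)
  fix g assume \<alpha>: "\<alpha> \<in> auto G" and z: "z \<in> center G" and g: "g \<in> carrier G"
  obtain h where h: "h \<in> carrier G" "g = \<alpha> h" using auto_surj[OF \<alpha> g] by blast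
  have "z \<otimes> h = h \<otimes> z" using z h by (simp add: center_commutes)
  then show "\<alpha> z \<otimes> g = g \<otimes> \<alpha> z"
    using auto_mult[OF \<alpha> _ h(1), of z] auto_mult[OF \<alpha> h(1), of z] z h by simp
qed (simp add: auto_closed)

lemma conj_aut_apply: "x \<in> carrier G \<Longrightarrow> conj_aut G g x = g \<otimes> x \<otimes> inv g"
  by (simp add: conj_aut_def)

lemma conj_aut_auto:
  assumes g: "g \<in> carrier G" shows "conj_aut G g \<in> auto G"
proof -
  have hom: "conj_aut G g \<in> hom G G"
    using g by (auto simp: hom_def conj_aut_def m_assoc)
  have "bij_betw (conj_aut G g) (carrier G) (carrier G)"
    by (rule bij_betwI[of _ _ _ "\<lambda>x. inv g \<otimes> x \<otimes> g"]) (use g in \<open>auto simp: conj_aut_def m_assoc\<close>)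
  with hom show ?thesis by (simp add: auto_iff conj_aut_def)
qed

lemma conj_aut_hom: "conj_aut G \<in> hom G (AutoGroup G)"
proof (rule homI)
  show "conj_aut G g \<in> carrier (AutoGroup G)" if "g \<in> carrier G" for g
    using that by (simp add: conj_aut_auto)
  show "conj_aut G (g \<otimes> h) = conj_aut G g \<otimes>\<^bsub>AutoGroup G\<^esub> conj_aut G h"
    if "g \<in> carrier G" "h \<in> carrier G" for g h
    using that
    by (intro auto_eqI auto_comp_closed conj_aut_auto)
      (simp_all add: mult_AutoGroup_apply conj_aut_auto conj_aut_apply m_assoc inv_mult_group)
qed

lemma conj_aut_eq_one_iff:
  assumes g: "g \<in> carrier G"
  shows "conj_aut G g = \<one>\<^bsub>AutoGroup G\<^esub> \<longleftrightarrow> g \<in> center G"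
proof -
  have "conj_aut G g = \<one>\<^bsub>AutoGroup G\<^esub> \<longleftrightarrow> (\<forall>x \<in> carrier G. g \<otimes> x \<otimes> inv g = x)"
    by (auto simp: one_AutoGroup conj_aut_def fun_eq_iff)
  also have "\<dots> \<longleftrightarrow> (\<forall>x \<in> carrier G. g \<otimes> x = x \<otimes> g)"
    using g by (intro ball_cong refl) (metis inv_solve_right m_closed inv_closed)
  also have "\<dots> \<longleftrightarrow> g \<in> center G" using g unfolding center_def by blast
  finally show ?thesis .
qed

lemma auto_conj_aut:
  assumes \<alpha>: "\<alpha> \<in> auto G" and g: "g \<in> carrier G"
  shows "\<alpha> \<otimes>\<^bsub>AutoGroup G\<^esub> conj_aut G g = conj_aut G (\<alpha> g) \<otimes>\<^bsub>AutoGroup G\<^esub> \<alpha>"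
  using assms
  by (intro auto_eqI auto_comp_closed conj_aut_auto)
    (simp_all add: mult_AutoGroup_apply conj_aut_auto conj_aut_apply auto_closed auto_mult auto_inv)

end

text \<open>Every homomorphism from \<open>G/Z(G)\<close> to \<open>Z(G)\<close> yields an automorphism.\<close>

definition central_aut :: "('a, 'm) monoid_scheme \<Rightarrow> ('a \<Rightarrow> 'a) \<Rightarrow> 'a \<Rightarrow> 'a"
  where "central_aut G f = (\<lambda>g \<in> carrier G. g \<otimes>\<^bsub>G\<^esub> f g)"

context group
begin

lemma central_homsD:
  assumes "f \<in> central_homs G"
  shows "f \<in> hom G G" "f \<in> extensional (carrier G)"
    "\<And>g. g \<in> carrier G \<Longrightarrow> f g \<in> center G" "\<And>z. z \<in> center G \<Longrightarrow> f z = \<one>"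
    "\<And>g h. g \<in> carrier G \<Longrightarrow> h \<in> carrier G \<Longrightarrow> f (g \<otimes> h) = f g \<otimes> f h"
  using assms by (auto simp: central_homs_def hom_def)

lemma central_aut_auto:
  assumes fin: "finite (carrier G)" and f: "f \<in> central_homs G"
  shows "central_aut G f \<in> auto G"
proof (rule finite_autoI[OF fin])
  note f = central_homsD[OF f]
  show "central_aut G f \<in> hom G G"
  proof (rule homI)
    show "central_aut G f g \<in> carrier G" if "g \<in> carrier G" for g
      using that f(3) by (simp add: central_aut_def)
    show "central_aut G f (g \<otimes> h) = central_aut G f g \<otimes> central_aut G f h"
      if "g \<in> carrier G" "h \<in> carrier G" for g h
      using that f center_commutes_left[of "f g" h "f h"] by (simp add: central_aut_def m_assoc)
  qed
  show "central_aut G f \<in> extensional (carrier G)" by (simp add: central_aut_def)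
  fix x assume x: "x \<in> carrier G" "central_aut G f x = \<one>"
  then have "x \<otimes> f x = \<one>" by (simp add: central_aut_def)
  then have "x = inv (f x)" using x f(3) by (metis center_closed inv_equality)
  then have "x \<in> center G" using f(3)[OF x(1)] by (metis center_inv)
  then show "x = \<one>" using \<open>x \<otimes> f x = \<one>\<close> f(4) by simp
qed

lemma central_aut_mult:
  assumes fin: "finite (carrier G)" and f: "f \<in> central_homs G" and h: "h \<in> central_homs G"
  shows "central_aut G f \<otimes>\<^bsub>AutoGroup G\<^esub> central_aut G h = central_aut G (\<lambda>g \<in> carrier G. f g \<otimes> h g)"
  unfolding mult_AutoGroup[OF central_aut_auto[OF fin f] central_aut_auto[OF fin h]]
proof (rule extensionalityI[of _ "carrier G"])
  fix g assume g: "g \<in> carrier G"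
  note F = central_homsD[OF f] and H = central_homsD[OF h]
  have "h g \<otimes> f g = f g \<otimes> h g" using F H g by (intro center_commutes) auto
  then show "compose (carrier G) (central_aut G f) (central_aut G h) g
      = central_aut G (\<lambda>g \<in> carrier G. f g \<otimes> h g) g"
    using g F H by (simp add: compose_def central_aut_def m_assoc)
qed (auto simp: central_aut_def compose_def)

lemma inj_central_aut: "inj_on (central_aut G) (central_homs G)"
proof (rule inj_onI)
  fix f h assume fh: "f \<in> central_homs G" "h \<in> central_homs G" "central_aut G f = central_aut G h"
  show "f = h"
  proof (rule extensionalityI[OF central_homsD(2)[OF fh(1)] central_homsD(2)[OF fh(2)]])
    fix g assume g: "g \<in> carrier G"
    have "central_aut G f g = central_aut G h g" using fh(3) by simp
    then show "f g = h g"
      using g central_homsD(3)[OF fh(1) g] central_homsD(3)[OF fh(2) g] by (simp add: central_aut_def)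
  qed
qed

end

lemma (in class_two_group) conj_aut_central:
  assumes g: "g \<in> carrier G"
  shows "restrict (commutator G g) (carrier G) \<in> central_homs G"
    and "conj_aut G g = central_aut G (restrict (commutator G g) (carrier G))"
proof -
  show "restrict (commutator G g) (carrier G) \<in> central_homs G"
    using g commutator_hom_right[OF g] unfolding central_homs_def by (auto simp: hom_def)
  have "g \<otimes> x \<otimes> inv g = x \<otimes> commutator G g x" if x: "x \<in> carrier G" for x
  proof -
    have "x \<otimes> commutator G g x = commutator G g x \<otimes> x"
      using x g center_commutes[of "commutator G g x" x] by simp
    then show ?thesis using x g by (simp add: commutator_def m_assoc)
  qed
  then show "conj_aut G g = central_aut G (restrict (commutator G g) (carrier G))"
    by (auto simp: conj_aut_def central_aut_def fun_eq_iff)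
qed

section \<open>Class-two groups that contain their automorphism group\<close>

locale class_two_embedding = class_two_exponent +
  fixes \<sigma> :: "('a \<Rightarrow> 'a) \<Rightarrow> 'a"
  assumes \<sigma>_hom: "\<sigma> \<in> hom (AutoGroup G) G" and \<sigma>_inj: "inj_on \<sigma> (auto G)"
begin

text \<open>Composed with conjugation, \<open>\<sigma>\<close> becomes an endomorphism of \<open>G\<close> whose kernel is the center.\<close>

definition inner_embedding :: "'a \<Rightarrow> 'a" where "inner_embedding g = \<sigma> (conj_aut G g)"

lemma \<sigma>_closed [simp]: "\<alpha> \<in> auto G \<Longrightarrow> \<sigma> \<alpha> \<in> carrier G"
  using \<sigma>_hom by (auto simp: hom_def)

lemma \<sigma>_mult: "\<alpha> \<in> auto G \<Longrightarrow> \<beta> \<in> auto G \<Longrightarrow> \<sigma> (\<alpha> \<otimes>\<^bsub>AutoGroup G\<^esub> \<beta>) = \<sigma> \<alpha> \<otimes> \<sigma> \<beta>"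
  using \<sigma>_hom by (auto simp: hom_def)

lemma \<sigma>_one: "\<sigma> \<one>\<^bsub>AutoGroup G\<^esub> = \<one>"
  using hom_one[OF \<sigma>_hom AutoGroup is_group] .

lemma group_hom_inner_embedding: "group_hom G G inner_embedding"
  unfolding group_hom_def group_hom_axioms_def
  using Group.hom_compose[OF conj_aut_hom \<sigma>_hom] by (simp add: inner_embedding_def[abs_def] comp_def)

sublocale s: group_hom G G inner_embedding
  by (rule group_hom_inner_embedding)

lemma inner_embedding_eq_one_iff:
  assumes "g \<in> carrier G" shows "inner_embedding g = \<one> \<longleftrightarrow> g \<in> center G"
proof -
  have "inner_embedding g = \<one> \<longleftrightarrow> \<sigma> (conj_aut G g) = \<sigma> \<one>\<^bsub>AutoGroup G\<^esub>"
    by (simp add: inner_embedding_def \<sigma>_one)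
  also have "\<dots> \<longleftrightarrow> conj_aut G g = \<one>\<^bsub>AutoGroup G\<^esub>"
    using \<sigma>_inj conj_aut_auto[OF assms] monoid.one_closed[OF group.is_monoid[OF AutoGroup]]
    by (auto simp: inj_on_def)
  finally show ?thesis using conj_aut_eq_one_iff[OF assms] by simp
qed

lemma inner_embedding_int_pow:
  "g \<in> carrier G \<Longrightarrow> inner_embedding (g [^] (i :: int)) = inner_embedding g [^] i"
  by (rule hom_int_pow[OF s.homh _ is_group is_group])

lemma inner_embedding_eq_iff:
  assumes "g \<in> carrier G" "h \<in> carrier G"
  shows "inner_embedding g = inner_embedding h \<longleftrightarrow> g \<otimes> inv h \<in> center G"
  using assms inner_embedding_eq_one_iff[of "g \<otimes> inv h"] by (simp add: mult_inv_eq_one_iff)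

definition central_image :: "'a set" where "central_image = \<sigma> ` central_aut G ` central_homs G"

lemma central_image_properties:
  shows "subgroup central_image G" "\<And>b b'. b \<in> central_image \<Longrightarrow> b' \<in> central_image \<Longrightarrow> b \<otimes> b' = b' \<otimes> b"
    "\<And>b. b \<in> central_image \<Longrightarrow> b [^] e = \<one>" "inner_embedding ` carrier G \<subseteq> central_image" "card central_image = card (central_homs G)"
proof -
  define \<tau> where "\<tau> f = \<sigma> (central_aut G f)" for f
  have image_\<tau>: "central_image = \<tau> ` central_homs G" by (auto simp: central_image_def \<tau>_def)
  have aut: "central_aut G f \<in> auto G" if "f \<in> central_homs G" for f
    using central_aut_auto[OF finite_carrier that] .
  have prod: "(\<lambda>g \<in> carrier G. f g \<otimes> h g) \<in> central_homs G"
    if "f \<in> central_homs G" "h \<in> central_homs G" for f h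
    using central_homsD[OF that(1)] central_homsD[OF that(2)]
    by (intro central_homI central_mult_hom) auto
  have \<tau>: "\<tau> f \<otimes> \<tau> h = \<tau> (\<lambda>g \<in> carrier G. f g \<otimes> h g)"
    if "f \<in> central_homs G" "h \<in> central_homs G" for f h
    unfolding \<tau>_def using that by (simp add: aut central_aut_mult flip: \<sigma>_mult)
  have \<tau>c: "\<tau> f \<in> carrier G" if "f \<in> central_homs G" for f
    using aut[OF that] by (simp add: \<tau>_def)
  show comm: "b \<otimes> b' = b' \<otimes> b" if "b \<in> central_image" "b' \<in> central_image" for b b'
  proof -
    from that obtain f h where fh: "f \<in> central_homs G" "h \<in> central_homs G" "b = \<tau> f" "b' = \<tau> h"
      unfolding image_\<tau> by auto
    have "(\<lambda>g \<in> carrier G. f g \<otimes> h g) = (\<lambda>g \<in> carrier G. h g \<otimes> f g)"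
      using central_homsD(3)[OF fh(1)] central_homsD(3)[OF fh(2)]
      by (intro restrict_ext center_commutes) auto
    then show ?thesis using \<tau> fh by simp
  qed
  have triv: "(\<lambda>g \<in> carrier G. \<one>) \<in> central_homs G"
    by (auto simp: central_homs_def hom_def)
  have \<tau>1: "\<tau> (\<lambda>g \<in> carrier G. \<one>) = \<one>"
    using \<tau>[OF triv triv] \<tau>c[OF triv] by (simp cong: restrict_cong)
  define P where "P f n = (\<lambda>g \<in> carrier G. f g [^] n)" for f :: "'a \<Rightarrow> 'a" and n :: nat
  have P0: "P f 0 = (\<lambda>g \<in> carrier G. \<one>)" for f by (simp add: P_def)
  have PSuc: "(\<lambda>g \<in> carrier G. P f n g \<otimes> f g) = P f (Suc n)" for f n
    unfolding P_def by (rule restrict_ext) simp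
  have pow: "P f n \<in> central_homs G \<and> \<tau> f [^] n = \<tau> (P f n)" if f: "f \<in> central_homs G" for f n
  proof (induction n)
    case 0
    show ?case unfolding P0 \<tau>1 using triv nat_pow_0 by blast
  next
    case (Suc n)
    then show ?case
      using prod[of "P f n" f] \<tau>[of "P f n" f] f unfolding PSuc by simp
  qed
  show exp: "b [^] e = \<one>" if "b \<in> central_image" for b
  proof -
    from that obtain f where f: "f \<in> central_homs G" "b = \<tau> f" unfolding image_\<tau> by auto
    interpret f: group_hom G G f
      using central_homsD(1)[OF f(1)] by (simp add: group_hom_def group_hom_axioms_def)
    have "f g [^] e = \<one>" if g: "g \<in> carrier G" for g
      using central_homsD(4)[OF f(1) pow_exponent_central[OF g]] g by (simp add: f.hom_nat_pow)
    then have "P f e = (\<lambda>g \<in> carrier G. \<one>)" unfolding P_def by (rule restrict_ext)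
    then show ?thesis using pow[OF f(1), of e] f(2) \<tau>1 by metis
  qed
  have closed: "b \<in> carrier G" if "b \<in> central_image" for b using that \<tau>c unfolding image_\<tau> by auto
  have pow_mem: "b [^] n \<in> central_image" if "b \<in> central_image" for b and n :: nat
    using that pow unfolding image_\<tau> by auto
  show "subgroup central_image G"
  proof (rule subgroupI)
    show "central_image \<subseteq> carrier G" using closed by auto
    show "central_image \<noteq> {}" using triv unfolding image_\<tau> by auto
    show "b \<otimes> b' \<in> central_image" if "b \<in> central_image" "b' \<in> central_image" for b b'
      using that prod \<tau> unfolding image_\<tau> by auto
    show "inv b \<in> central_image" if b: "b \<in> central_image" for b
    proof -
      have "b [^] (e - 1) \<otimes> b = b [^] e"
        using exponent_pos closed[OF b] by (simp flip: nat_pow_Suc)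
      then have "inv b = b [^] (e - 1)" using exp[OF b] closed[OF b] by (intro inv_equality) auto
      then show ?thesis using pow_mem[OF b] by simp
    qed
  qed
  show "inner_embedding ` carrier G \<subseteq> central_image"
    using conj_aut_central unfolding central_image_def inner_embedding_def by auto
  have "inj_on \<sigma> (central_aut G ` central_homs G)"
    using aut by (intro inj_on_subset[OF \<sigma>_inj]) auto
  then show "card central_image = card (central_homs G)"
    unfolding central_image_def by (simp add: card_image inj_central_aut)
qed

text \<open>The image of the central automorphisms is an abelian subgroup of exponent \<open>e\<close> that is as large as the
  set of homomorphisms from \<open>G/Z(G)\<close> to \<open>Z(G)\<close>, so \<open>abelian_subgroup_bound\<close> applies to it. Its
  order \<open>e^2\<close> is that of the group of inner automorphisms, which are among the central ones.\<close>

lemma shape: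
  shows "order G = e * e * card (center G)" "card (center_torsion G e) = e"
    "central_image = inner_embedding ` carrier G" "inner_embedding ` carrier G \<inter> center G = center_torsion G e"
proof -
  obtain x where x: "full_order G e x" using exponent_attained by blast
  then have xc: "x \<in> carrier G" by (simp add: full_order_def)
  obtain y where y: "y \<in> carrier G" "ord (commutator G x y) = e"
    using commutator_of_full_order[OF x] by blast
  have le: "card (center_torsion G e) ^ 2 * order G \<le> card central_image * (e * e * card (center G))"
    using card_central_homs_ge[OF xc y] central_image_properties(5) by simp
  have bd: "order G = e * e * card (center G)" "card (center_torsion G e) = e"
    "card central_image = e * e" "card (central_image \<inter> center G) = e"
    by (rule abelian_subgroup_bound[OF xc y central_image_properties(1) _ _ le];
        blast intro: central_image_properties(2,3))+
  show "order G = e * e * card (center G)" by (fact bd(1))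
  show "card (center_torsion G e) = e" by (fact bd(2))
  have finB: "finite central_image"
    using subgroup.subset[OF central_image_properties(1)] by (rule finite_subset) simp
  have zpos: "card (center G) > 0"
    using center_one finite_subset[OF center_subset finite_carrier] by (metis card_gt_0_iff emptyE)
  have "order G = card (inner_embedding ` carrier G) * card (center G)"
    unfolding order_def
    by (rule card_eq_card_image_times[OF subgroup_center]) (auto simp: inner_embedding_eq_iff)
  then have "card (inner_embedding ` carrier G) = e * e" using bd(1) zpos by simp
  then show central_image: "central_image = inner_embedding ` carrier G"
    using bd(3) central_image_properties(4) finB by (metis card_subset_eq)
  have "central_image \<inter> center G \<subseteq> center_torsion G e"
    using central_image_properties(3) by (auto simp: center_torsion_def)
  moreover have "finite (center_torsion G e)"
    by (rule finite_subset[OF _ finite_carrier]) (auto simp: center_torsion_def)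
  ultimately have "central_image \<inter> center G = center_torsion G e"
    using bd(2,4) by (metis card_subset_eq)
  then show "inner_embedding ` carrier G \<inter> center G = center_torsion G e" using central_image by simp
qed

lemma torsion_powers:
  assumes d: "d \<in> center_torsion G e" "ord d = e" and t: "t \<in> center_torsion G e"
  obtains i :: int where "t = d [^] i"
proof -
  have dc: "d \<in> carrier G" using d by (simp add: center_torsion_def)
  have "generate G {d} \<subseteq> center_torsion G e"
    using d by (intro generate_subgroup_incl subgroup_center_torsion) auto
  moreover have "card (generate G {d}) = card (center_torsion G e)"
    using generate_pow_card[OF dc] d shape(2) by simp
  moreover have "finite (center_torsion G e)"
    by (rule finite_subset[OF _ finite_carrier]) (auto simp: center_torsion_def)
  ultimately have "generate G {d} = center_torsion G e" by (metis card_subset_eq)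
  then have "t \<in> {d [^] (k :: int) | k. k \<in> UNIV}" using t generate_pow[OF dc] by simp
  then show ?thesis using that by blast
qed

text \<open>By \<open>shape\<close>, some conjugation by an element \<open>y\<close> is sent to a generator of the central torsion.
  Since \<open>\<sigma>\<close> is injective, conjugation by \<open>y\<close> commutes with every automorphism, that is, \<open>y\<close> is fixed modulo the
  center. Commutators of automorphisms with conjugations are also sent to the central torsion, so every
  automorphism moves \<open>x\<close> only by powers of \<open>y\<close> modulo the center. Such an automorphism fixes \<open>[x, y]\<close>,
  which generates the central torsion.\<close>

lemma fixed_frame:
  obtains x y where "x \<in> carrier G" "y \<in> carrier G" "ord (commutator G x y) = e"
    "inner_embedding y \<in> center_torsion G e" "ord (inner_embedding y) = e"
    "\<And>\<alpha> t. \<alpha> \<in> auto G \<Longrightarrow> t \<in> center_torsion G e \<Longrightarrow> \<alpha> t = t"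
proof -
  obtain x0 where x0: "full_order G e x0" using exponent_attained by blast
  then have x0c: "x0 \<in> carrier G" by (simp add: full_order_def)
  obtain y0 where y0: "y0 \<in> carrier G" "ord (commutator G x0 y0) = e"
    using commutator_of_full_order[OF x0] by blast
  have "commutator G x0 y0 \<in> inner_embedding ` carrier G"
    using shape(4) x0c y0(1) commutator_in_torsion by blast
  then obtain y where y: "y \<in> carrier G" "commutator G x0 y0 = inner_embedding y" by blast
  have sy: "inner_embedding y \<in> center_torsion G e" "ord (inner_embedding y) = e"
    using y y0 x0c commutator_in_torsion[of x0 y0] by auto
  have "full_order G e y"
    unfolding full_order_def
  proof (intro conjI allI)
    fix i :: int
    have "y [^] i \<in> center G \<longleftrightarrow> inner_embedding y [^] i = \<one>"
      using y(1) inner_embedding_eq_one_iff[of "y [^] i"] inner_embedding_int_pow by simp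
    then show "y [^] i \<in> center G \<longleftrightarrow> int e dvd i"
      using y(1) sy(2) by (simp add: int_pow_eq_id)
  qed (fact y(1))
  then obtain x where x: "x \<in> carrier G" "ord (commutator G y x) = e"
    using commutator_of_full_order by blast
  have ord: "ord (commutator G x y) = e"
    using x y(1) commutator_swap_inv[of y x] by simp
  have move: "inner_embedding (\<alpha> g \<otimes> inv g) = commutator G (\<sigma> \<alpha>) (inner_embedding g)"
    if \<alpha>: "\<alpha> \<in> auto G" and g: "g \<in> carrier G" for \<alpha> g
  proof -
    have "\<sigma> \<alpha> \<otimes> inner_embedding g = inner_embedding (\<alpha> g) \<otimes> \<sigma> \<alpha>"
      using auto_conj_aut[OF \<alpha> g] \<alpha> g
      by (simp add: inner_embedding_def conj_aut_auto auto_closed flip: \<sigma>_mult)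
    then have "inner_embedding (\<alpha> g) = \<sigma> \<alpha> \<otimes> inner_embedding g \<otimes> inv (\<sigma> \<alpha>)"
      using \<alpha> g by (simp add: m_assoc auto_closed)
    then show ?thesis
      using \<alpha> g by (simp add: commutator_def auto_closed)
  qed
  have fix_comm: "\<alpha> (commutator G x y) = commutator G x y" if \<alpha>: "\<alpha> \<in> auto G" for \<alpha>
  proof -
    have "inner_embedding (\<alpha> y \<otimes> inv y) = \<one>"
      using move[OF \<alpha> y(1)] sy(1) \<alpha> by (simp add: center_torsion_def)
    then have "\<alpha> y \<otimes> inv y \<in> center G"
      using \<alpha> y(1) inner_embedding_eq_one_iff[of "\<alpha> y \<otimes> inv y"] by (simp add: auto_closed del: s.hom_mult)
    then have \<alpha>y: "commutator G (\<alpha> y) h = commutator G y h" if "h \<in> carrier G" for h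
      using mult_inv_in_center_iff[of "\<alpha> y" y] \<alpha> y(1) that by (simp add: auto_closed)
    have "inner_embedding (\<alpha> x \<otimes> inv x) \<in> center_torsion G e"
      using move[OF \<alpha> x(1)] \<alpha> x(1) by simp
    then obtain i :: int where "inner_embedding (\<alpha> x \<otimes> inv x) = inner_embedding y [^] i"
      using torsion_powers[OF sy] by blast
    then have "inner_embedding (\<alpha> x) = inner_embedding (y [^] i \<otimes> x)"
      using \<alpha> x(1) y(1) by (simp add: inner_embedding_int_pow auto_closed inv_solve_right')
    then have \<alpha>x: "commutator G (\<alpha> x) h = commutator G (y [^] i \<otimes> x) h" if "h \<in> carrier G" for h
      using \<alpha> x(1) y(1) that mult_inv_in_center_iff[of "\<alpha> x" "y [^] i \<otimes> x"]
        inner_embedding_eq_iff[of "\<alpha> x" "y [^] i \<otimes> x"]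
      by (simp add: auto_closed del: s.hom_mult)
    have "\<alpha> (commutator G x y) = commutator G (\<alpha> x) (\<alpha> y)"
      using \<alpha> x(1) y(1) by (simp add: auto_commutator)
    also have "\<dots> = commutator G (y [^] i \<otimes> x) (\<alpha> y)"
      by (rule \<alpha>x[OF auto_closed[OF \<alpha> y(1)]])
    also have "\<dots> = inv (commutator G (\<alpha> y) (y [^] i \<otimes> x))"
      using \<alpha> x(1) y(1) by (intro commutator_swap_inv) (auto simp: auto_closed)
    also have "\<dots> = inv (commutator G y (y [^] i \<otimes> x))" using \<alpha>y[of "y [^] i \<otimes> x"] x(1) y(1) by simp
    also have "\<dots> = commutator G (y [^] i \<otimes> x) y"
      using x(1) y(1) by (intro commutator_swap_inv[symmetric]) auto
    also have "\<dots> = commutator G x y"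
      using x(1) y(1) by (simp add: commutator_mult_left commutator_int_pow_left)
    finally show ?thesis .
  qed
  have "\<alpha> t = t" if \<alpha>: "\<alpha> \<in> auto G" and t: "t \<in> center_torsion G e" for \<alpha> t
  proof -
    obtain i :: int where i: "t = commutator G x y [^] i"
      using torsion_powers[OF _ ord t] x(1) y(1) by auto
    then show ?thesis
      using hom_int_pow[of \<alpha> G G "commutator G x y" i] \<alpha> fix_comm[OF \<alpha>] x(1) y(1)
      by (simp add: auto_iff)
  qed
  with that x(1) y(1) ord sy show ?thesis by blast
qed

end

lemma (in class_two_group) commutator_inv_right:
  "x \<in> carrier G \<Longrightarrow> z \<in> carrier G \<Longrightarrow> commutator G z (inv x) = inv (commutator G z x)"
  using group_hom.hom_inv[of G G "commutator G z" x] commutator_hom_right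
  by (simp add: group_hom_def group_hom_axioms_def)

context class_two_exponent
begin

lemma frame_decomposition:
  assumes shape: "order G = e * e * card (center G)"
    and u: "u \<in> carrier G" and w: "w \<in> carrier G" and c: "ord (commutator G u w) = e"
    and g: "g \<in> carrier G"
  obtains z and i j :: int where "z \<in> center G" "g = z \<otimes> u [^] i \<otimes> w [^] j"
proof -
  note S = pair_subgroup[OF u w c]
  have "adjoin G (adjoin G (center G) u) w = carrier G"
    using S(5) shape subgroup.subset[OF S(1)] by (intro card_subset_eq) (auto simp: order_def)
  then have "g \<in> adjoin G (adjoin G (center G) u) w" using g by simp
  then show ?thesis using that unfolding adjoin_def by blast
qed

text \<open>If \<open>w\<close> has order \<open>e\<close>, then \<open>G\<close> is the semidirect product of the abelian centralizer \<open>L\<close> of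
  \<open>u\<close> by the group generated by \<open>w\<close>. Inversion on \<open>L\<close> commutes with the action of \<open>w\<close>, so it
  extends to an automorphism fixing \<open>w\<close>. For \<open>g = l w^j\<close> with \<open>l \<in> L\<close> its value is
  \<open>inv l w^j = w^j inv g w^j\<close>.\<close>

lemma inversion_automorphism:
  assumes shape: "order G = e * e * card (center G)"
    and u: "u \<in> carrier G" and w: "w \<in> carrier G" and c: "ord (commutator G u w) = e"
    and we: "w [^] e = \<one>"
  obtains \<iota> where "\<iota> \<in> auto G" "\<And>z. z \<in> center G \<Longrightarrow> \<iota> z = inv z"
    "\<And>g. g \<in> carrier G \<Longrightarrow> \<iota> (\<iota> g) = g"
    "\<And>g. g \<in> carrier G \<Longrightarrow> \<exists>j :: int. \<iota> g = w [^] j \<otimes> inv g \<otimes> w [^] j"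
proof -
  define d where "d = commutator G u w"
  have dT: "d \<in> center_torsion G e" using u w by (simp add: d_def)
  obtain \<mu> where \<mu>: "\<mu> \<in> hom (G\<lparr>carrier := center_torsion G e\<rparr>) (integer_mod_group e)" "\<mu> d = 1"
    using char_of_center_torsion[OF dT] c unfolding d_def by blast
  define J where "J = (\<lambda>g \<in> carrier G. \<mu> (commutator G u g))"
  have Jh: "J \<in> hom G (integer_mod_group e)"
    unfolding J_def by (rule hom_comp_commutator[OF \<mu>(1) u])
  have Jmult: "J (g \<otimes> h) = (J g + J h) mod int e" if "g \<in> carrier G" "h \<in> carrier G" for g h
    using Jh that by (simp add: hom_integer_mod_group_iff[OF exponent_pos])
  have Jr: "J g mod int e = J g" if "g \<in> carrier G" for g
    using Jh that by (simp add: hom_integer_mod_group_iff[OF exponent_pos])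
  have Jw: "J w = 1" using w \<mu>(2) by (simp add: J_def d_def)
  interpret T: group "G\<lparr>carrier := center_torsion G e\<rparr>"
    using subgroup_center_torsion by (rule subgroup.subgroup_is_group) (rule is_group)
  have \<mu>1: "\<mu> \<one> = 0"
    using hom_one[OF \<mu>(1) T.is_group group_integer_mod_group] by simp
  have J0: "J g = 0" if "g \<in> carrier G" "commutator G u g = \<one>" for g
    using that \<mu>1 by (simp add: J_def)
  define L where "L = {g \<in> carrier G. commutator G u g = \<one>}"
  have Lc: "l \<in> carrier G" if "l \<in> L" for l using that by (simp add: L_def)
  have L: "subgroup L G"
  proof (rule subgroupI)
    show "L \<subseteq> carrier G" by (auto simp: L_def)
    have "\<one> \<in> L" using u by (simp add: L_def)
    then show "L \<noteq> {}" by blast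
    show "inv l \<in> L" if "l \<in> L" for l
      using that u by (simp add: L_def commutator_inv_right)
    show "l \<otimes> m \<in> L" if "l \<in> L" "m \<in> L" for l m
      using that u by (simp add: L_def commutator_mult_right)
  qed
  have Lform: "\<exists>z \<in> center G. \<exists>i :: int. l = z \<otimes> u [^] i" if l: "l \<in> L" for l
  proof -
    obtain z and i j :: int where z: "z \<in> center G" "l = z \<otimes> u [^] i \<otimes> w [^] j"
      using frame_decomposition[OF shape u w c Lc[OF l]] by blast
    have "\<one> = commutator G u l" using l by (simp add: L_def)
    also have "\<dots> = commutator G u w [^] j"
      unfolding z(2) using z(1) u w by (simp add: commutator_mult_right commutator_int_pow_right)
    finally have "commutator G u w [^] j = \<one>" by simp
    then have "int e dvd j" using u w c by (simp add: int_pow_eq_id)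
    then have "w [^] j = \<one>" using int_pow_mod[OF w we, of j] by simp
    then show ?thesis using z u by auto
  qed
  have Lcomm: "l \<otimes> m = m \<otimes> l" if l: "l \<in> L" and m: "m \<in> L" for l m
  proof -
    obtain z i where z: "z \<in> center G" "l = z \<otimes> u [^] (i :: int)" using Lform[OF l] by blast
    obtain z' i' where z': "z' \<in> center G" "m = z' \<otimes> u [^] (i' :: int)" using Lform[OF m] by blast
    have "commutator G l m = \<one>"
      unfolding z z' using z(1) z'(1) u
      by (simp add: commutator_mult_left commutator_mult_right commutator_int_pow_left commutator_int_pow_right)
    then show ?thesis using Lc[OF l] Lc[OF m] by (simp add: commutator_eq_one_iff)
  qed
  have Ldec: "g \<otimes> w [^] (- J g) \<in> L" if g: "g \<in> carrier G" for g
  proof -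
    obtain z and i j :: int where z: "z \<in> center G" "g = z \<otimes> u [^] i \<otimes> w [^] j"
      using frame_decomposition[OF shape u w c g] by blast
    have cg: "commutator G u g = commutator G u w [^] j"
      unfolding z(2) using z(1) u w by (simp add: commutator_mult_right commutator_int_pow_right)
    have "J g = j mod int e"
    proof -
      have "J g = \<mu> (d [^] j)" using g cg by (simp add: J_def d_def)
      also have "\<dots> = \<mu> (d [^]\<^bsub>G\<lparr>carrier := center_torsion G e\<rparr>\<^esub> j)"
        using int_pow_consistent[OF subgroup_center_torsion dT] by simp
      also have "\<dots> = j mod int e" using T.char_int_pow[OF \<mu>(1), of d j] dT \<mu>(2) by simp
      finally show ?thesis .
    qed
    then have "d [^] J g = d [^] j"
      using int_pow_mod[of d e j] dT by (simp add: center_torsion_def)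
    moreover have "commutator G u (g \<otimes> w [^] (- J g)) = d [^] j \<otimes> inv (d [^] J g)"
      using g u w cg
      by (simp add: commutator_mult_right commutator_int_pow_right commutator_inv_right d_def int_pow_neg)
    ultimately show ?thesis using g w u by (simp add: L_def d_def)
  qed
  have Lconj: "w [^] i \<otimes> l \<otimes> inv (w [^] i) \<in> L" if l: "l \<in> L" for l and i :: int
  proof -
    have "commutator G u (w [^] i \<otimes> l \<otimes> w [^] (- i))
        = commutator G u w [^] i \<otimes> commutator G u l \<otimes> inv (commutator G u w [^] i)"
      using u w Lc[OF l]
      by (simp add: commutator_mult_right commutator_int_pow_right commutator_inv_right int_pow_neg)
    then show ?thesis using l u w by (simp add: L_def int_pow_neg)
  qed
  have wmod: "w [^] (i mod int e) = w [^] i" for i by (rule int_pow_mod[OF w we])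
  define \<iota> where "\<iota> = (\<lambda>g \<in> carrier G. w [^] J g \<otimes> inv g \<otimes> w [^] J g)"
  have dec: "\<exists>l \<in> L. g = l \<otimes> w [^] J g" if g: "g \<in> carrier G" for g
    using Ldec[OF g] g w by (intro bexI[of _ "g \<otimes> w [^] (- J g)"]) (simp_all add: m_assoc int_pow_neg)
  have JL: "J (l \<otimes> w [^] i) = i mod int e" if l: "l \<in> L" for l and i :: int
    using Jmult[of l "w [^] i"] J0[of l] char_int_pow[OF Jh w, of i] l Lc[OF l] w Jw
    by (simp add: L_def)
  have \<iota>L: "\<iota> (l \<otimes> w [^] i) = inv l \<otimes> w [^] i" if l: "l \<in> L" for l and i :: int
    using Lc[OF l] w JL[OF l] by (simp add: \<iota>_def wmod inv_mult_group flip: m_assoc)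
  have hom: "\<iota> \<in> hom G G"
  proof (rule homI)
    show "\<iota> g \<in> carrier G" if "g \<in> carrier G" for g using that w by (simp add: \<iota>_def)
    fix g h assume g: "g \<in> carrier G" and h: "h \<in> carrier G"
    obtain l where l: "l \<in> L" "g = l \<otimes> w [^] J g" using dec[OF g] by blast
    obtain m where m: "m \<in> L" "h = m \<otimes> w [^] J h" using dec[OF h] by blast
    define i where "i = J g"
    define j where "j = J h"
    define m' where "m' = w [^] i \<otimes> m \<otimes> inv (w [^] i)"
    have m': "m' \<in> L" unfolding m'_def by (rule Lconj[OF m(1)])
    have c': "l \<in> carrier G" "m \<in> carrier G" "m' \<in> carrier G" using l m m' Lc by auto
    have swap: "w [^] i \<otimes> m = m' \<otimes> w [^] i"
      unfolding m'_def using c' w by (simp add: m_assoc)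
    have swap': "w [^] i \<otimes> inv m = inv m' \<otimes> w [^] i"
    proof -
      have "inv m' = w [^] i \<otimes> inv m \<otimes> inv (w [^] i)"
        unfolding m'_def using c' w by (simp add: inv_mult_group m_assoc)
      then show ?thesis using c' w by (simp add: m_assoc)
    qed
    have "g \<otimes> h = (l \<otimes> w [^] i) \<otimes> (m \<otimes> w [^] j)"
      using l(2) m(2) unfolding i_def j_def by metis
    also have "\<dots> = l \<otimes> (w [^] i \<otimes> m) \<otimes> w [^] j"
      using c' w by (simp add: m_assoc)
    also have "\<dots> = (l \<otimes> m') \<otimes> w [^] (i + j)"
      unfolding swap using c' w by (simp add: m_assoc int_pow_mult)
    finally have "\<iota> (g \<otimes> h) = inv (l \<otimes> m') \<otimes> w [^] (i + j)"
      using \<iota>L[OF subgroup.m_closed[OF L l(1) m']] by simp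
    also have "inv (l \<otimes> m') = inv l \<otimes> inv m'"
      using Lcomm[OF l(1) m'] c' by (simp add: inv_mult_group)
    also have "inv l \<otimes> inv m' \<otimes> w [^] (i + j) = inv l \<otimes> (inv m' \<otimes> w [^] i) \<otimes> w [^] j"
      using c' w by (simp add: m_assoc int_pow_mult)
    also have "\<dots> = (inv l \<otimes> w [^] i) \<otimes> (inv m \<otimes> w [^] j)"
      unfolding swap'[symmetric] using c' w by (simp add: m_assoc)
    also have "\<dots> = \<iota> g \<otimes> \<iota> h"
      using \<iota>L[OF l(1), of i] \<iota>L[OF m(1), of j] l(2) m(2) unfolding i_def j_def by metis
    finally show "\<iota> (g \<otimes> h) = \<iota> g \<otimes> \<iota> h" .
  qed
  have invol: "\<iota> (\<iota> g) = g" if g: "g \<in> carrier G" for g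
  proof -
    obtain l where l: "l \<in> L" "g = l \<otimes> w [^] J g" using dec[OF g] by blast
    have "\<iota> (\<iota> g) = inv (inv l) \<otimes> w [^] J g"
      using \<iota>L[OF l(1), of "J g"] \<iota>L[OF subgroup.m_inv_closed[OF L l(1)], of "J g"] l(2) by metis
    then show ?thesis using l Lc[OF l(1)] by simp
  qed
  have aut: "\<iota> \<in> auto G"
  proof (rule finite_autoI[OF finite_carrier hom])
    show "\<iota> \<in> extensional (carrier G)" by (simp add: \<iota>_def)
    show "g = \<one>" if "g \<in> carrier G" "\<iota> g = \<one>" for g
      using invol[OF that(1)] invol[OF one_closed] hom_one[OF hom is_group is_group] that by simp
  qed
  have cen: "\<iota> z = inv z" if z: "z \<in> center G" for z
    using J0[of z] z u by (simp add: \<iota>_def)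
  show ?thesis
    by (rule that[OF aut cen invol]) (auto simp: \<iota>_def)
qed

end

context class_two_embedding
begin

text \<open>The image \<open>w\<close> of the conjugation by \<open>x\<close> has order \<open>e\<close>, because its \<open>e\<close>-th power is the image of a trivial
  conjugation, and it also has order \<open>e\<close> modulo the center, because powers of \<open>x\<close> meet those of \<open>y\<close>
  trivially modulo the center. So \<open>w\<close> qualifies for \<open>inversion_automorphism\<close>. The
  last conclusion holds because the centralizer of \<open>w\<close> is \<open>Z(G) \<union> Z(G) w\<close>, which consists of images of
  inner automorphisms.\<close>

lemma dihedral_shape:
  obtains u w c where "u \<in> carrier G" "w \<in> carrier G" "center G = {\<one>, c}" "c \<noteq> \<one>"
    "order G = 8" "w \<otimes> w = \<one>" "w \<notin> center G" "commutator G u w = c"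
    "\<And>g. g \<in> carrier G \<Longrightarrow> g \<otimes> g \<in> center G"
    "\<And>n. n \<in> carrier G \<Longrightarrow> (\<And>g. g \<in> carrier G \<Longrightarrow> n \<otimes> inner_embedding g = inner_embedding g \<otimes> n) \<Longrightarrow>
      n \<in> inner_embedding ` carrier G"
proof -
  obtain x y where xy: "x \<in> carrier G" "y \<in> carrier G" "ord (commutator G x y) = e"
    "inner_embedding y \<in> center_torsion G e" "ord (inner_embedding y) = e"
    and fixed: "\<And>\<alpha> t. \<alpha> \<in> auto G \<Longrightarrow> t \<in> center_torsion G e \<Longrightarrow> \<alpha> t = t"
    using fixed_frame by blast
  define w where "w = inner_embedding x"
  have wc: "w \<in> carrier G" using xy(1) by (simp add: w_def)
  have we: "w [^] e = \<one>"
    using inner_embedding_int_pow[OF xy(1), of "int e"] inner_embedding_eq_one_iff[of "x [^] e"]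
      pow_exponent_central[OF xy(1)] xy(1) by (simp add: w_def int_pow_int)
  have "full_order G e w"
    unfolding full_order_def
  proof (intro conjI allI iffI)
    fix i :: int
    assume "w [^] i \<in> center G"
    moreover have "w [^] i = inner_embedding (x [^] i)"
      using inner_embedding_int_pow[OF xy(1)] by (simp add: w_def)
    ultimately have "inner_embedding (x [^] i) \<in> center_torsion G e"
      unfolding shape(4)[symmetric]
      using imageI[OF int_pow_closed[OF xy(1), of i], of inner_embedding] by (metis IntI)
    then obtain j :: int where "inner_embedding (x [^] i) = inner_embedding y [^] j"
      using torsion_powers[OF xy(4,5)] by blast
    then have "inner_embedding (x [^] i) = inner_embedding (y [^] j)"
      using inner_embedding_int_pow[OF xy(2)] by simp
    then have "x [^] i \<otimes> inv (y [^] j) \<in> center G"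
      using inner_embedding_eq_iff[of "x [^] i" "y [^] j"] xy(1,2) by simp
    then have "commutator G (x [^] i) y = commutator G (y [^] j) y"
      using mult_inv_in_center_iff[of "x [^] i" "y [^] j"] xy(1,2) by simp
    then have "commutator G x y [^] i = \<one>"
      using xy(1,2) by (simp add: commutator_int_pow_left)
    then show "int e dvd i" using xy(1,2,3) by (simp add: int_pow_eq_id)
  next
    fix i :: int
    assume "int e dvd i"
    then have "w [^] i = \<one>" using int_pow_mod[OF wc we, of i] by simp
    then show "w [^] i \<in> center G" by simp
  qed (fact wc)
  then obtain u where u: "u \<in> carrier G" "ord (commutator G w u) = e"
    using commutator_of_full_order by blast
  define c where "c = commutator G u w"
  have ordc: "ord (commutator G u w) = e"
    using u wc commutator_swap_inv[of w u] by simp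
  obtain \<iota> where \<iota>: "\<iota> \<in> auto G" "\<And>z. z \<in> center G \<Longrightarrow> \<iota> z = inv z"
    "\<And>g. g \<in> carrier G \<Longrightarrow> \<iota> (\<iota> g) = g"
    "\<And>g. g \<in> carrier G \<Longrightarrow> \<exists>j :: int. \<iota> g = w [^] j \<otimes> inv g \<otimes> w [^] j"
    using inversion_automorphism[OF shape(1) u(1) wc ordc we] by blast
  \<comment> \<open>The inversion fixes commutators, which therefore have order two.\<close>
  have cT: "c \<in> center_torsion G e" using u wc by (simp add: c_def)
  have cc: "c \<in> center G" "c \<in> carrier G" using cT by (auto simp: center_torsion_def)
  have "inv c = c" using \<iota>(2)[OF cc(1)] fixed[OF \<iota>(1) cT] by simp
  then have "c [^] (2::nat) = \<one>" using cc by (metis l_inv nat_pow_Suc nat_pow_0 l_one numeral_2_eq_2)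
  then have "e dvd 2" using ordc cc(2) by (simp add: pow_eq_id c_def)
  then have e: "e = 2" using exponent_gt_1 by (metis dvd_imp_le le_antisym less_eq_Suc_le one_add_one plus_1_eq_Suc zero_less_numeral)
  have sq: "g [^] (2::nat) = g \<otimes> g" if "g \<in> carrier G" for g
    using that by (simp add: numeral_2_eq_2)
  have ww: "w \<otimes> w = \<one>" using we e sq wc by simp
  have T: "center_torsion G e = {\<one>, c}"
  proof -
    have "c \<noteq> \<one>" using ordc e by (auto simp: c_def)
    then have "card {\<one>, c} = card (center_torsion G e)" using shape(2) e by simp
    moreover have "{\<one>, c} \<subseteq> center_torsion G e"
      using cT subgroup.one_closed[OF subgroup_center_torsion] by simp
    moreover have "finite (center_torsion G e)"
      by (rule finite_subset[OF _ finite_carrier]) (auto simp: center_torsion_def)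
    ultimately show ?thesis by (metis card_subset_eq)
  qed
  have cne: "c \<noteq> \<one>" using ordc e by (auto simp: c_def)
  have centralizer: "\<exists>z \<in> center G. n = z \<or> n = z \<otimes> w"
    if n: "n \<in> carrier G" "n \<otimes> w = w \<otimes> n" for n
  proof -
    obtain z and i j :: int where z: "z \<in> center G" "n = z \<otimes> u [^] i \<otimes> w [^] j"
      using frame_decomposition[OF shape(1) u(1) wc ordc n(1)] by blast
    have "commutator G n w = \<one>" using n wc by (simp add: commutator_eq_one_iff)
    then have "commutator G u w [^] i = \<one>"
      unfolding z(2) using z(1) u wc by (simp add: commutator_mult_left commutator_int_pow_left)
    then have "int e dvd i" using u(1) wc ordc by (simp add: int_pow_eq_id)
    then obtain q where "i = int e * q" by auto
    then have "u [^] i = (u [^] e) [^] q" using u(1) by (simp add: int_pow_int flip: int_pow_pow)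
    then have ui: "u [^] i \<in> center G" using pow_exponent_central[OF u(1)] by simp
    have "w [^] j = w [^] (j mod int e)" using int_pow_mod[OF wc we] by simp
    moreover have "j mod int e = 0 \<or> j mod int e = 1" using e by auto
    ultimately have "w [^] j = \<one> \<or> w [^] j = w" using wc by auto
    then show ?thesis
      using z ui by (intro bexI[of _ "z \<otimes> u [^] i"]) auto
  qed
  have s_mem: "z \<in> inner_embedding ` carrier G" "z \<otimes> w \<in> inner_embedding ` carrier G"
    if "z \<in> center_torsion G e" for z
  proof -
    show z: "z \<in> inner_embedding ` carrier G" using that shape(4) by blast
    have "subgroup (inner_embedding ` carrier G) G" by (rule s.img_is_subgroup)
    moreover have "w \<in> inner_embedding ` carrier G" using xy(1) by (simp add: w_def)
    ultimately show "z \<otimes> w \<in> inner_embedding ` carrier G" using z subgroup.m_closed by metis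
  qed
  \<comment> \<open>The image of the inversion is an involution commuting with \<open>w\<close>, so the inversion is inner
    and hence trivial on the center.\<close>
  have \<iota>x: "commutator G (\<iota> x) h = commutator G x h" if h: "h \<in> carrier G" for h
  proof -
    obtain j :: int where j: "\<iota> x = w [^] j \<otimes> inv x \<otimes> w [^] j" using \<iota>(4)[OF xy(1)] by blast
    have sq1: "commutator G g h \<otimes> commutator G g h = \<one>" if "g \<in> carrier G" for g
      using commutator_pow_exponent[OF that h] e sq that h by simp
    have inv1: "inv (commutator G g h) = commutator G g h" if "g \<in> carrier G" for g
      using sq1[OF that] that h by (intro inv_equality) auto
    have "commutator G (\<iota> x) h
        = commutator G (w [^] j) h \<otimes> inv (commutator G x h) \<otimes> commutator G (w [^] j) h"
      unfolding j using wc xy(1) h by (simp add: commutator_mult_left commutator_inv_left)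
    also have "\<dots> = commutator G (w [^] j) h \<otimes> (commutator G (w [^] j) h \<otimes> commutator G x h)"
      using wc xy(1) h inv1[OF xy(1)] center_commutes[of "commutator G x h" "commutator G (w [^] j) h"]
      by (simp add: m_assoc)
    also have "\<dots> = commutator G x h"
      using sq1[of "w [^] j"] wc xy(1) h by (simp flip: m_assoc)
    finally show ?thesis .
  qed
  have "inner_embedding (\<iota> x) = w"
    unfolding w_def using inner_embedding_eq_iff[of "\<iota> x" x] mult_inv_in_center_iff[of "\<iota> x" x]
      \<iota>x xy(1) \<iota>(1) by (simp add: auto_closed)
  then have "\<sigma> \<iota> \<otimes> w = w \<otimes> \<sigma> \<iota>"
    using auto_conj_aut[OF \<iota>(1) xy(1)] \<iota>(1) xy(1)
    by (metis \<sigma>_mult auto_closed conj_aut_auto inner_embedding_def w_def)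
  then obtain z where z: "z \<in> center G" "\<sigma> \<iota> = z \<or> \<sigma> \<iota> = z \<otimes> w"
    using centralizer[of "\<sigma> \<iota>"] \<iota>(1) by auto
  have "\<iota> \<otimes>\<^bsub>AutoGroup G\<^esub> \<iota> = \<one>\<^bsub>AutoGroup G\<^esub>"
    using \<iota>(1,3) by (intro auto_eqI auto_comp_closed) (auto simp: mult_AutoGroup_apply one_AutoGroup id_in_auto)
  then have \<sigma>\<sigma>: "\<sigma> \<iota> \<otimes> \<sigma> \<iota> = \<one>" using \<iota>(1) \<sigma>_one by (metis \<sigma>_mult)
  have "z \<otimes> z = \<one>"
    using z(2)
  proof
    assume "\<sigma> \<iota> = z \<otimes> w"
    then have "(z \<otimes> w) \<otimes> (z \<otimes> w) = \<one>" using \<sigma>\<sigma> by simp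
    moreover have "(z \<otimes> w) \<otimes> (z \<otimes> w) = (z \<otimes> z) \<otimes> (w \<otimes> w)"
      using z wc center_commutes_left[of z w w] by (simp add: m_assoc)
    ultimately show ?thesis using ww z by simp
  qed (use \<sigma>\<sigma> in simp)
  then have "z \<in> center_torsion G e" using z e sq by (simp add: center_torsion_def)
  then have "\<sigma> \<iota> \<in> inner_embedding ` carrier G" using z(2) s_mem by auto
  then obtain g where g: "g \<in> carrier G" "\<sigma> \<iota> = \<sigma> (conj_aut G g)"
    by (auto simp: inner_embedding_def)
  then have "\<iota> = conj_aut G g" using \<sigma>_inj \<iota>(1) conj_aut_auto by (auto simp: inj_on_def)
  then have "inv v = v" if v: "v \<in> center G" for v
    using \<iota>(2)[OF v] v g(1) center_commutes_left[OF v g(1), of "inv g"]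
    by (simp add: conj_aut_apply m_assoc)
  then have "v \<in> center_torsion G e" if v: "v \<in> center G" for v
    using v e sq by (metis (mono_tags, lifting) center_closed center_torsion_def l_inv mem_Collect_eq)
  then have Z: "center G = {\<one>, c}" using T by (auto simp: center_torsion_def)
  have ord8: "order G = 8" using shape(1) Z cne e by simp
  have wZ: "w \<notin> center G" using cne u(1) wc unfolding c_def by auto
  have cent: "n \<in> inner_embedding ` carrier G"
    if n: "n \<in> carrier G" "\<And>g. g \<in> carrier G \<Longrightarrow> n \<otimes> inner_embedding g = inner_embedding g \<otimes> n" for n
  proof -
    obtain z where z: "z \<in> center G" "n = z \<or> n = z \<otimes> w"
      using centralizer[OF n(1)] n(2)[OF xy(1)] unfolding w_def by blast
    have "z \<in> center_torsion G e" using z(1) Z T by simp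
    then show ?thesis using z(2) s_mem by auto
  qed
  have sqZ: "g \<otimes> g \<in> center G" if "g \<in> carrier G" for g
    using pow_exponent_central[OF that] e sq[OF that] by simp
  show ?thesis
    by (rule that[OF u(1) wc Z cne ord8 ww wZ c_def[symmetric] sqZ cent])
qed

end

section \<open>The dihedral group of order eight\<close>

lemma dihedral_group_simps:
  "carrier (dihedral_group n) = {0..<int n} \<times> UNIV"
  "(a, s) \<otimes>\<^bsub>dihedral_group n\<^esub> (b, t) = ((if s then a - b else a + b) mod int n, s \<noteq> t)"
  "\<one>\<^bsub>dihedral_group n\<^esub> = (0, False)"
  by (simp_all add: dihedral_group_def)

lemma (in group) iso_dihedral_groupI:
  assumes n: "n > 0" and ord: "order G = 2 * n"
    and r: "r \<in> carrier G" "ord r = n" and w: "w \<in> carrier G" "w \<otimes> w = \<one>"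
    and rel: "w \<otimes> r = inv r \<otimes> w" and indep: "\<And>i :: int. w \<noteq> r [^] i"
  shows "dihedral_group n \<cong> G"
proof -
  interpret D: group "dihedral_group n" using n by (intro group_dihedral_group) simp
  define f where "f = (\<lambda>(a :: int, s). r [^] a \<otimes> (if s then w else \<one>))"
  have rn: "r [^] (i mod int n) = r [^] i" for i using r by (intro int_pow_mod) auto
  have pw: "w \<otimes> r [^] i = r [^] (- i) \<otimes> w" for i :: int
  proof -
    have "w \<otimes> r \<otimes> inv w = inv r" using rel r w by (simp add: m_assoc)
    moreover have "w \<otimes> r [^] i \<otimes> inv w = (w \<otimes> r \<otimes> inv w) [^] i"
      using hom_int_pow[of "\<lambda>x. w \<otimes> x \<otimes> inv w" G G r i] r w
      by (simp add: hom_def m_assoc)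
    ultimately have "w \<otimes> r [^] i \<otimes> inv w = r [^] (- i)" using r by (simp add: int_pow_inv int_pow_neg)
    then show ?thesis using r w by (metis int_pow_closed inv_closed inv_inv inv_solve_right m_closed)
  qed
  have hom: "f \<in> hom (dihedral_group n) G"
  proof (rule homI)
    fix p q assume "p \<in> carrier (dihedral_group n)" "q \<in> carrier (dihedral_group n)"
    obtain a s b t where pq: "p = (a, s)" "q = (b, t)" by (metis surj_pair)
    show "f p \<in> carrier G" using r w by (simp add: f_def pq)
    have key: "r [^] a \<otimes> w \<otimes> (r [^] b \<otimes> v) = r [^] (a - b) \<otimes> (w \<otimes> v)" if "v \<in> carrier G" for v
    proof -
      have key: "r [^] a \<otimes> w \<otimes> (r [^] b \<otimes> v) = r [^] a \<otimes> (w \<otimes> r [^] b) \<otimes> v"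
        using r w that by (simp add: m_assoc)
      also have "\<dots> = r [^] (a - b) \<otimes> (w \<otimes> v)"
        unfolding pw using r w that by (simp add: m_assoc int_pow_diff int_pow_neg)
      finally show ?thesis .
    qed
    show "f (p \<otimes>\<^bsub>dihedral_group n\<^esub> q) = f p \<otimes> f q"
    proof (cases s)
      case True
      then show ?thesis
        using r w key[of \<one>] key[of w] by (cases t) (simp_all add: pq f_def dihedral_group_simps rn)
    next
      case False
      then show ?thesis
        using r w by (cases t) (simp_all add: pq f_def dihedral_group_simps rn int_pow_mult m_assoc)
    qed
  qed
  have "inj_on f (carrier (dihedral_group n))"
  proof (rule group_hom.inj_on_one_iff[THEN iffD2])
    show "group_hom (dihedral_group n) G f"
      using hom D.is_group is_group by (simp add: group_hom_def group_hom_axioms_def)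
    show "\<forall>p. p \<in> carrier (dihedral_group n) \<longrightarrow> f p = \<one> \<longrightarrow> p = \<one>\<^bsub>dihedral_group n\<^esub>"
    proof (intro allI impI)
      fix p assume p: "p \<in> carrier (dihedral_group n)" "f p = \<one>"
      obtain a s where as: "p = (a, s)" by (metis surj_pair)
      have "\<not> s"
      proof
        assume s
        then have "r [^] a \<otimes> w = \<one>" using p as by (simp add: f_def)
        then have "inv w = r [^] a" using r w by (intro inv_equality) auto
        moreover have "inv w = w" using w by (intro inv_equality) auto
        ultimately show False using indep by metis
      qed
      then have "r [^] a = \<one>" using p as r by (simp add: f_def)
      then have "int n dvd a" using r by (simp add: int_pow_eq_id)
      then have "a = 0" using p as by (auto simp: dihedral_group_simps zdvd_not_zless order_le_less)
      then show "p = \<one>\<^bsub>dihedral_group n\<^esub>" using as \<open>\<not> s\<close> by (simp add: dihedral_group_simps)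
    qed
  qed
  moreover have fin: "finite (carrier G)" using ord n by (metis card_ge_0_finite mult_pos_pos order_def zero_less_numeral)
  moreover have "f ` carrier (dihedral_group n) \<subseteq> carrier G" using hom by (auto simp: hom_def)
  moreover have "card (carrier (dihedral_group n)) = card (carrier G)"
    using ord order_dihedral_group[of n] by (simp add: order_def)
  ultimately have "bij_betw f (carrier (dihedral_group n)) (carrier G)"
    by (metis bij_betw_def card_image card_subset_eq)
  with hom show ?thesis by (auto simp: is_iso_def iso_def)
qed

text \<open>The conclusions after the first serve the case where \<open>G\<close> is a subgroup of a larger group and \<open>\<sigma>\<close> arises
  from automorphisms of that group.\<close>

theorem (in class_two_group) dihedral_if_contains_automorphism_group:
  assumes \<sigma>: "\<sigma> \<in> hom (AutoGroup G) G" "inj_on \<sigma> (auto G)"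
  shows "dihedral_group 4 \<cong> G"
    and "\<exists>c. center G = {\<one>, c} \<and> c \<noteq> \<one>"
    and "\<And>n. n \<in> carrier G \<Longrightarrow>
      (\<And>g. g \<in> carrier G \<Longrightarrow> n \<otimes> \<sigma> (conj_aut G g) = \<sigma> (conj_aut G g) \<otimes> n) \<Longrightarrow>
      \<exists>g \<in> carrier G. n = \<sigma> (conj_aut G g)"
proof -
  obtain e where "class_two_exponent G e" using exponent_exists by blast
  then interpret class_two_embedding G e \<sigma>
    using \<sigma> by (simp add: class_two_embedding_def class_two_embedding_axioms_def)
  obtain u w c where shape: "u \<in> carrier G" "w \<in> carrier G" "center G = {\<one>, c}" "c \<noteq> \<one>"
    "order G = 8" "w \<otimes> w = \<one>" "w \<notin> center G" "commutator G u w = c"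
    "\<And>g. g \<in> carrier G \<Longrightarrow> g \<otimes> g \<in> center G"
    and cent: "\<And>n. n \<in> carrier G \<Longrightarrow>
      (\<And>g. g \<in> carrier G \<Longrightarrow> n \<otimes> inner_embedding g = inner_embedding g \<otimes> n) \<Longrightarrow>
      n \<in> inner_embedding ` carrier G"
    by (rule dihedral_shape) blast
  show "\<exists>c. center G = {\<one>, c} \<and> c \<noteq> \<one>" using shape by blast
  show "\<exists>g \<in> carrier G. n = \<sigma> (conj_aut G g)"
    if "n \<in> carrier G" "\<And>g. g \<in> carrier G \<Longrightarrow> n \<otimes> \<sigma> (conj_aut G g) = \<sigma> (conj_aut G g) \<otimes> n" for n
    using cent[OF that(1)] that(2) by (auto simp: inner_embedding_def)
  have cZ: "c \<in> center G" "c \<in> carrier G" using shape(3) center_subset by auto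
  have cc: "c \<otimes> c = \<one>"
  proof -
    have "c \<otimes> c \<in> {\<one>, c}" using cZ center_mult[of c c] shape(3) by simp
    then show ?thesis using cZ shape(4) by auto
  qed
  have uw: "u \<otimes> w = c \<otimes> (w \<otimes> u)" using mult_eq_commutator[of u w] shape by simp
  \<comment> \<open>Exactly one of \<open>u\<close> and \<open>u w\<close> squares to the central involution.\<close>
  define r where "r = (if u \<otimes> u = \<one> then u \<otimes> w else u)"
  have rc: "r \<in> carrier G" using shape by (simp add: r_def)
  have rr: "r \<otimes> r = c"
  proof (cases "u \<otimes> u = \<one>")
    case True
    have "(u \<otimes> w) \<otimes> (u \<otimes> w) = (c \<otimes> (w \<otimes> u)) \<otimes> (u \<otimes> w)" using uw by simp
    also have "\<dots> = c \<otimes> (w \<otimes> (u \<otimes> u) \<otimes> w)" using shape(1,2) cZ by (simp add: m_assoc)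
    also have "\<dots> = c" using True shape cZ by simp
    finally show ?thesis using True by (simp add: r_def)
  next
    case False
    then show ?thesis using shape(3) shape(9)[OF shape(1)] by (auto simp: r_def)
  qed
  have rw: "commutator G r w = c"
    using shape(1,2,8) cZ by (simp add: r_def commutator_mult_left)
  have "dihedral_group 4 \<cong> G"
  proof (rule iso_dihedral_groupI[OF _ _ rc _ shape(2,6)])
    show "order G = 2 * 4" using shape(5) by simp
    have r2: "r [^] (2::nat) = c" using rr rc by (simp add: numeral_2_eq_2)
    have "r [^] (4::nat) = (r [^] (2::nat)) [^] (2::nat)" using rc by (simp add: nat_pow_pow)
    then have r4: "r [^] (4::nat) = \<one>" using r2 cc cZ by (simp add: numeral_2_eq_2)
    have "ord r dvd 4" using r4 rc by (simp add: pow_eq_id)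
    moreover have "\<not> ord r dvd 2" using r2 rc shape(4) by (simp flip: pow_eq_id)
    moreover have "d = 4" if "d dvd 4" "\<not> d dvd 2" for d :: nat
    proof -
      have "d \<le> 4" using that(1) by (rule dvd_imp_le) simp
      then have "d = 0 \<or> d = 1 \<or> d = 2 \<or> d = 3 \<or> d = 4" by auto
      then show ?thesis using that by auto
    qed
    ultimately show "ord r = 4" by blast
    have "inv r = r \<otimes> c" using rr rc cc cZ by (intro inv_equality) (simp_all add: m_assoc center_commutes_left[OF cZ(1)])
    moreover have "r \<otimes> w = c \<otimes> (w \<otimes> r)" using mult_eq_commutator[of r w] rw rc shape by simp
    ultimately show "w \<otimes> r = inv r \<otimes> w"
      using rc shape(2) cZ cc center_commutes_left[OF cZ(1), of r w] by (simp add: m_assoc flip: m_assoc[of c c])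
    show "w \<noteq> r [^] i" for i :: int
    proof
      assume "w = r [^] i"
      then have "commutator G r w = \<one>" using rc commutator_int_pow_right[OF rc rc, of i] by simp
      then show False using rw shape(4) by simp
    qed
  qed simp
  then show "dihedral_group 4 \<cong> G" .
qed

text \<open>The rotation \<open>r^a\<close>, possibly composed with a reflection, corresponds to the automorphism that
  multiplies the rotation angle by \<open>1\<close> or \<open>- 1\<close> and moves the reflections by \<open>a\<close>. For \<open>n = 4\<close> the units
  modulo \<open>n\<close> are \<open>1\<close> and \<open>- 1\<close>, so these are all automorphisms.\<close>

definition dihedral_affine :: "nat \<Rightarrow> int \<times> bool \<Rightarrow> int \<times> bool \<Rightarrow> int \<times> bool"
  where "dihedral_affine n = (\<lambda>(a, s). \<lambda>(b, t) \<in> carrier (dihedral_group n).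
    (((if s then - b else b) + (if t then a else 0)) mod int n, t))"

lemma Aut_dihedral_4: "dihedral_group 4 \<cong> AutoGroup (dihedral_group 4)"
proof -
  let ?D = "dihedral_group 4"
  let ?\<theta> = "dihedral_affine 4"
  interpret D: group ?D by (rule group_dihedral_group) simp
  have elem: "\<exists>b t. x = (b, t) \<and> 0 \<le> b \<and> b < 4" if "x \<in> carrier ?D" for x
    using that by (cases x) (simp add: dihedral_group_simps)
  have finD: "finite (carrier ?D)" by (simp add: dihedral_group_simps)
  have app: "?\<theta> (a, s) (b, t) = (((if s then - b else b) + (if t then a else 0)) mod 4, t)"
    if "0 \<le> b" "b < 4" for a s b t
    using that by (simp add: dihedral_affine_def dihedral_group_simps)
  have app_mod: "?\<theta> (a, s) (b mod 4, t) = (((if s then - b else b) + (if t then a else 0)) mod 4, t)"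
    for a s b t
    by (subst app) (auto simp: mod_simps)
  have auto: "?\<theta> p \<in> auto ?D" for p
  proof (rule D.finite_autoI[OF finD])
    obtain a s where p: "p = (a, s)" by (metis surj_pair)
    show "?\<theta> p \<in> hom ?D ?D"
    proof (rule homI)
      show "?\<theta> p x \<in> carrier ?D" if "x \<in> carrier ?D" for x
        using elem[OF that] by (auto simp: p app dihedral_group_simps(1))
      fix x y assume "x \<in> carrier ?D" "y \<in> carrier ?D"
      then obtain b t d v where xy: "x = (b, t)" "y = (d, v)" "0 \<le> b" "b < 4" "0 \<le> d" "d < 4"
        using elem by metis
      show "?\<theta> p (x \<otimes>\<^bsub>?D\<^esub> y) = ?\<theta> p x \<otimes>\<^bsub>?D\<^esub> ?\<theta> p y"
        unfolding p xy(1,2) dihedral_group_simps app[OF xy(3,4)] app[OF xy(5,6)]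
        by (cases s; cases t; cases v; simp add: dihedral_group_simps app_mod mod_simps; simp add: algebra_simps)
    qed
    show "?\<theta> p \<in> extensional (carrier ?D)" by (simp add: p dihedral_affine_def)
    show "x = \<one>\<^bsub>?D\<^esub>" if x: "x \<in> carrier ?D" "?\<theta> p x = \<one>\<^bsub>?D\<^esub>" for x
    proof -
      obtain b t where bt: "x = (b, t)" "0 \<le> b" "b < 4" using elem[OF x(1)] by blast
      then have "\<not> t" "(if s then - b else b) mod 4 = 0" using x(2) by (auto simp: p app dihedral_group_simps split: if_splits)
      then show ?thesis using bt by (auto simp: dihedral_group_simps split: if_splits) presburger
    qed
  qed
  have hom: "?\<theta> \<in> hom ?D (AutoGroup ?D)"
  proof (rule homI)
    show "?\<theta> p \<in> carrier (AutoGroup ?D)" for p using auto by simp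
    fix p q :: "int \<times> bool"
    obtain a s b t where pq: "p = (a, s)" "q = (b, t)" by (metis surj_pair)
    show "?\<theta> (p \<otimes>\<^bsub>?D\<^esub> q) = ?\<theta> p \<otimes>\<^bsub>AutoGroup ?D\<^esub> ?\<theta> q"
    proof (rule D.auto_eqI[OF auto D.auto_comp_closed[OF auto auto]])
      fix x assume x: "x \<in> carrier ?D"
      then obtain d v where xy: "x = (d, v)" "0 \<le> d" "d < 4" using elem by blast
      show "?\<theta> (p \<otimes>\<^bsub>?D\<^esub> q) x = (?\<theta> p \<otimes>\<^bsub>AutoGroup ?D\<^esub> ?\<theta> q) x"
        unfolding mult_AutoGroup_apply[OF auto auto x]
        unfolding pq xy(1) dihedral_group_simps app[OF xy(2,3)] app_mod
        by (cases s; cases t; cases v; simp add: mod_simps; simp add: algebra_simps)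
    qed
  qed
  have inj: "inj_on ?\<theta> (carrier ?D)"
  proof (rule inj_onI)
    fix p q assume p: "p \<in> carrier ?D" and q: "q \<in> carrier ?D" and eq: "?\<theta> p = ?\<theta> q"
    obtain a s where as: "p = (a, s)" "0 \<le> a" "a < 4" using elem[OF p] by blast
    obtain b t where bt: "q = (b, t)" "0 \<le> b" "b < 4" using elem[OF q] by blast
    have "?\<theta> p (0, True) = ?\<theta> q (0, True)" "?\<theta> p (1, False) = ?\<theta> q (1, False)" using eq by simp_all
    then show "p = q" using as bt by (auto simp: app split: if_splits)
  qed
  have surj: "\<alpha> \<in> ?\<theta> ` carrier ?D" if \<alpha>: "\<alpha> \<in> auto ?D" for \<alpha>
  proof -
    have car: "(d, v) \<in> carrier ?D \<longleftrightarrow> d \<in> {0, 1, 2, 3}" for d v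
      by (auto simp: dihedral_group_simps)
    have mult: "\<alpha> ((d, v) \<otimes>\<^bsub>?D\<^esub> (d', v')) = \<alpha> (d, v) \<otimes>\<^bsub>?D\<^esub> \<alpha> (d', v')"
      if "d \<in> {0,1,2,3}" "d' \<in> {0,1,2,3}" for d v d' v'
      using D.auto_mult[OF \<alpha>, of "(d, v)" "(d', v')"] car that by blast
    have inj: "\<alpha> (d, v) = \<alpha> (d', v') \<longleftrightarrow> d = d' \<and> v = v'"
      if "d \<in> {0,1,2,3}" "d' \<in> {0,1,2,3}" for d v d' v'
      using D.auto_inj[OF \<alpha>, of "(d, v)" "(d', v')"] car that by blast
    have one: "\<alpha> (0, False) = (0, False)"
      using D.auto_one[OF \<alpha>] by (simp add: dihedral_group_simps)
    obtain b v where b: "\<alpha> (1, False) = (b, v)" "b \<in> {0,1,2,3}"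
      using D.auto_closed[OF \<alpha>, of "(1, False)"] car by (metis insertCI surj_pair)
    obtain a u where a: "\<alpha> (0, True) = (a, u)" "a \<in> {0,1,2,3}"
      using D.auto_closed[OF \<alpha>, of "(0, True)"] car by (metis insertCI surj_pair)
    have a2: "\<alpha> (2, False) = (b, v) \<otimes>\<^bsub>?D\<^esub> (b, v)"
      using mult[of 1 1 False False] b(1) by (simp add: dihedral_group_simps)
    have "\<alpha> (2, False) \<noteq> (0, False)" using inj[of 2 0 False False] one by simp
    then have v: "\<not> v" "b \<in> {1, 3}" using a2 b(2) by (auto simp: dihedral_group_simps split: if_splits)
    then have a2': "\<alpha> (2, False) = (2, False)" using a2 by (auto simp: dihedral_group_simps)
    have sq: "(a, u) \<otimes>\<^bsub>?D\<^esub> (a, u) = (0, False)"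
      using mult[of 0 0 True True] a(1) one by (simp add: dihedral_group_simps)
    have "\<alpha> (0, True) \<noteq> (0, False)" "\<alpha> (0, True) \<noteq> (2, False)"
      using inj[of 0 0 True False] inj[of 0 2 True False] one a2' by simp_all
    then have u: u using sq a by (auto simp: dihedral_group_simps split: if_splits)
    have a3: "\<alpha> (3, False) = (2, False) \<otimes>\<^bsub>?D\<^esub> (b, v)"
      using mult[of 2 1 False False] b(1) a2' by (simp add: dihedral_group_simps)
    have aT: "\<alpha> (d, True) = \<alpha> (d, False) \<otimes>\<^bsub>?D\<^esub> (a, u)" if "d \<in> {0,1,2,3}" for d
      using mult[of d 0 False True] a(1) that by (auto simp: dihedral_group_simps)
    have "\<alpha> = ?\<theta> (a, b = 3)"
    proof (rule D.auto_eqI[OF \<alpha> auto])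
      fix x assume "x \<in> carrier ?D"
      then obtain d t where x: "x = (d, t)" "d \<in> {0,1,2,3}" using car by (metis surj_pair)
      have "\<alpha> (d, False) = ?\<theta> (a, b = 3) (d, False)"
        using x(2) v one b(1) a2' a3 by (auto simp: app dihedral_group_simps)
      moreover have "\<alpha> (d, True) = ?\<theta> (a, b = 3) (d, True)"
        using aT[OF x(2)] x(2) v u one b(1) a2' a3 a(2) by (auto simp: app dihedral_group_simps)
      ultimately show "\<alpha> x = ?\<theta> (a, b = 3) x" using x by (cases t) auto
    qed
    then show ?thesis using a(2) by (auto simp: dihedral_group_simps)
  qed
  have "?\<theta> ` carrier ?D = carrier (AutoGroup ?D)" using auto surj by auto
  then show ?thesis using hom inj by (auto simp: is_iso_def iso_def bij_betw_def)
qed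

section \<open>Characters of order two and the abelianization\<close>

context group
begin

lemma derived_normal: "derived G (carrier G) \<lhd> G"
  by (rule derived_is_normal) (simp add: normal_inv_iff subgroup_self)

text \<open>An abelian group of even order contains an involution, so squaring is not injective and hence not
  onto, and there is a nontrivial character of order two that kills the squares.\<close>

lemma even_abelianization_character:
  assumes fin: "finite (carrier G)" and even: "even (order (abelianization G))"
  obtains \<psi> x where "\<psi> \<in> hom G (integer_mod_group 2)" "x \<in> carrier G" "\<psi> x \<noteq> 0"
proof -
  let ?A = "abelianization G"
  interpret D: normal "derived G (carrier G)" G by (rule derived_normal)
  interpret A: comm_group ?A unfolding abelianization_def by (rule derived_quot_is_comm_group)
  have finA: "finite (carrier ?A)" using fin by (simp add: abelianization_def carrier_FactGroup)
  have "order ?A = 2 ^ 1 * (order ?A div 2)" using even by simp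
  then obtain H where H: "subgroup H ?A" "card H = 2"
    using sylow_thm[OF two_is_prime_nat A.is_group _ finA, of 1] by auto
  then obtain t where t: "t \<in> H" "t \<noteq> \<one>\<^bsub>?A\<^esub>"
    by (metis card_2_iff insertCI)
  have tc: "t \<in> carrier ?A" using H(1) t(1) by (rule subgroup.mem_carrier)
  have t2: "t \<otimes>\<^bsub>?A\<^esub> t = \<one>\<^bsub>?A\<^esub>"
  proof -
    have "{\<one>\<^bsub>?A\<^esub>, t} \<subseteq> H" using subgroup.one_closed[OF H(1)] t by simp
    moreover have "card {\<one>\<^bsub>?A\<^esub>, t} = 2" using t by simp
    ultimately have "H = {\<one>\<^bsub>?A\<^esub>, t}" using H(2) by (metis card_subset_eq card_2_iff' card_eq_0_iff zero_neq_numeral)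
    then have "t \<otimes>\<^bsub>?A\<^esub> t \<in> {\<one>\<^bsub>?A\<^esub>, t}" using subgroup.m_closed[OF H(1) t(1) t(1)] by simp
    then show ?thesis using t(2) tc by auto
  qed
  define S where "S = (\<lambda>a. a \<otimes>\<^bsub>?A\<^esub> a) ` carrier ?A"
  have sqhom: "group_hom ?A ?A (\<lambda>a. a \<otimes>\<^bsub>?A\<^esub> a)"
    by (simp add: group_hom_def group_hom_axioms_def hom_def A.m_ac)
  have S: "subgroup S ?A" unfolding S_def by (rule group_hom.img_is_subgroup[OF sqhom])
  have "S \<noteq> carrier ?A"
  proof
    assume "S = carrier ?A"
    then have "inj_on (\<lambda>a. a \<otimes>\<^bsub>?A\<^esub> a) (carrier ?A)"
      using finA unfolding S_def by (intro eq_card_imp_inj_on) auto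
    from inj_onD[OF this, of t "\<one>\<^bsub>?A\<^esub>"] show False using t2 tc t(2) by simp
  qed
  then have "card S < order ?A"
    using subgroup.subset[OF S] finA unfolding order_def by (intro psubset_card_mono) auto
  moreover have "card (char_extensions ?A 2 S (\<lambda>_. 0)) * card S = order ?A"
  proof (rule A.card_chars_trivial_on[OF finA _ S])
    show "\<forall>x \<in> carrier ?A. \<forall>y \<in> carrier ?A.
        x \<otimes>\<^bsub>?A\<^esub> y \<otimes>\<^bsub>?A\<^esub> inv\<^bsub>?A\<^esub> x \<otimes>\<^bsub>?A\<^esub> inv\<^bsub>?A\<^esub> y \<in> S"
    proof (intro ballI)
      fix x y assume "x \<in> carrier ?A" "y \<in> carrier ?A"
      then have "x \<otimes>\<^bsub>?A\<^esub> y \<otimes>\<^bsub>?A\<^esub> inv\<^bsub>?A\<^esub> x \<otimes>\<^bsub>?A\<^esub> inv\<^bsub>?A\<^esub> y = \<one>\<^bsub>?A\<^esub>"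
        using A.commutator_eq_one_iff[of x y] by (simp add: commutator_def A.m_comm)
      then show "x \<otimes>\<^bsub>?A\<^esub> y \<otimes>\<^bsub>?A\<^esub> inv\<^bsub>?A\<^esub> x \<otimes>\<^bsub>?A\<^esub> inv\<^bsub>?A\<^esub> y \<in> S"
        using subgroup.one_closed[OF S] by simp
    qed
    show "\<forall>x \<in> carrier ?A. x [^]\<^bsub>?A\<^esub> (2::nat) \<in> S"
      by (auto simp: S_def numeral_2_eq_2)
  qed simp
  ultimately have more: "\<not> card (char_extensions ?A 2 S (\<lambda>_. 0)) \<le> Suc 0"
    using mult_right_mono[of "card (char_extensions ?A 2 S (\<lambda>_. 0))" "Suc 0" "card S"] by fastforce
  from more obtain \<psi> \<psi>' where \<psi>: "\<psi> \<in> char_extensions ?A 2 S (\<lambda>_. 0)"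
    "\<psi>' \<in> char_extensions ?A 2 S (\<lambda>_. 0)" "\<psi> \<noteq> \<psi>'"
    using card_le_Suc0_iff_eq[OF finite_char_extensions[OF finA]] by auto
  have "\<exists>\<psi> \<in> hom ?A (integer_mod_group 2). \<exists>a \<in> carrier ?A. \<psi> a \<noteq> 0"
  proof (rule ccontr)
    assume "\<not> ?thesis"
    then have "\<psi> a = \<psi>' a" if "a \<in> carrier ?A" for a
      using \<psi>(1,2) that unfolding char_extensions_def by (metis (no_types, lifting) mem_Collect_eq)
    then have "\<psi> = \<psi>'" using \<psi>(1,2) by (auto simp: char_extensions_def intro: extensionalityI)
    then show False using \<psi>(3) by simp
  qed
  then obtain \<chi> a where \<chi>: "\<chi> \<in> hom ?A (integer_mod_group 2)" "a \<in> carrier ?A" "\<chi> a \<noteq> 0" by blast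
  obtain x where x: "x \<in> carrier G" "a = derived G (carrier G) #> x"
    using \<chi>(2) by (auto simp: abelianization_def carrier_FactGroup)
  have "\<chi> \<circ> (\<lambda>g. derived G (carrier G) #> g) \<in> hom G (integer_mod_group 2)"
    using Group.hom_compose[OF D.r_coset_hom_Mod] \<chi>(1) by (simp add: abelianization_def)
  then show ?thesis using that x \<chi>(3) by auto
qed

lemma odd_abelianization_hom_trivial:
  assumes fin: "finite (carrier G)" and odd: "odd (order (abelianization G))"
    and f: "f \<in> hom G H" and H: "group H"
    and sq: "\<And>x. x \<in> carrier G \<Longrightarrow> f x \<otimes>\<^bsub>H\<^esub> f x = \<one>\<^bsub>H\<^esub>"
    and comm: "\<And>x y. x \<in> carrier G \<Longrightarrow> y \<in> carrier G \<Longrightarrow> f x \<otimes>\<^bsub>H\<^esub> f y = f y \<otimes>\<^bsub>H\<^esub> f x"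
    and x: "x \<in> carrier G"
  shows "f x = \<one>\<^bsub>H\<^esub>"
proof -
  interpret H: group H by (rule H)
  interpret f: group_hom G H f using f by (simp add: group_hom_def group_hom_axioms_def)
  interpret D: normal "derived G (carrier G)" G by (rule derived_normal)
  interpret A: comm_group "abelianization G"
    unfolding abelianization_def by (rule derived_quot_is_comm_group)
  have "derived G (carrier G) \<subseteq> kernel G H f"
    unfolding derived_def
  proof (rule generate_subgroup_incl[OF _ f.subgroup_kernel])
    show "derived_set G (carrier G) \<subseteq> kernel G H f"
    proof
      fix g assume "g \<in> derived_set G (carrier G)"
      then obtain a b where ab: "a \<in> carrier G" "b \<in> carrier G" "g = commutator G a b"
        by (auto simp: commutator_def)
      have "f g = commutator H (f a) (f b)" using ab by (simp add: commutator_def)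
      also have "\<dots> = \<one>\<^bsub>H\<^esub>" using ab comm by (simp add: H.commutator_eq_one_iff)
      finally show "g \<in> kernel G H f" using ab by (simp add: kernel_def)
    qed
  qed
  moreover have "x [^] order (abelianization G) \<in> derived G (carrier G)"
  proof -
    have "derived G (carrier G) #> x \<in> carrier (abelianization G)"
      using x by (auto simp: abelianization_def carrier_FactGroup)
    then have "(derived G (carrier G) #> x) [^]\<^bsub>abelianization G\<^esub> order (abelianization G) = \<one>\<^bsub>abelianization G\<^esub>"
      by (rule A.pow_order_eq_1)
    then have "derived G (carrier G) #> (x [^] order (abelianization G)) = derived G (carrier G)"
      using D.FactGroup_pow[OF x] by (simp add: abelianization_def)
    then show ?thesis
      using x D.subset by (metis coset_join1 D.is_subgroup nat_pow_closed)
  qed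
  ultimately have pow: "f x [^]\<^bsub>H\<^esub> order (abelianization G) = \<one>\<^bsub>H\<^esub>"
    using x by (auto simp: kernel_def f.hom_nat_pow)
  obtain m where m: "order (abelianization G) = 2 * m + 1" using odd by (rule oddE)
  have "f x [^]\<^bsub>H\<^esub> (2 * m) = \<one>\<^bsub>H\<^esub>"
  proof -
    have "f x [^]\<^bsub>H\<^esub> (2::nat) = \<one>\<^bsub>H\<^esub>" using sq[OF x] x by (simp add: numeral_2_eq_2)
    then show ?thesis using H.nat_pow_pow[of "f x" 2 m] x by simp
  qed
  then show ?thesis using pow x m by simp
qed

end

section \<open>Stable extensions\<close>

text \<open>The kernel of \<open>p\<close> plays the role of \<open>N\<close>, and \<open>\<Psi>\<close> is the isomorphism that expresses
  stability. It is directed from automorphisms to elements, so that the subgroups of \<open>Aut G\<close> used in the proof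
  become subgroups of \<open>G\<close>.\<close>

locale stable_extension = group G + K: group K for G (structure) and K and p +
  fixes \<Psi> :: "('a \<Rightarrow> 'a) \<Rightarrow> 'a"
  assumes finite_G [simp]: "finite (carrier G)"
    and p_hom: "p \<in> hom G K" and p_surj: "p ` carrier G = carrier K"
    and inner_action: "\<And>g. g \<in> carrier G \<Longrightarrow>
      \<exists>n \<in> kernel G K p. \<forall>x \<in> kernel G K p. g \<otimes> x \<otimes> inv g = n \<otimes> x \<otimes> inv n"
    and class_two: "\<And>x y z. x \<in> kernel G K p \<Longrightarrow> y \<in> kernel G K p \<Longrightarrow> z \<in> kernel G K p \<Longrightarrow>
      commutator G x y \<otimes> z = z \<otimes> commutator G x y"
    and kernel_nonabelian: "\<exists>x \<in> kernel G K p. \<exists>y \<in> kernel G K p. x \<otimes> y \<noteq> y \<otimes> x"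
    and centerless_K: "center K = {\<one>\<^bsub>K\<^esub>}"
    and \<Psi>_iso: "\<Psi> \<in> iso (AutoGroup G) G"
begin

sublocale p: group_hom G K p
  by (simp add: group_hom_def group_hom_axioms_def p_hom)

definition N :: "'a set" where "N = kernel G K p"
definition C :: "'a set" where "C = {c \<in> carrier G. \<forall>x \<in> N. c \<otimes> x = x \<otimes> c}"

lemma N_subgroup: "subgroup N G"
  unfolding N_def by (rule p.subgroup_kernel)

lemma N_closed [simp]: "n \<in> N \<Longrightarrow> n \<in> carrier G"
  by (simp add: N_def kernel_def)

lemma p_N [simp]: "n \<in> N \<Longrightarrow> p n = \<one>\<^bsub>K\<^esub>"
  unfolding N_def kernel_def by blast

lemma NI: "g \<in> carrier G \<Longrightarrow> p g = \<one>\<^bsub>K\<^esub> \<Longrightarrow> g \<in> N"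
  unfolding N_def kernel_def by blast

lemma C_closed [simp]: "c \<in> C \<Longrightarrow> c \<in> carrier G"
  unfolding C_def by blast

lemma C_commutes: "c \<in> C \<Longrightarrow> x \<in> N \<Longrightarrow> c \<otimes> x = x \<otimes> c"
  unfolding C_def by blast

lemma CI: "c \<in> carrier G \<Longrightarrow> (\<And>x. x \<in> N \<Longrightarrow> c \<otimes> x = x \<otimes> c) \<Longrightarrow> c \<in> C"
  unfolding C_def by blast

lemma C_subgroup: "subgroup C G"
proof (rule subgroupI)
  show "C \<subseteq> carrier G" by auto
  have "\<one> \<in> C" by (rule CI) simp_all
  then show "C \<noteq> {}" by blast
  show "inv c \<in> C" if c: "c \<in> C" for c
  proof -
    have "inv c \<otimes> x = x \<otimes> inv c" if x: "x \<in> N" for x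
    proof -
      have "inv c \<otimes> x = inv c \<otimes> (x \<otimes> c) \<otimes> inv c" using c x by (simp add: m_assoc)
      also have "x \<otimes> c = c \<otimes> x" using C_commutes[OF c x] by simp
      finally show ?thesis using c x by (simp add: m_assoc)
    qed
    then show ?thesis using c by (intro CI) simp_all
  qed
  show "c \<otimes> d \<in> C" if c: "c \<in> C" and d: "d \<in> C" for c d
  proof -
    have "c \<otimes> d \<otimes> x = x \<otimes> (c \<otimes> d)" if x: "x \<in> N" for x
      using c d x C_commutes[OF c x] C_commutes[OF d x] by (metis C_closed N_closed m_assoc)
    then show ?thesis using c d by (intro CI) simp_all
  qed
qed

lemma center_subset_N: "center G \<subseteq> N"
proof
  fix z assume z: "z \<in> center G"
  have "p z \<in> center K"
  proof (rule K.centerI)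
    show "p z \<in> carrier K" using z by simp
    fix k assume "k \<in> carrier K"
    then obtain g where g: "g \<in> carrier G" "k = p g" using p_surj by blast
    have "p (z \<otimes> g) = p (g \<otimes> z)" using center_commutes[OF z g(1)] by simp
    then show "p z \<otimes>\<^bsub>K\<^esub> k = k \<otimes>\<^bsub>K\<^esub> p z" using z g by simp
  qed
  then show "z \<in> N" using z centerless_K by (intro NI) simp_all
qed

lemma action_on_N:
  assumes g: "g \<in> carrier G"
  obtains n where "n \<in> N" "\<And>x. x \<in> N \<Longrightarrow> g \<otimes> x \<otimes> inv g = n \<otimes> x \<otimes> inv n"
  using inner_action[OF g] unfolding N_def by blast

text \<open>An element of \<open>N\<close> that centralizes \<open>N\<close> is central, since every element of \<open>G\<close> acts on \<open>N\<close> like an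
  element of \<open>N\<close>.\<close>

lemma N_Int_C: "N \<inter> C = center G"
proof (intro equalityI subsetI)
  fix z assume z: "z \<in> N \<inter> C"
  show "z \<in> center G"
  proof (rule centerI)
    show zc: "z \<in> carrier G" using z by simp
    fix g assume g: "g \<in> carrier G"
    obtain n where n: "n \<in> N" "\<And>x. x \<in> N \<Longrightarrow> g \<otimes> x \<otimes> inv g = n \<otimes> x \<otimes> inv n"
      using action_on_N[OF g] by blast
    have "g \<otimes> z \<otimes> inv g = n \<otimes> z \<otimes> inv n" using n z by blast
    also have "n \<otimes> z = z \<otimes> n" using C_commutes[of z n] z n by simp
    also have "z \<otimes> n \<otimes> inv n = z" using n zc by (simp add: m_assoc)
    finally have "z \<otimes> g = (g \<otimes> z \<otimes> inv g) \<otimes> g" by simp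
    then show "z \<otimes> g = g \<otimes> z" using g zc by (simp add: m_assoc)
  qed
next
  fix z assume z: "z \<in> center G"
  then have "z \<otimes> x = x \<otimes> z" if "x \<in> N" for x using center_commutes[OF z] that by simp
  then have "z \<in> C" using z by (intro CI) simp_all
  then show "z \<in> N \<inter> C" using z center_subset_N by blast
qed

lemma N_times_C:
  assumes g: "g \<in> carrier G"
  obtains n c where "n \<in> N" "c \<in> C" "g = n \<otimes> c"
proof -
  obtain n where n: "n \<in> N" "\<And>x. x \<in> N \<Longrightarrow> g \<otimes> x \<otimes> inv g = n \<otimes> x \<otimes> inv n"
    using action_on_N[OF g] by blast
  have "(inv n \<otimes> g) \<otimes> x = x \<otimes> (inv n \<otimes> g)" if x: "x \<in> N" for x
  proof -
    have "(inv n \<otimes> g) \<otimes> x = inv n \<otimes> (g \<otimes> x \<otimes> inv g) \<otimes> g" using g n(1) x by (simp add: m_assoc)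
    also have "g \<otimes> x \<otimes> inv g = n \<otimes> x \<otimes> inv n" by (rule n(2)[OF x])
    finally show ?thesis using g n(1) x by (simp add: m_assoc)
  qed
  then have "inv n \<otimes> g \<in> C" using g n(1) by (intro CI) simp_all
  then show ?thesis using that[of n "inv n \<otimes> g"] n g by simp
qed

text \<open>The kernel is the second center of \<open>G\<close>, hence is preserved by all automorphisms.\<close>

lemma N_eq_second_center:
  "g \<in> N \<longleftrightarrow> g \<in> carrier G \<and> (\<forall>h \<in> carrier G. commutator G g h \<in> center G)"
proof (intro iffI conjI ballI)
  fix h assume g: "g \<in> N" and h: "h \<in> carrier G"
  obtain n where n: "n \<in> N" "\<And>x. x \<in> N \<Longrightarrow> h \<otimes> x \<otimes> inv h = n \<otimes> x \<otimes> inv n"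
    using action_on_N[OF h] by blast
  have gi: "inv g \<in> N" using g by (rule subgroup.m_inv_closed[OF N_subgroup])
  have "commutator G g h = g \<otimes> (h \<otimes> inv g \<otimes> inv h)" using g h by (simp add: commutator_def m_assoc)
  also have "\<dots> = commutator G g n" using n(2)[OF gi] g n(1) by (simp add: commutator_def m_assoc)
  finally have eq: "commutator G g h = commutator G g n" .
  have "commutator G g n \<in> N"
    unfolding commutator_def using g n gi N_subgroup by (simp add: subgroup.m_closed subgroup.m_inv_closed)
  moreover have "commutator G g n \<in> C"
    using class_two[of g n] g n(1) by (intro CI) (simp_all flip: N_def)
  ultimately show "commutator G g h \<in> center G" using eq N_Int_C by auto
next
  assume g: "g \<in> carrier G \<and> (\<forall>h \<in> carrier G. commutator G g h \<in> center G)"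
  have "p g \<in> center K"
  proof (rule K.centerI)
    show "p g \<in> carrier K" using g by simp
    fix k assume "k \<in> carrier K"
    then obtain h where h: "h \<in> carrier G" "k = p h" using p_surj by blast
    have "commutator G g h \<in> N" using g h center_subset_N by blast
    then have "p (commutator G g h) = \<one>\<^bsub>K\<^esub>" by (rule p_N)
    moreover have "p (commutator G g h) = commutator K (p g) (p h)"
      using g h by (simp add: commutator_def)
    ultimately have "commutator K (p g) (p h) = \<one>\<^bsub>K\<^esub>" by simp
    then show "p g \<otimes>\<^bsub>K\<^esub> k = k \<otimes>\<^bsub>K\<^esub> p g" using g h by (simp add: K.commutator_eq_one_iff)
  qed
  then show "g \<in> N" using g centerless_K by (intro NI) simp_all
qed simp

lemma N_auto:
  assumes \<alpha>: "\<alpha> \<in> auto G" and n: "n \<in> N" shows "\<alpha> n \<in> N"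
  unfolding N_eq_second_center
proof (intro conjI ballI)
  show "\<alpha> n \<in> carrier G" using \<alpha> n by (simp add: auto_closed)
  fix h assume "h \<in> carrier G"
  then obtain k where k: "k \<in> carrier G" "h = \<alpha> k" using auto_surj[OF \<alpha>] by blast
  have "commutator G n k \<in> center G" using n k N_eq_second_center by blast
  then have "\<alpha> (commutator G n k) \<in> center G" by (rule center_auto[OF \<alpha>])
  then show "commutator G (\<alpha> n) h \<in> center G" using auto_commutator[OF \<alpha> _ k(1), of n] n k by simp
qed

lemma C_auto:
  assumes \<alpha>: "\<alpha> \<in> auto G" and c: "c \<in> C" shows "\<alpha> c \<in> C"
proof -
  have surj: "\<exists>m \<in> N. x = \<alpha> m" if x: "x \<in> N" for x
  proof -
    have "\<alpha> ` N \<subseteq> N" using N_auto[OF \<alpha>] by auto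
    moreover have "card (\<alpha> ` N) = card N"
      by (rule card_image) (use \<alpha> in \<open>auto simp: auto_inj inj_on_def\<close>)
    moreover have "finite N" by (rule finite_subset[OF _ finite_G]) auto
    ultimately have "\<alpha> ` N = N" by (metis card_subset_eq)
    then show ?thesis using x by auto
  qed
  have "\<alpha> c \<otimes> x = x \<otimes> \<alpha> c" if "x \<in> N" for x
  proof -
    obtain m where m: "m \<in> N" "x = \<alpha> m" using surj \<open>x \<in> N\<close> by blast
    show ?thesis using C_commutes[OF c m(1)] auto_mult[OF \<alpha>, of c m] auto_mult[OF \<alpha>, of m c] c m by simp
  qed
  then show ?thesis using \<alpha> c by (intro CI) (simp_all add: auto_closed)
qed

end

section \<open>The direct decomposition of a stable extension\<close>

context stable_extension
begin

definition conj_image :: "'a \<Rightarrow> 'a" where "conj_image g = \<Psi> (conj_aut G g)"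
text \<open>The group \<open>C/Z(G)\<close>, realized as a group of automorphisms and brought back to \<open>G\<close>.\<close>

definition L :: "'a set" where "L = conj_image ` C"

lemma \<Psi>_hom: "\<Psi> \<in> hom (AutoGroup G) G"
  using \<Psi>_iso by (simp add: iso_def)

lemma \<Psi>_bij: "bij_betw \<Psi> (auto G) (carrier G)"
  using \<Psi>_iso by (simp add: iso_def)

lemma \<Psi>_closed [simp]: "\<alpha> \<in> auto G \<Longrightarrow> \<Psi> \<alpha> \<in> carrier G"
  using \<Psi>_bij by (rule bij_betwE[THEN bspec])

lemma \<Psi>_mult: "\<alpha> \<in> auto G \<Longrightarrow> \<beta> \<in> auto G \<Longrightarrow> \<Psi> (\<alpha> \<otimes>\<^bsub>AutoGroup G\<^esub> \<beta>) = \<Psi> \<alpha> \<otimes> \<Psi> \<beta>"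
  using \<Psi>_hom by (auto simp: hom_def)

lemma \<Psi>_eq_iff: "\<alpha> \<in> auto G \<Longrightarrow> \<beta> \<in> auto G \<Longrightarrow> \<Psi> \<alpha> = \<Psi> \<beta> \<longleftrightarrow> \<alpha> = \<beta>"
  using \<Psi>_bij by (auto simp: bij_betw_def inj_on_def)

lemma \<Psi>_surj:
  assumes "g \<in> carrier G" obtains \<alpha> where "\<alpha> \<in> auto G" "g = \<Psi> \<alpha>"
  using assms \<Psi>_bij by (auto simp: bij_betw_def)

lemma group_hom_conj_image: "group_hom G G conj_image"
  unfolding group_hom_def group_hom_axioms_def
  using Group.hom_compose[OF conj_aut_hom \<Psi>_hom] by (simp add: conj_image_def[abs_def] comp_def)

sublocale s: group_hom G G conj_image
  by (rule group_hom_conj_image)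

lemma conj_image_eq_one_iff:
  assumes "g \<in> carrier G" shows "conj_image g = \<one> \<longleftrightarrow> g \<in> center G"
proof -
  have one: "\<one>\<^bsub>AutoGroup G\<^esub> \<in> auto G"
    using monoid.one_closed[OF group.is_monoid[OF AutoGroup]] by simp
  have "\<Psi> \<one>\<^bsub>AutoGroup G\<^esub> = \<one>" using hom_one[OF \<Psi>_hom AutoGroup is_group] .
  then have "conj_image g = \<one> \<longleftrightarrow> \<Psi> (conj_aut G g) = \<Psi> \<one>\<^bsub>AutoGroup G\<^esub>"
    by (simp add: conj_image_def)
  also have "\<dots> \<longleftrightarrow> conj_aut G g = \<one>\<^bsub>AutoGroup G\<^esub>"
    by (rule \<Psi>_eq_iff[OF conj_aut_auto[OF assms] one])
  finally show ?thesis using conj_aut_eq_one_iff[OF assms] by simp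
qed

lemma conj_image_eq_iff:
  assumes "g \<in> carrier G" "h \<in> carrier G"
  shows "conj_image g = conj_image h \<longleftrightarrow> g \<otimes> inv h \<in> center G"
  using assms conj_image_eq_one_iff[of "g \<otimes> inv h"] by (simp add: mult_inv_eq_one_iff)

lemma conj_image_mult_center:
  assumes "g \<in> carrier G" "z \<in> center G"
  shows "conj_image (g \<otimes> z) = conj_image g" "conj_image (z \<otimes> g) = conj_image g"
  using assms conj_image_eq_one_iff[of z] by simp_all

lemma \<Psi>_conj_image:
  assumes \<alpha>: "\<alpha> \<in> auto G" and g: "g \<in> carrier G"
  shows "\<Psi> \<alpha> \<otimes> conj_image g = conj_image (\<alpha> g) \<otimes> \<Psi> \<alpha>"
  using auto_conj_aut[OF \<alpha> g] \<alpha> g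
  by (simp add: conj_image_def conj_aut_auto auto_closed flip: \<Psi>_mult)

lemma conj_image_commutator:
  "g \<in> carrier G \<Longrightarrow> h \<in> carrier G \<Longrightarrow> conj_image (commutator G g h) = commutator G (conj_image g) (conj_image h)"
  by (simp add: commutator_def)

lemma L_closed [simp]: "l \<in> L \<Longrightarrow> l \<in> carrier G"
  unfolding L_def by auto

lemma L_subgroup: "subgroup L G"
  unfolding L_def by (rule s.subgroup_img_is_subgroup[OF C_subgroup])

text \<open>An element of \<open>N \<inter> L\<close> comes from an element of \<open>C\<close> whose commutators with \<open>C\<close> are in
  the second center and hence, being in \<open>C\<close>, in the center. Such an element is itself in the second
  center and thus central.\<close>

lemma N_Int_L: "N \<inter> L = {\<one>}"
proof (intro equalityI subsetI)
  fix l assume l: "l \<in> N \<inter> L"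
  then obtain c where c: "c \<in> C" "l = conj_image c" unfolding L_def by auto
  have cd: "commutator G c d \<in> center G" if d: "d \<in> C" for d
  proof -
    have dc: "commutator G c d \<in> carrier G" using c(1) d by simp
    have "\<forall>h \<in> carrier G. commutator G (conj_image c) h \<in> center G"
      using l c(2) N_eq_second_center by blast
    then have "commutator G (conj_image c) (conj_image d) \<in> center G"
      using s.hom_closed[OF C_closed[OF d]] by blast
    then have dZ: "conj_image (commutator G c d) \<in> center G"
      using conj_image_commutator[OF C_closed[OF c(1)] C_closed[OF d]] by metis
    have "commutator G (commutator G c d) g \<in> center G" if g: "g \<in> carrier G" for g
    proof -
      have "conj_image (commutator G (commutator G c d) g) = \<one>"
        unfolding conj_image_commutator[OF dc g] by (rule commutator_center_left[OF s.hom_closed[OF g] dZ])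
      then show ?thesis using conj_image_eq_one_iff[OF commutator_closed[OF dc g]] by blast
    qed
    then have "commutator G c d \<in> N" using N_eq_second_center dc by blast
    moreover have "commutator G c d \<in> C"
      unfolding commutator_def
      using c(1) d by (intro subgroup.m_closed[OF C_subgroup] subgroup.m_inv_closed[OF C_subgroup])
    ultimately show ?thesis using N_Int_C by blast
  qed
  have "c \<in> N"
    unfolding N_eq_second_center
  proof (intro conjI ballI)
    show "c \<in> carrier G" using c by simp
    fix g assume "g \<in> carrier G"
    then obtain n d where nd: "n \<in> N" "d \<in> C" "g = n \<otimes> d" by (rule N_times_C)
    have "c \<otimes> g = n \<otimes> (commutator G c d \<otimes> (d \<otimes> c))"
    proof -
      have "c \<otimes> g = (c \<otimes> n) \<otimes> d" using nd c(1) by (simp add: m_assoc)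
      also have "c \<otimes> n = n \<otimes> c" by (rule C_commutes[OF c(1) nd(1)])
      also have "n \<otimes> c \<otimes> d = n \<otimes> (c \<otimes> d)" using nd(1,2) c(1) by (simp add: m_assoc)
      finally show ?thesis using mult_eq_commutator[of c d] c(1) nd(2) by simp
    qed
    also have "\<dots> = commutator G c d \<otimes> (n \<otimes> (d \<otimes> c))"
      using nd c(1) by (intro center_commutes_left cd) simp_all
    also have "\<dots> = commutator G c d \<otimes> (g \<otimes> c)" using nd c(1) by (simp add: m_assoc)
    finally have "commutator G c g = commutator G c d"
      using mult_eq_commutator[of c g] c(1) nd by (metis C_closed N_closed commutator_closed m_closed right_cancel)
    then show "commutator G c g \<in> center G" using cd[OF nd(2)] by simp
  qed
  then have "c \<in> center G" using c(1) N_Int_C by blast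
  then show "l \<in> {\<one>}" using c conj_image_eq_one_iff[of c] by simp
qed (use subgroup.one_closed[OF N_subgroup] subgroup.one_closed[OF L_subgroup] in auto)

lemma p_inj_L: "inj_on p L"
proof (rule inj_onI)
  fix k l assume kl: "k \<in> L" "l \<in> L" "p k = p l"
  have "p (k \<otimes> inv l) = \<one>\<^bsub>K\<^esub>" using kl by simp
  then have "k \<otimes> inv l \<in> N" using kl(1,2) by (intro NI) simp_all
  moreover have "k \<otimes> inv l \<in> L"
    using kl L_subgroup by (simp add: subgroup.m_closed subgroup.m_inv_closed)
  ultimately have "k \<otimes> inv l = \<one>" using N_Int_L by blast
  then show "k = l" using kl(1,2) by (simp add: mult_inv_eq_one_iff)
qed

lemma p_C: "p ` C = carrier K"
proof (intro equalityI subsetI)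
  fix k assume "k \<in> carrier K"
  then obtain g where g: "g \<in> carrier G" "k = p g" using p_surj by blast
  obtain n c where nc: "n \<in> N" "c \<in> C" "g = n \<otimes> c" using g(1) by (rule N_times_C)
  then show "k \<in> p ` C" using g by auto
qed auto

text \<open>Both \<open>L\<close> and the image of \<open>C\<close> under \<open>p\<close> are quotients of \<open>C\<close> by \<open>Z(G)\<close>, so \<open>L\<close> has as many elements as \<open>K\<close>.\<close>

lemma p_L: "p ` L = carrier K"
proof -
  have finC: "finite C" by (rule finite_subset[OF _ finite_G]) auto
  have Zc: "subgroup (center G) G" by (rule subgroup_center)
  have ZC: "z \<in> C" if "z \<in> center G" for z using that N_Int_C by blast
  have "card C = card (conj_image ` C) * card (center G)"
    using subgroup.m_closed[OF C_subgroup] ZC finC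
    by (intro card_eq_card_image_times[OF Zc]) (auto simp: conj_image_eq_iff simp del: s.hom_mult)
  moreover have "card C = card (p ` C) * card (center G)"
  proof (intro card_eq_card_image_times[OF Zc finC])
    show "p c = p d \<longleftrightarrow> c \<otimes> inv d \<in> center G" if cd: "c \<in> C" "d \<in> C" for c d
    proof -
      have "c \<otimes> inv d \<in> C"
        using cd C_subgroup by (simp add: subgroup.m_closed subgroup.m_inv_closed)
      moreover have "c \<otimes> inv d \<in> N \<longleftrightarrow> p (c \<otimes> inv d) = \<one>\<^bsub>K\<^esub>"
        using cd p_N NI by (metis C_closed inv_closed m_closed)
      moreover have "p (c \<otimes> inv d) = \<one>\<^bsub>K\<^esub> \<longleftrightarrow> p c = p d"
        using cd by (simp add: K.mult_inv_eq_one_iff)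
      ultimately show ?thesis using N_Int_C by blast
    qed
  qed (use subgroup.m_closed[OF C_subgroup] ZC in auto)
  moreover have "card (center G) > 0"
    using center_one finite_subset[OF center_subset finite_G] by (metis card_gt_0_iff emptyE)
  ultimately have "card L = card (carrier K)" by (simp add: L_def p_C)
  then have "card (p ` L) = card (carrier K)" using card_image[OF p_inj_L] by simp
  moreover have "finite (carrier K)" using p_surj finite_G by (metis finite_imageI)
  moreover have "p ` L \<subseteq> carrier K" by auto
  ultimately show ?thesis by (metis card_subset_eq)
qed

definition q :: "'c \<Rightarrow> 'a" where "q = inv_into L p"

lemma q_L: "k \<in> carrier K \<Longrightarrow> q k \<in> L"
  using p_L inv_into_into[of k p L] by (simp add: q_def)

lemma q_closed [simp]: "k \<in> carrier K \<Longrightarrow> q k \<in> carrier G"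
  using q_L by simp

lemma p_q [simp]: "k \<in> carrier K \<Longrightarrow> p (q k) = k"
  using p_L f_inv_into_f[of k p L] by (simp add: q_def)

lemma q_p: "l \<in> L \<Longrightarrow> q (p l) = l"
  using inv_into_f_f[OF p_inj_L] by (simp add: q_def)

lemma q_mult: "k \<in> carrier K \<Longrightarrow> k' \<in> carrier K \<Longrightarrow> q (k \<otimes>\<^bsub>K\<^esub> k') = q k \<otimes> q k'"
  using q_p[of "q k \<otimes> q k'"] q_L subgroup.m_closed[OF L_subgroup] by simp

lemma N_L_commute:
  assumes n: "n \<in> N" and l: "l \<in> L"
  shows "n \<otimes> l = l \<otimes> n"
proof -
  have "n \<otimes> l \<otimes> inv n \<in> L"
  proof -
    obtain \<alpha> where \<alpha>: "\<alpha> \<in> auto G" "n = \<Psi> \<alpha>" using N_closed[OF n] by (rule \<Psi>_surj)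
    obtain c where c: "c \<in> C" "l = conj_image c" using l unfolding L_def by blast
    have "n \<otimes> l = conj_image (\<alpha> c) \<otimes> n" using \<Psi>_conj_image[OF \<alpha>(1), of c] \<alpha>(2) c by simp
    then have "n \<otimes> l \<otimes> inv n = conj_image (\<alpha> c)"
      using n l c(1) \<alpha>(1) by (simp add: m_assoc auto_closed)
    then show ?thesis using C_auto[OF \<alpha>(1) c(1)] unfolding L_def by blast
  qed
  then have "commutator G n l \<in> L"
    unfolding commutator_def
    by (rule subgroup.m_closed[OF L_subgroup _ subgroup.m_inv_closed[OF L_subgroup l]])
  moreover have "commutator G n l \<in> N"
    using n l by (intro NI) (simp_all add: commutator_def)
  ultimately have "commutator G n l = \<one>" using N_Int_L by blast
  then show ?thesis using n l by (simp add: commutator_eq_one_iff)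
qed

text \<open>So \<open>G\<close> is the internal direct product of \<open>N\<close> and \<open>L\<close>; the two components of \<open>g\<close> are
  \<open>npart g\<close> and \<open>q (p g)\<close>.\<close>

definition npart :: "'a \<Rightarrow> 'a" where "npart g = g \<otimes> inv (q (p g))"

lemma npart_N: "g \<in> carrier G \<Longrightarrow> npart g \<in> N"
  unfolding npart_def by (intro NI) simp_all

lemma npart_decomp: "g \<in> carrier G \<Longrightarrow> g = npart g \<otimes> q (p g)"
  by (simp add: npart_def m_assoc)

lemma qp_one [simp]: "q \<one>\<^bsub>K\<^esub> = \<one>"
  using q_p[OF subgroup.one_closed[OF L_subgroup]] by simp

lemma npart_of_N: "n \<in> N \<Longrightarrow> npart n = n"
  by (simp add: npart_def)

lemma npart_of_L: "l \<in> L \<Longrightarrow> npart l = \<one>"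
  by (simp add: npart_def q_p)

lemma npart_mult:
  assumes g: "g \<in> carrier G" and h: "h \<in> carrier G"
  shows "npart (g \<otimes> h) = npart g \<otimes> npart h"
proof -
  have c: "npart g \<in> carrier G" "npart h \<in> carrier G" "q (p g) \<in> carrier G" "q (p h) \<in> carrier G"
    using g h npart_N by auto
  have swap: "npart h \<otimes> q (p g) = q (p g) \<otimes> npart h"
    using g h by (intro N_L_commute npart_N q_L) simp_all
  have "g \<otimes> h = (npart g \<otimes> q (p g)) \<otimes> (npart h \<otimes> q (p h))"
    using npart_decomp[OF g] npart_decomp[OF h] by simp
  also have "\<dots> = npart g \<otimes> (q (p g) \<otimes> npart h) \<otimes> q (p h)"
    using c by (simp add: m_assoc)
  also have "\<dots> = npart g \<otimes> npart h \<otimes> (q (p g) \<otimes> q (p h))"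
    unfolding swap[symmetric] using c by (simp add: m_assoc)
  also have "q (p g) \<otimes> q (p h) = q (p (g \<otimes> h))" using g h by (simp add: q_mult)
  finally have "npart (g \<otimes> h) = npart g \<otimes> npart h \<otimes> q (p (g \<otimes> h)) \<otimes> inv (q (p (g \<otimes> h)))"
    by (simp add: npart_def)
  then show ?thesis using c g h by (simp add: m_assoc del: p.hom_mult)
qed

text \<open>The image of \<open>L\<close> in \<open>K\<close> is all of \<open>K\<close>, which has no center.\<close>

lemma commutes_with_L_imp_N:
  assumes g: "g \<in> carrier G" and comm: "\<And>l. l \<in> L \<Longrightarrow> g \<otimes> l = l \<otimes> g"
  shows "g \<in> N"
proof -
  have "p g \<in> center K"
  proof (rule K.centerI)
    show "p g \<in> carrier K" using g by simp
    fix k assume "k \<in> carrier K"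
    then obtain l where l: "l \<in> L" "k = p l" using p_L by blast
    have "p (g \<otimes> l) = p (l \<otimes> g)" using comm[OF l(1)] by simp
    then show "p g \<otimes>\<^bsub>K\<^esub> k = k \<otimes>\<^bsub>K\<^esub> p g" using l g by simp
  qed
  then show ?thesis using centerless_K g by (intro NI) simp_all
qed

text \<open>The automorphism of \<open>G\<close> acting by \<open>\<beta>\<close> on \<open>N\<close> and, through \<open>p\<close>, by \<open>\<gamma>\<close> on \<open>L\<close>.\<close>

definition prod_aut :: "('a \<Rightarrow> 'a) \<Rightarrow> ('c \<Rightarrow> 'c) \<Rightarrow> 'a \<Rightarrow> 'a"
  where "prod_aut \<beta> \<gamma> = (\<lambda>g \<in> carrier G. \<beta> (npart g) \<otimes> q (\<gamma> (p g)))"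

abbreviation NG :: "('a, 'b) monoid_scheme" where "NG \<equiv> G\<lparr>carrier := N\<rparr>"

sublocale NG: group NG
  using N_subgroup by (rule subgroup.subgroup_is_group) (rule is_group)

lemma prod_aut_auto:
  assumes \<beta>: "\<beta> \<in> auto NG" and \<gamma>: "\<gamma> \<in> auto K"
  shows "prod_aut \<beta> \<gamma> \<in> auto G"
proof (rule finite_autoI[OF finite_G])
  have \<beta>N: "\<beta> n \<in> N" if "n \<in> N" for n using NG.auto_closed[OF \<beta>] that by simp
  have \<beta>m: "\<beta> (m \<otimes> n) = \<beta> m \<otimes> \<beta> n" if "m \<in> N" "n \<in> N" for m n
    using NG.auto_mult[OF \<beta>] that by simp
  show "prod_aut \<beta> \<gamma> \<in> hom G G"
  proof (rule homI)
    show "prod_aut \<beta> \<gamma> g \<in> carrier G" if "g \<in> carrier G" for g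
      using that npart_N \<beta>N K.auto_closed[OF \<gamma>] by (simp add: prod_aut_def)
    fix g h assume g: "g \<in> carrier G" and h: "h \<in> carrier G"
    have c: "\<beta> (npart g) \<in> N" "\<beta> (npart h) \<in> N" "q (\<gamma> (p g)) \<in> L" "q (\<gamma> (p h)) \<in> L"
      using g h npart_N \<beta>N K.auto_closed[OF \<gamma>] q_L by simp_all
    have c': "\<beta> (npart g) \<in> carrier G" "\<beta> (npart h) \<in> carrier G" "q (\<gamma> (p g)) \<in> carrier G" "q (\<gamma> (p h)) \<in> carrier G"
      using c by simp_all
    have "prod_aut \<beta> \<gamma> (g \<otimes> h) = \<beta> (npart g) \<otimes> \<beta> (npart h) \<otimes> (q (\<gamma> (p g)) \<otimes> q (\<gamma> (p h)))"
      using g h by (simp add: prod_aut_def npart_mult \<beta>m npart_N K.auto_mult[OF \<gamma>] q_mult K.auto_closed[OF \<gamma>])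
    also have "\<dots> = \<beta> (npart g) \<otimes> (\<beta> (npart h) \<otimes> q (\<gamma> (p g))) \<otimes> q (\<gamma> (p h))"
      using c' by (simp add: m_assoc)
    also have "\<beta> (npart h) \<otimes> q (\<gamma> (p g)) = q (\<gamma> (p g)) \<otimes> \<beta> (npart h)"
      by (rule N_L_commute[OF c(2,3)])
    finally show "prod_aut \<beta> \<gamma> (g \<otimes> h) = prod_aut \<beta> \<gamma> g \<otimes> prod_aut \<beta> \<gamma> h"
      using c' g h by (simp add: prod_aut_def m_assoc)
  qed
  show "prod_aut \<beta> \<gamma> \<in> extensional (carrier G)" by (simp add: prod_aut_def)
  fix g assume g: "g \<in> carrier G" "prod_aut \<beta> \<gamma> g = \<one>"
  have c: "\<beta> (npart g) \<in> N" "q (\<gamma> (p g)) \<in> L"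
    using g npart_N \<beta>N K.auto_closed[OF \<gamma>] q_L by simp_all
  have e: "\<beta> (npart g) \<otimes> q (\<gamma> (p g)) = \<one>" using g by (simp add: prod_aut_def)
  then have "p (\<beta> (npart g) \<otimes> q (\<gamma> (p g))) = \<one>\<^bsub>K\<^esub>" by simp
  then have "\<gamma> (p g) = \<one>\<^bsub>K\<^esub>" using c g K.auto_closed[OF \<gamma>] by simp
  then have pg: "p g = \<one>\<^bsub>K\<^esub>"
    using K.auto_inj[OF \<gamma>, of "p g" "\<one>\<^bsub>K\<^esub>"] K.auto_one[OF \<gamma>] g by simp
  then have gN: "g \<in> N" using g(1) by (intro NI) simp_all
  have "\<beta> g = \<one>" using e pg K.auto_one[OF \<gamma>] npart_of_N[OF gN] \<beta>N[OF gN] by simp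
  then show "g = \<one>"
    using NG.auto_inj[OF \<beta>, of g \<one>] NG.auto_one[OF \<beta>] gN subgroup.one_closed[OF N_subgroup] by simp
qed

lemma id_auto_N: "(\<lambda>x \<in> N. x) \<in> auto NG"
  using NG.id_in_auto by simp

lemma prod_aut_mult:
  assumes "\<beta> \<in> auto NG" "\<beta>' \<in> auto NG"
  shows "prod_aut (\<beta> \<otimes>\<^bsub>AutoGroup NG\<^esub> \<beta>') (\<lambda>x \<in> carrier K. x)
    = prod_aut \<beta> (\<lambda>x \<in> carrier K. x) \<otimes>\<^bsub>AutoGroup G\<^esub> prod_aut \<beta>' (\<lambda>x \<in> carrier K. x)"
proof (rule auto_eqI)
  note aut = prod_aut_auto[OF _ K.id_in_auto]
  show "prod_aut (\<beta> \<otimes>\<^bsub>AutoGroup NG\<^esub> \<beta>') (\<lambda>x \<in> carrier K. x) \<in> auto G"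
    by (rule aut[OF NG.auto_comp_closed[OF assms]])
  show "prod_aut \<beta> (\<lambda>x \<in> carrier K. x) \<otimes>\<^bsub>AutoGroup G\<^esub> prod_aut \<beta>' (\<lambda>x \<in> carrier K. x) \<in> auto G"
    by (rule auto_comp_closed[OF aut[OF assms(1)] aut[OF assms(2)]])
  fix g assume g: "g \<in> carrier G"
  have b: "\<beta>' (npart g) \<in> N" using NG.auto_closed[OF assms(2)] npart_N[OF g] by simp
  have "npart (\<beta>' (npart g) \<otimes> q (p g)) = \<beta>' (npart g)"
    using b g q_L[of "p g"] NG.auto_closed[OF assms(2)]
    by (simp add: npart_mult npart_of_N npart_of_L)
  then show "prod_aut (\<beta> \<otimes>\<^bsub>AutoGroup NG\<^esub> \<beta>') (\<lambda>x \<in> carrier K. x) g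
      = (prod_aut \<beta> (\<lambda>x \<in> carrier K. x) \<otimes>\<^bsub>AutoGroup G\<^esub> prod_aut \<beta>' (\<lambda>x \<in> carrier K. x)) g"
    unfolding mult_AutoGroup_apply[OF aut[OF assms(1)] aut[OF assms(2)] g]
    using g b npart_N[OF g] mult_AutoGroup_apply[OF assms, of "npart g"] q_closed[of "p g"]
    by (simp add: prod_aut_def)
qed

end

section \<open>The factors of a stable extension\<close>

context stable_extension
begin

lemma NG_commutator: "x \<in> N \<Longrightarrow> y \<in> N \<Longrightarrow> commutator NG x y = commutator G x y"
  unfolding commutator_def using m_inv_consistent[OF N_subgroup] by simp

lemma center_NG: "center NG = center G"
proof -
  have "center NG = {z \<in> N. \<forall>x \<in> N. z \<otimes> x = x \<otimes> z}" by (simp add: center_def)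
  also have "\<dots> = N \<inter> C" unfolding C_def using N_closed by blast
  finally show ?thesis using N_Int_C by simp
qed

lemma class_two_NG: "class_two_group NG"
proof
  show "finite (carrier NG)" by (simp, rule finite_subset[OF _ finite_G]) auto
  show "commutator NG x y \<in> center NG" if "x \<in> carrier NG" "y \<in> carrier NG" for x y
  proof -
    have xy: "x \<in> N" "y \<in> N" using that by simp_all
    then have "commutator G x y \<in> center G"
      using N_eq_second_center[of x] N_closed by blast
    then show ?thesis unfolding center_NG NG_commutator[OF xy] .
  qed
  show "center NG \<noteq> carrier NG"
  proof
    assume eq: "center NG = carrier NG"
    obtain x y where xy: "x \<in> N" "y \<in> N" "x \<otimes> y \<noteq> y \<otimes> x"
      using kernel_nonabelian unfolding N_def by blast
    have "x \<in> center G" using eq xy(1) unfolding center_NG by simp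
    then show False using xy center_commutes[of x y] by simp
  qed
qed

lemma L_subset_C: "l \<in> L \<Longrightarrow> l \<in> C"
  by (rule CI[OF L_closed N_L_commute[symmetric]])

lemma npart_C: "c \<in> C \<Longrightarrow> npart c \<in> center G"
proof -
  assume c: "c \<in> C"
  have "q (p c) \<in> C" using c by (intro L_subset_C q_L) simp
  then have "npart c \<in> C"
    unfolding npart_def
    by (intro subgroup.m_closed[OF C_subgroup c] subgroup.m_inv_closed[OF C_subgroup])
  then show "npart c \<in> center G" using npart_N[of c] c N_Int_C by auto
qed

definition aut_embedding :: "('a \<Rightarrow> 'a) \<Rightarrow> 'a"
  where "aut_embedding \<beta> = \<Psi> (prod_aut \<beta> (\<lambda>x \<in> carrier K. x))"

text \<open>The automorphism acts on \<open>C\<close> as the identity modulo the center, because the component in \<open>N\<close> of an element of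
  \<open>C\<close> is central. So it commutes with the conjugations by elements of \<open>C\<close>, that is, its image
  centralizes \<open>L\<close>.\<close>

lemma aut_embedding_N:
  assumes \<beta>: "\<beta> \<in> auto NG" shows "aut_embedding \<beta> \<in> N"
proof (rule commutes_with_L_imp_N)
  let ?\<alpha> = "prod_aut \<beta> (\<lambda>x \<in> carrier K. x)"
  have \<alpha>: "?\<alpha> \<in> auto G" by (rule prod_aut_auto[OF \<beta> K.id_in_auto])
  show "aut_embedding \<beta> \<in> carrier G" using \<alpha> by (simp add: aut_embedding_def)
  fix l assume "l \<in> L"
  then obtain c where c: "c \<in> C" "l = conj_image c" unfolding L_def by blast
  have cc: "c \<in> carrier G" using c by simp
  have qc: "q (p c) \<in> carrier G" using cc by simp
  have "\<beta> (npart c) \<in> center NG"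
    using NG.center_auto[OF \<beta>, of "npart c"] npart_C[OF c(1)] center_NG by simp
  then have z: "\<beta> (npart c) \<in> center G" using center_NG by simp
  have "?\<alpha> c = \<beta> (npart c) \<otimes> q (p c)" using cc by (simp add: prod_aut_def)
  then have "conj_image (?\<alpha> c) = conj_image (q (p c))"
    using conj_image_mult_center(2)[OF qc z] by simp
  also have "\<dots> = conj_image (npart c \<otimes> q (p c))"
    using conj_image_mult_center(2)[OF qc npart_C[OF c(1)]] by simp
  also have "\<dots> = conj_image c" using npart_decomp[OF cc] by simp
  finally show "aut_embedding \<beta> \<otimes> l = l \<otimes> aut_embedding \<beta>"
    using \<Psi>_conj_image[OF \<alpha> cc] c(2) by (simp add: aut_embedding_def)
qed

lemma aut_embedding_hom: "aut_embedding \<in> hom (AutoGroup NG) NG"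
proof (rule homI)
  show "aut_embedding \<beta> \<in> carrier NG" if "\<beta> \<in> carrier (AutoGroup NG)" for \<beta>
    using aut_embedding_N that by simp
  show "aut_embedding (\<beta> \<otimes>\<^bsub>AutoGroup NG\<^esub> \<beta>') = aut_embedding \<beta> \<otimes>\<^bsub>NG\<^esub> aut_embedding \<beta>'"
    if "\<beta> \<in> carrier (AutoGroup NG)" "\<beta>' \<in> carrier (AutoGroup NG)" for \<beta> \<beta>'
    using that \<Psi>_mult[OF prod_aut_auto[OF _ K.id_in_auto] prod_aut_auto[OF _ K.id_in_auto]]
    by (simp add: aut_embedding_def prod_aut_mult)
qed

lemma aut_embedding_inj: "inj_on aut_embedding (auto NG)"
proof (rule inj_onI)
  fix \<beta> \<beta>' assume b: "\<beta> \<in> auto NG" "\<beta>' \<in> auto NG" "aut_embedding \<beta> = aut_embedding \<beta>'"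
  then have eq: "prod_aut \<beta> (\<lambda>x \<in> carrier K. x) = prod_aut \<beta>' (\<lambda>x \<in> carrier K. x)"
    using \<Psi>_eq_iff[OF prod_aut_auto[OF _ K.id_in_auto] prod_aut_auto[OF _ K.id_in_auto]]
    by (simp add: aut_embedding_def)
  have val: "prod_aut \<gamma> (\<lambda>x \<in> carrier K. x) n = \<gamma> n" if \<gamma>: "\<gamma> \<in> auto NG" and n: "n \<in> N" for \<gamma> n
    using NG.auto_closed[OF \<gamma>, of n] n by (simp add: prod_aut_def npart_of_N)
  show "\<beta> = \<beta>'"
  proof (rule NG.auto_eqI[OF b(1,2)])
    fix n assume "n \<in> carrier NG"
    then show "\<beta> n = \<beta>' n" using val[OF b(1), of n] val[OF b(2), of n] eq by simp
  qed
qed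

lemma aut_embedding_inner:
  assumes n: "n \<in> N" shows "aut_embedding (conj_aut NG n) = conj_image n"
proof -
  have nc: "n \<in> carrier NG" "n \<in> carrier G" using n by simp_all
  have "prod_aut (conj_aut NG n) (\<lambda>x \<in> carrier K. x) = conj_aut G n"
  proof (rule auto_eqI[OF prod_aut_auto[OF NG.conj_aut_auto[OF nc(1)] K.id_in_auto] conj_aut_auto[OF nc(2)]])
    fix g assume g: "g \<in> carrier G"
    have gN: "npart g \<in> N" and gL: "q (p g) \<in> L" using npart_N g q_L by simp_all
    have c: "npart g \<in> carrier G" "q (p g) \<in> carrier G" using gN gL by simp_all
    have "prod_aut (conj_aut NG n) (\<lambda>x \<in> carrier K. x) g = n \<otimes> npart g \<otimes> inv n \<otimes> q (p g)"
      using g gN NG.conj_aut_apply[of "npart g" n] m_inv_consistent[OF N_subgroup n]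
      by (simp add: prod_aut_def)
    also have "\<dots> = n \<otimes> npart g \<otimes> (inv n \<otimes> q (p g))" using c nc by (simp add: m_assoc)
    also have "inv n \<otimes> q (p g) = q (p g) \<otimes> inv n"
      by (rule N_L_commute[OF subgroup.m_inv_closed[OF N_subgroup n] gL])
    also have "n \<otimes> npart g \<otimes> (q (p g) \<otimes> inv n) = n \<otimes> (npart g \<otimes> q (p g)) \<otimes> inv n"
      using c nc by (simp add: m_assoc)
    also have "\<dots> = conj_aut G n g" using npart_decomp[OF g] g by (simp add: conj_aut_apply)
    finally show "prod_aut (conj_aut NG n) (\<lambda>x \<in> carrier K. x) g = conj_aut G n g" .
  qed
  then show ?thesis by (simp add: aut_embedding_def conj_image_def)
qed

lemmas N_dihedral = class_two_group.dihedral_if_contains_automorphism_group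
  [OF class_two_NG aut_embedding_hom aut_embedding_inj]

lemma G_iso: "G \<cong> dihedral_group 4 \<times>\<times> K"
proof -
  have grp: "group (dihedral_group 4)" by (rule group_dihedral_group) simp
  obtain f where f: "f \<in> hom (dihedral_group 4) NG" "bij_betw f (carrier (dihedral_group 4)) N"
    using N_dihedral(1) by (auto simp: is_iso_def iso_def)
  have fN: "f d \<in> N" if "d \<in> carrier (dihedral_group 4)" for d
    using f(2) that by (auto simp: bij_betw_def)
  define F where "F = (\<lambda>(d, k). f d \<otimes> q k)"
  have "F \<in> hom (dihedral_group 4 \<times>\<times> K) G"
  proof (rule homI)
    fix u v
    assume "u \<in> carrier (dihedral_group 4 \<times>\<times> K)" "v \<in> carrier (dihedral_group 4 \<times>\<times> K)"
    then obtain d k d' k' where uv: "u = (d, k)" "v = (d', k')"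
      and m: "d \<in> carrier (dihedral_group 4)" "k \<in> carrier K"
        "d' \<in> carrier (dihedral_group 4)" "k' \<in> carrier K" by auto
    have c: "f d \<in> carrier G" "f d' \<in> carrier G" "q k \<in> carrier G" "q k' \<in> carrier G"
      using m fN by simp_all
    show "F u \<in> carrier G" using c uv by (simp add: F_def)
    have "f (d \<otimes>\<^bsub>dihedral_group 4\<^esub> d') = f d \<otimes> f d'" using f(1) m by (auto simp: hom_def)
    then have "F (u \<otimes>\<^bsub>dihedral_group 4 \<times>\<times> K\<^esub> v) = f d \<otimes> (f d' \<otimes> q k) \<otimes> q k'"
      using uv m c by (simp add: F_def q_mult m_assoc)
    also have "f d' \<otimes> q k = q k \<otimes> f d'" by (rule N_L_commute[OF fN[OF m(3)] q_L[OF m(2)]])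
    finally show "F (u \<otimes>\<^bsub>dihedral_group 4 \<times>\<times> K\<^esub> v) = F u \<otimes> F v"
      using uv c by (simp add: F_def m_assoc)
  qed
  moreover have "bij_betw F (carrier (dihedral_group 4 \<times>\<times> K)) (carrier G)"
    unfolding bij_betw_def
  proof
    show "inj_on F (carrier (dihedral_group 4 \<times>\<times> K))"
    proof (rule inj_onI)
      fix u v
      assume "u \<in> carrier (dihedral_group 4 \<times>\<times> K)" "v \<in> carrier (dihedral_group 4 \<times>\<times> K)" and eq: "F u = F v"
      then obtain d k d' k' where uv: "u = (d, k)" "v = (d', k')"
        and m: "d \<in> carrier (dihedral_group 4)" "k \<in> carrier K"
          "d' \<in> carrier (dihedral_group 4)" "k' \<in> carrier K" by auto
      have e: "f d \<otimes> q k = f d' \<otimes> q k'" using eq uv by (simp add: F_def)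
      have "p (f d \<otimes> q k) = k" "p (f d' \<otimes> q k') = k'" using m fN by simp_all
      then have "k = k'" using e by metis
      moreover have "f d = f d'" using e \<open>k = k'\<close> m fN by simp
      then have "d = d'" using f(2) m by (auto simp: bij_betw_def inj_on_def)
      ultimately show "u = v" using uv by simp
    qed
    show "F ` carrier (dihedral_group 4 \<times>\<times> K) = carrier G"
    proof (intro equalityI subsetI)
      fix g assume g: "g \<in> carrier G"
      have "npart g \<in> f ` carrier (dihedral_group 4)"
        using npart_N[OF g] f(2) by (simp add: bij_betw_def)
      then obtain d where d: "d \<in> carrier (dihedral_group 4)" "npart g = f d" by blast
      have "g = F (d, p g)" using npart_decomp[OF g] d by (simp add: F_def)
      then show "g \<in> F ` carrier (dihedral_group 4 \<times>\<times> K)" using d g by auto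
    qed (use fN in \<open>auto simp: F_def\<close>)
  qed
  ultimately have "dihedral_group 4 \<times>\<times> K \<cong> G" by (auto simp: is_iso_def iso_def)
  then show ?thesis using group.iso_sym DirProd_group[OF grp K.is_group] by blast
qed

text \<open>An automorphism \<open>\<gamma>\<close> of \<open>K\<close> is transported to \<open>L\<close> and extended by the identity on \<open>N\<close>. By the direct
  decomposition, the resulting automorphism of \<open>G\<close> corresponds to a product of an element of \<open>N\<close>, which
  centralizes \<open>L\<close>, and of the conjugation by some \<open>c \<in> C\<close>. So it acts on \<open>C\<close> modulo \<open>Z(G)\<close>
  like \<open>c\<close>, and \<open>\<gamma>\<close> is conjugation by \<open>p c\<close>.\<close>

lemma K_complete: "complete_group K"
proof -
  have "conj_aut K ` carrier K = auto K"
  proof (intro equalityI subsetI)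
    fix \<gamma> assume \<gamma>: "\<gamma> \<in> auto K"
    let ?\<alpha> = "prod_aut (\<lambda>x \<in> N. x) \<gamma>"
    have \<alpha>: "?\<alpha> \<in> auto G" by (rule prod_aut_auto[OF id_auto_N \<gamma>])
    define n where "n = npart (\<Psi> ?\<alpha>)"
    have n: "n \<in> N" unfolding n_def using \<alpha> by (intro npart_N) simp
    have "q (p (\<Psi> ?\<alpha>)) \<in> L" using \<alpha> by (intro q_L) simp
    then obtain c where c: "c \<in> C" "q (p (\<Psi> ?\<alpha>)) = conj_image c" unfolding L_def by blast
    have dec: "\<Psi> ?\<alpha> = n \<otimes> conj_image c" using npart_decomp[of "\<Psi> ?\<alpha>"] \<alpha> c by (simp add: n_def)
    have conjC: "\<gamma> (p d) = p c \<otimes>\<^bsub>K\<^esub> p d \<otimes>\<^bsub>K\<^esub> inv\<^bsub>K\<^esub> (p c)" if d: "d \<in> C" for d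
    proof -
      have cl: "conj_image c \<in> carrier G" "conj_image d \<in> carrier G" "n \<in> carrier G" "d \<in> carrier G" "c \<in> carrier G"
        using c(1) d n by simp_all
      have "conj_image (c \<otimes> d) \<in> L"
        unfolding L_def using subgroup.m_closed[OF C_subgroup c(1) d] by blast
      have cdc: "c \<otimes> d \<otimes> inv c \<in> C"
        using c(1) d C_subgroup by (simp add: subgroup.m_closed subgroup.m_inv_closed)
      then have "conj_image (c \<otimes> d \<otimes> inv c) \<in> L" unfolding L_def by blast
      then have sw: "n \<otimes> conj_image (c \<otimes> d \<otimes> inv c) = conj_image (c \<otimes> d \<otimes> inv c) \<otimes> n"
        by (rule N_L_commute[OF n])
      have ac: "?\<alpha> d \<in> carrier G" by (rule auto_closed[OF \<alpha> cl(4)])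
      have "conj_image (?\<alpha> d) \<otimes> \<Psi> ?\<alpha> = \<Psi> ?\<alpha> \<otimes> conj_image d"
        using \<Psi>_conj_image[OF \<alpha> cl(4)] by simp
      also have "\<dots> = n \<otimes> conj_image (c \<otimes> d \<otimes> inv c) \<otimes> conj_image c"
        unfolding dec using cl by (simp add: m_assoc)
      also have "\<dots> = conj_image (c \<otimes> d \<otimes> inv c) \<otimes> \<Psi> ?\<alpha>"
        unfolding sw dec using cl by (simp add: m_assoc del: s.hom_mult)
      finally have "conj_image (?\<alpha> d) = conj_image (c \<otimes> d \<otimes> inv c)"
        using cl ac \<alpha> by (simp add: right_cancel del: s.hom_mult)
      then have "?\<alpha> d \<otimes> inv (c \<otimes> d \<otimes> inv c) \<in> center G"
        using conj_image_eq_iff[OF ac, of "c \<otimes> d \<otimes> inv c"] cl by (simp del: s.hom_mult)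
      then have "p (?\<alpha> d \<otimes> inv (c \<otimes> d \<otimes> inv c)) = \<one>\<^bsub>K\<^esub>"
        using center_subset_N by (intro p_N) blast
      moreover have "p (?\<alpha> d \<otimes> inv (c \<otimes> d \<otimes> inv c))
          = p (?\<alpha> d) \<otimes>\<^bsub>K\<^esub> inv\<^bsub>K\<^esub> (p c \<otimes>\<^bsub>K\<^esub> p d \<otimes>\<^bsub>K\<^esub> inv\<^bsub>K\<^esub> (p c))"
        using cl ac by simp
      ultimately have "p (?\<alpha> d) = p c \<otimes>\<^bsub>K\<^esub> p d \<otimes>\<^bsub>K\<^esub> inv\<^bsub>K\<^esub> (p c)"
        using cl ac by (simp add: K.mult_inv_eq_one_iff)
      moreover have "p (?\<alpha> d) = \<gamma> (p d)"
        using cl npart_N[of d] K.auto_closed[OF \<gamma>] by (simp add: prod_aut_def)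
      ultimately show ?thesis by simp
    qed
    have val: "\<gamma> k = p c \<otimes>\<^bsub>K\<^esub> k \<otimes>\<^bsub>K\<^esub> inv\<^bsub>K\<^esub> (p c)" if "k \<in> carrier K" for k
    proof -
      have "k \<in> p ` C" using that p_C by simp
      then obtain d where d: "d \<in> C" "k = p d" by blast
      show ?thesis unfolding d(2) by (rule conjC[OF d(1)])
    qed
    have pc: "p c \<in> carrier K" using c(1) by simp
    have "\<gamma> = conj_aut K (p c)"
    proof (rule K.auto_eqI[OF \<gamma> K.conj_aut_auto[OF pc]])
      fix k assume k: "k \<in> carrier K"
      show "\<gamma> k = conj_aut K (p c) k" unfolding K.conj_aut_apply[OF k] by (rule val[OF k])
    qed
    then show "\<gamma> \<in> conj_aut K ` carrier K" using c(1) by simp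
  qed (use K.conj_aut_auto in auto)
  moreover have "inj_on (conj_aut K) (carrier K)"
  proof (rule group_hom.inj_on_one_iff[THEN iffD2])
    show "group_hom K (AutoGroup K) (conj_aut K)"
      using K.conj_aut_hom K.AutoGroup by (simp add: group_hom_def group_hom_axioms_def)
    show "\<forall>k. k \<in> carrier K \<longrightarrow> conj_aut K k = \<one>\<^bsub>AutoGroup K\<^esub> \<longrightarrow> k = \<one>\<^bsub>K\<^esub>"
      using K.conj_aut_eq_one_iff centerless_K by simp
  qed
  ultimately show ?thesis
    using K.conj_aut_hom by (simp add: complete_group_def iso_def bij_betw_def)
qed

text \<open>A character \<open>\<psi>\<close> of \<open>K\<close> of order two would give a central automorphism \<open>g \<mapsto> g c^\<psi>(p g)\<close>,
  where \<open>c\<close> is the central involution.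
  It commutes with all inner automorphisms, so it is the image of an element of \<open>N\<close>
  centralizing the inner automorphisms of \<open>N\<close>; hence it is inner, induced by \<open>N\<close>, and trivial
  on \<open>L\<close>.\<close>

lemma K_abelianization_odd: "odd (order (abelianization K))"
proof
  assume even: "even (order (abelianization K))"
  have "finite (carrier K)" using p_surj finite_G by (metis finite_imageI)
  then obtain \<psi> k0 where \<psi>: "\<psi> \<in> hom K (integer_mod_group 2)" "k0 \<in> carrier K" "\<psi> k0 \<noteq> 0"
    using K.even_abelianization_character[OF _ even] by blast
  obtain c where c: "center G = {\<one>, c}" "c \<noteq> \<one>"
    using N_dihedral(2) unfolding center_NG by auto
  have cZ: "c \<in> center G" "c \<in> carrier G" using c(1) center_subset by auto
  have cc: "c \<otimes> c = \<one>"
  proof -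
    have "c \<otimes> c \<in> {\<one>, c}" using cZ center_mult[of c c] c(1) by simp
    then show ?thesis using cZ c(2) by auto
  qed
  define f where "f = (\<lambda>g \<in> carrier G. c [^] \<psi> (p g))"
  have \<psi>1: "\<psi> \<one>\<^bsub>K\<^esub> = 0"
    using hom_one[OF \<psi>(1) K.is_group group_integer_mod_group] by simp
  have fh: "f \<in> central_homs G"
    unfolding central_homs_def
  proof (intro CollectI conjI)
    show "f \<in> hom G G"
    proof (rule homI)
      show "f g \<in> carrier G" if "g \<in> carrier G" for g using that cZ by (simp add: f_def)
      show "f (g \<otimes> h) = f g \<otimes> f h" if gh: "g \<in> carrier G" "h \<in> carrier G" for g h
      proof -
        have "\<psi> (p g \<otimes>\<^bsub>K\<^esub> p h) = (\<psi> (p g) + \<psi> (p h)) mod int 2"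
          using \<psi>(1) gh hom_integer_mod_group_iff[of 2 \<psi> K] by simp
        moreover have "c [^] ((\<psi> (p g) + \<psi> (p h)) mod int 2) = c [^] (\<psi> (p g) + \<psi> (p h))"
          using cZ cc by (intro int_pow_mod) (simp_all add: numeral_2_eq_2)
        ultimately show ?thesis using gh cZ by (simp add: f_def int_pow_mult)
      qed
    qed
    show "f \<in> extensional (carrier G)" by (simp add: f_def)
    show "f ` carrier G \<subseteq> center G" using cZ by (auto simp: f_def)
    show "\<forall>z \<in> center G. f z = \<one>"
    proof
      fix z assume z: "z \<in> center G"
      then have "z \<in> N" using center_subset_N by blast
      then show "f z = \<one>" using \<psi>1 by (simp add: f_def)
    qed
  qed
  define \<alpha> where "\<alpha> = central_aut G f"
  have \<alpha>: "\<alpha> \<in> auto G" unfolding \<alpha>_def by (rule central_aut_auto[OF finite_G fh])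
  have comm: "\<Psi> \<alpha> \<otimes> conj_image g = conj_image g \<otimes> \<Psi> \<alpha>" if g: "g \<in> carrier G" for g
  proof -
    have "conj_image (\<alpha> g) = conj_image g"
      unfolding \<alpha>_def central_aut_def using g conj_image_mult_center(1)[OF g central_homsD(3)[OF fh g]] by simp
    then show ?thesis using \<Psi>_conj_image[OF \<alpha> g] by simp
  qed
  have "\<Psi> \<alpha> \<in> N"
  proof (rule commutes_with_L_imp_N)
    show "\<Psi> \<alpha> \<in> carrier G" using \<alpha> by simp
    fix l assume "l \<in> L"
    then obtain c' where "c' \<in> C" "l = conj_image c'" unfolding L_def by blast
    then show "\<Psi> \<alpha> \<otimes> l = l \<otimes> \<Psi> \<alpha>" using comm[of c'] by simp
  qed
  moreover have "\<Psi> \<alpha> \<otimes>\<^bsub>NG\<^esub> aut_embedding (conj_aut NG n) = aut_embedding (conj_aut NG n) \<otimes>\<^bsub>NG\<^esub> \<Psi> \<alpha>"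
    if "n \<in> carrier NG" for n
    using comm[of n] that aut_embedding_inner[of n] by simp
  ultimately have "\<exists>n \<in> N. \<Psi> \<alpha> = aut_embedding (conj_aut NG n)"
    using N_dihedral(3)[of "\<Psi> \<alpha>"] by simp
  then obtain n where n: "n \<in> N" "\<Psi> \<alpha> = \<Psi> (conj_aut G n)"
    using aut_embedding_inner unfolding conj_image_def by auto
  have \<alpha>n: "\<alpha> = conj_aut G n" using n \<Psi>_eq_iff[OF \<alpha> conj_aut_auto[of n]] by simp
  have q0: "q k0 \<in> L" by (rule q_L[OF \<psi>(2)])
  have "\<alpha> (q k0) = n \<otimes> q k0 \<otimes> inv n" using \<alpha>n \<psi>(2) by (simp add: conj_aut_apply)
  also have "n \<otimes> q k0 = q k0 \<otimes> n" by (rule N_L_commute[OF n(1) q0])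
  also have "q k0 \<otimes> n \<otimes> inv n = q k0" using n(1) \<psi>(2) by (simp add: m_assoc)
  finally have "q k0 \<otimes> c [^] \<psi> k0 = q k0"
    using \<psi>(2) by (simp add: \<alpha>_def central_aut_def f_def)
  then have "c [^] \<psi> k0 = \<one>" using \<psi>(2) cZ by simp
  moreover have "\<psi> k0 = 1"
    using \<psi> hom_integer_mod_group_iff[of 2 \<psi> K] by fastforce
  ultimately show False using c(2) cZ by simp
qed

end

section \<open>Automorphisms of a direct product\<close>

lemma AutoGroup_iso:
  assumes G: "group G" and H: "group H" and iso: "G \<cong> H"
  shows "AutoGroup G \<cong> AutoGroup H"
proof -
  interpret G: group G by (rule G)
  interpret H: group H by (rule H)
  obtain f where f: "f \<in> iso G H" using iso by (auto simp: is_iso_def)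
  define g where "g = inv_into (carrier G) f"
  have g: "g \<in> iso H G" unfolding g_def by (rule G.iso_set_sym[OF f])
  have fb: "bij_betw f (carrier G) (carrier H)" and fh: "f \<in> hom G H" using f by (auto simp: iso_def)
  have gb: "bij_betw g (carrier H) (carrier G)" and gh: "g \<in> hom H G" using g by (auto simp: iso_def)
  have fg: "f (g y) = y" if "y \<in> carrier H" for y
    unfolding g_def using fb that by (intro f_inv_into_f) (simp add: bij_betw_def)
  have gf: "g (f x) = x" if "x \<in> carrier G" for x
    unfolding g_def using fb that by (intro inv_into_f_f) (simp_all add: bij_betw_def)
  have fc: "f x \<in> carrier H" if "x \<in> carrier G" for x using fh that by (auto simp: hom_def)
  have gc: "g y \<in> carrier G" if "y \<in> carrier H" for y using gh that by (auto simp: hom_def)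
  define T where "T \<alpha> = (\<lambda>y \<in> carrier H. f (\<alpha> (g y)))" for \<alpha>
  have T: "T \<alpha> \<in> auto H" if \<alpha>: "\<alpha> \<in> auto G" for \<alpha>
  proof -
    have "\<alpha> \<in> hom G G" "bij_betw \<alpha> (carrier G) (carrier G)" using \<alpha> by (auto simp: G.auto_iff)
    then have "f \<circ> \<alpha> \<circ> g \<in> hom H H" "bij_betw (f \<circ> \<alpha> \<circ> g) (carrier H) (carrier H)"
      using fh gh fb gb by (auto intro: Group.hom_compose bij_betw_trans)
    then have "T \<alpha> \<in> hom H H" "bij_betw (T \<alpha>) (carrier H) (carrier H)"
      unfolding T_def by (auto simp: hom_def intro: bij_betw_cong[THEN iffD1, rotated])
    then show ?thesis by (simp add: H.auto_iff T_def)
  qed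
  have hom: "T \<in> hom (AutoGroup G) (AutoGroup H)"
  proof (rule homI)
    show "T \<alpha> \<in> carrier (AutoGroup H)" if "\<alpha> \<in> carrier (AutoGroup G)" for \<alpha> using T that by simp
    fix \<alpha> \<beta> assume "\<alpha> \<in> carrier (AutoGroup G)" "\<beta> \<in> carrier (AutoGroup G)"
    then have ab: "\<alpha> \<in> auto G" "\<beta> \<in> auto G" by simp_all
    show "T (\<alpha> \<otimes>\<^bsub>AutoGroup G\<^esub> \<beta>) = T \<alpha> \<otimes>\<^bsub>AutoGroup H\<^esub> T \<beta>"
    proof (rule H.auto_eqI[OF T[OF G.auto_comp_closed[OF ab]] H.auto_comp_closed[OF T[OF ab(1)] T[OF ab(2)]]])
      fix y assume y: "y \<in> carrier H"
      show "T (\<alpha> \<otimes>\<^bsub>AutoGroup G\<^esub> \<beta>) y = (T \<alpha> \<otimes>\<^bsub>AutoGroup H\<^esub> T \<beta>) y"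
        unfolding mult_AutoGroup_apply[OF T[OF ab(1)] T[OF ab(2)] y]
        using y mult_AutoGroup_apply[OF ab gc[OF y]] G.auto_closed[OF ab(2) gc[OF y]]
        by (simp add: T_def gf fc)
    qed
  qed
  have "bij_betw T (auto G) (auto H)"
    unfolding bij_betw_def
  proof
    show "inj_on T (auto G)"
    proof (rule inj_onI)
      fix \<alpha> \<beta> assume ab: "\<alpha> \<in> auto G" "\<beta> \<in> auto G" "T \<alpha> = T \<beta>"
      show "\<alpha> = \<beta>"
      proof (rule G.auto_eqI[OF ab(1,2)])
        fix x assume x: "x \<in> carrier G"
        have "T \<alpha> (f x) = T \<beta> (f x)" using ab(3) by simp
        then have "f (\<alpha> x) = f (\<beta> x)" using x by (simp add: T_def gf fc)
        then have "g (f (\<alpha> x)) = g (f (\<beta> x))" by simp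
        then show "\<alpha> x = \<beta> x" using x ab G.auto_closed by (simp add: gf)
      qed
    qed
    show "T ` auto G = auto H"
    proof (intro equalityI subsetI)
      fix \<beta> assume \<beta>: "\<beta> \<in> auto H"
      define \<alpha> where "\<alpha> = (\<lambda>x \<in> carrier G. g (\<beta> (f x)))"
      have \<alpha>: "\<alpha> \<in> auto G"
      proof -
        have "\<beta> \<in> hom H H" "bij_betw \<beta> (carrier H) (carrier H)" using \<beta> by (auto simp: H.auto_iff)
        then have "g \<circ> \<beta> \<circ> f \<in> hom G G" "bij_betw (g \<circ> \<beta> \<circ> f) (carrier G) (carrier G)"
          using fh gh fb gb by (auto intro: Group.hom_compose bij_betw_trans)
        then have "\<alpha> \<in> hom G G" "bij_betw \<alpha> (carrier G) (carrier G)"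
          unfolding \<alpha>_def by (auto simp: hom_def intro: bij_betw_cong[THEN iffD1, rotated])
        then show ?thesis by (simp add: G.auto_iff \<alpha>_def)
      qed
      have "T \<alpha> = \<beta>"
        by (rule H.auto_eqI[OF T[OF \<alpha>] \<beta>])
          (simp add: T_def \<alpha>_def gc fg H.auto_closed[OF \<beta>])
      then show "\<beta> \<in> T ` auto G" using \<alpha> by blast
    qed (use T in auto)
  qed
  with hom show ?thesis by (auto simp: is_iso_def iso_def)
qed

lemma AutoGroup_DirProd:
  fixes A :: "('a, 'm) monoid_scheme" and B :: "('b, 'n) monoid_scheme"
  assumes A: "group A" "finite (carrier A)" and B: "group B" "finite (carrier B)"
    and charA: "\<And>\<alpha> x. \<alpha> \<in> auto (A \<times>\<times> B) \<Longrightarrow> x \<in> carrier A \<Longrightarrow> snd (\<alpha> (x, \<one>\<^bsub>B\<^esub>)) = \<one>\<^bsub>B\<^esub>"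
    and charB: "\<And>\<alpha> y. \<alpha> \<in> auto (A \<times>\<times> B) \<Longrightarrow> y \<in> carrier B \<Longrightarrow> fst (\<alpha> (\<one>\<^bsub>A\<^esub>, y)) = \<one>\<^bsub>A\<^esub>"
  shows "AutoGroup A \<times>\<times> AutoGroup B \<cong> AutoGroup (A \<times>\<times> B)"
proof -
  let ?W = "A \<times>\<times> B"
  interpret A: group A by (rule A)
  interpret B: group B by (rule B)
  interpret W: group ?W by (rule DirProd_group[OF A(1) B(1)])
  have finW: "finite (carrier ?W)" using A(2) B(2) by simp
  define T where "T = (\<lambda>(a :: 'a \<Rightarrow> 'a, b :: 'b \<Rightarrow> 'b). \<lambda>w \<in> carrier ?W. (a (fst w), b (snd w)))"
  have app: "T (a, b) (x, y) = (a x, b y)" if "x \<in> carrier A" "y \<in> carrier B" for a b x y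
    using that by (simp add: T_def)
  have T: "T (a, b) \<in> auto ?W" if a: "a \<in> auto A" and b: "b \<in> auto B" for a b
  proof (rule W.finite_autoI[OF finW])
    show "T (a, b) \<in> hom ?W ?W"
      using A.auto_closed[OF a] B.auto_closed[OF b] A.auto_mult[OF a] B.auto_mult[OF b]
      by (intro homI) (auto simp: app)
    show "T (a, b) \<in> extensional (carrier ?W)" by (simp add: T_def)
    show "w = \<one>\<^bsub>?W\<^esub>" if w: "w \<in> carrier ?W" "T (a, b) w = \<one>\<^bsub>?W\<^esub>" for w
    proof -
      obtain x y where xy: "w = (x, y)" "x \<in> carrier A" "y \<in> carrier B" using w(1) by auto
      then have "a x = \<one>\<^bsub>A\<^esub>" "b y = \<one>\<^bsub>B\<^esub>" using w(2) by (simp_all add: app)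
      then show ?thesis
        using xy A.auto_inj[OF a, of x "\<one>\<^bsub>A\<^esub>"] B.auto_inj[OF b, of y "\<one>\<^bsub>B\<^esub>"] A.auto_one[OF a] B.auto_one[OF b]
        by simp
    qed
  qed
  have hom: "T \<in> hom (AutoGroup A \<times>\<times> AutoGroup B) (AutoGroup ?W)"
  proof (rule homI)
    fix u v assume "u \<in> carrier (AutoGroup A \<times>\<times> AutoGroup B)" "v \<in> carrier (AutoGroup A \<times>\<times> AutoGroup B)"
    then obtain a b a' b' where uv: "u = (a, b)" "v = (a', b')"
      and m: "a \<in> auto A" "b \<in> auto B" "a' \<in> auto A" "b' \<in> auto B" by auto
    show "T u \<in> carrier (AutoGroup ?W)" using T m uv by simp
    have "T (a \<otimes>\<^bsub>AutoGroup A\<^esub> a', b \<otimes>\<^bsub>AutoGroup B\<^esub> b') = T (a, b) \<otimes>\<^bsub>AutoGroup ?W\<^esub> T (a', b')"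
    proof (rule W.auto_eqI)
      show "T (a \<otimes>\<^bsub>AutoGroup A\<^esub> a', b \<otimes>\<^bsub>AutoGroup B\<^esub> b') \<in> auto ?W"
        by (intro T A.auto_comp_closed B.auto_comp_closed m)
      show "T (a, b) \<otimes>\<^bsub>AutoGroup ?W\<^esub> T (a', b') \<in> auto ?W"
        by (intro W.auto_comp_closed T m)
      fix w assume w: "w \<in> carrier ?W"
      obtain x y where xy: "w = (x, y)" "x \<in> carrier A" "y \<in> carrier B" using w by auto
      show "T (a \<otimes>\<^bsub>AutoGroup A\<^esub> a', b \<otimes>\<^bsub>AutoGroup B\<^esub> b') w = (T (a, b) \<otimes>\<^bsub>AutoGroup ?W\<^esub> T (a', b')) w"
        unfolding mult_AutoGroup_apply[OF T[OF m(1,2)] T[OF m(3,4)] w]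
        using xy A.auto_closed[OF m(3) xy(2)] B.auto_closed[OF m(4) xy(3)]
        by (simp add: app mult_AutoGroup_apply m)
    qed
    then show "T (u \<otimes>\<^bsub>AutoGroup A \<times>\<times> AutoGroup B\<^esub> v) = T u \<otimes>\<^bsub>AutoGroup ?W\<^esub> T v"
      using uv by simp
  qed
  have inj: "inj_on T (auto A \<times> auto B)"
  proof (rule inj_onI)
    fix u v assume "u \<in> auto A \<times> auto B" "v \<in> auto A \<times> auto B" and eq: "T u = T v"
    then obtain a b a' b' where uv: "u = (a, b)" "v = (a', b')"
      and m: "a \<in> auto A" "b \<in> auto B" "a' \<in> auto A" "b' \<in> auto B" by auto
    have e: "a x = a' x \<and> b y = b' y" if "x \<in> carrier A" "y \<in> carrier B" for x y
      using app[OF that, of a b] app[OF that, of a' b'] eq uv by simp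
    have "a = a'" using e[OF _ B.one_closed] by (intro A.auto_eqI m) blast
    moreover have "b = b'" using e[OF A.one_closed] by (intro B.auto_eqI m) blast
    ultimately show "u = v" using uv by simp
  qed
  have surj: "\<alpha> \<in> T ` (auto A \<times> auto B)" if \<alpha>: "\<alpha> \<in> auto ?W" for \<alpha>
  proof -
    define a where "a = (\<lambda>x \<in> carrier A. fst (\<alpha> (x, \<one>\<^bsub>B\<^esub>)))"
    define b where "b = (\<lambda>y \<in> carrier B. snd (\<alpha> (\<one>\<^bsub>A\<^esub>, y)))"
    have va: "\<alpha> (x, \<one>\<^bsub>B\<^esub>) = (a x, \<one>\<^bsub>B\<^esub>)" if "x \<in> carrier A" for x
      using charA[OF \<alpha> that] that by (simp add: a_def prod_eq_iff)
    have vb: "\<alpha> (\<one>\<^bsub>A\<^esub>, y) = (\<one>\<^bsub>A\<^esub>, b y)" if "y \<in> carrier B" for y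
      using charB[OF \<alpha> that] that by (simp add: b_def prod_eq_iff)
    have ac: "a x \<in> carrier A" if "x \<in> carrier A" for x
      using W.auto_closed[OF \<alpha>, of "(x, \<one>\<^bsub>B\<^esub>)"] va[OF that] that by simp
    have bc: "b y \<in> carrier B" if "y \<in> carrier B" for y
      using W.auto_closed[OF \<alpha>, of "(\<one>\<^bsub>A\<^esub>, y)"] vb[OF that] that by simp
    have am: "a (x \<otimes>\<^bsub>A\<^esub> x') = a x \<otimes>\<^bsub>A\<^esub> a x'" if "x \<in> carrier A" "x' \<in> carrier A" for x x'
      using W.auto_mult[OF \<alpha>, of "(x, \<one>\<^bsub>B\<^esub>)" "(x', \<one>\<^bsub>B\<^esub>)"] that va[OF that(1)] va[OF that(2)] va[of "x \<otimes>\<^bsub>A\<^esub> x'"]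
      by simp
    have bm: "b (y \<otimes>\<^bsub>B\<^esub> y') = b y \<otimes>\<^bsub>B\<^esub> b y'" if "y \<in> carrier B" "y' \<in> carrier B" for y y'
      using W.auto_mult[OF \<alpha>, of "(\<one>\<^bsub>A\<^esub>, y)" "(\<one>\<^bsub>A\<^esub>, y')"] that vb[OF that(1)] vb[OF that(2)] vb[of "y \<otimes>\<^bsub>B\<^esub> y'"]
      by simp
    have one: "\<alpha> (\<one>\<^bsub>A\<^esub>, \<one>\<^bsub>B\<^esub>) = (\<one>\<^bsub>A\<^esub>, \<one>\<^bsub>B\<^esub>)" using W.auto_one[OF \<alpha>] by simp
    have a: "a \<in> auto A"
    proof (rule A.finite_autoI[OF A(2)])
      show "a \<in> hom A A" using ac am by (intro homI)
      show "a \<in> extensional (carrier A)" by (simp add: a_def)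
      show "x = \<one>\<^bsub>A\<^esub>" if "x \<in> carrier A" "a x = \<one>\<^bsub>A\<^esub>" for x
        using va[OF that(1)] one that W.auto_inj[OF \<alpha>, of "(x, \<one>\<^bsub>B\<^esub>)" "(\<one>\<^bsub>A\<^esub>, \<one>\<^bsub>B\<^esub>)"] by simp
    qed
    have b: "b \<in> auto B"
    proof (rule B.finite_autoI[OF B(2)])
      show "b \<in> hom B B" using bc bm by (intro homI)
      show "b \<in> extensional (carrier B)" by (simp add: b_def)
      show "y = \<one>\<^bsub>B\<^esub>" if "y \<in> carrier B" "b y = \<one>\<^bsub>B\<^esub>" for y
        using vb[OF that(1)] one that W.auto_inj[OF \<alpha>, of "(\<one>\<^bsub>A\<^esub>, y)" "(\<one>\<^bsub>A\<^esub>, \<one>\<^bsub>B\<^esub>)"] by simp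
    qed
    have "\<alpha> = T (a, b)"
    proof (rule W.auto_eqI[OF \<alpha> T[OF a b]])
      fix w assume "w \<in> carrier ?W"
      then obtain x y where xy: "w = (x, y)" "x \<in> carrier A" "y \<in> carrier B" by auto
      have "\<alpha> (x, y) = \<alpha> (x, \<one>\<^bsub>B\<^esub>) \<otimes>\<^bsub>?W\<^esub> \<alpha> (\<one>\<^bsub>A\<^esub>, y)"
        using W.auto_mult[OF \<alpha>, of "(x, \<one>\<^bsub>B\<^esub>)" "(\<one>\<^bsub>A\<^esub>, y)"] xy by simp
      then show "\<alpha> w = T (a, b) w" using xy va[OF xy(2)] vb[OF xy(3)] ac bc by (simp add: app)
    qed
    then show ?thesis using a b by blast
  qed
  have "T ` (auto A \<times> auto B) = auto ?W" using T surj by auto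
  then show ?thesis using hom inj by (auto simp: is_iso_def iso_def bij_betw_def)
qed

lemma dihedral_4_center:
  assumes d: "d \<in> center (dihedral_group 4)"
  shows "d \<otimes>\<^bsub>dihedral_group 4\<^esub> d = \<one>\<^bsub>dihedral_group 4\<^esub>"
proof -
  interpret D: group "dihedral_group 4" by (rule group_dihedral_group) simp
  obtain a s where as: "d = (a, s)" "0 \<le> a" "a < 4"
    using D.center_closed[OF d] by (cases d) (simp add: dihedral_group_simps)
  have c: "(1, False) \<in> carrier (dihedral_group 4)" "(0, True) \<in> carrier (dihedral_group 4)"
    by (simp_all add: dihedral_group_simps)
  have "\<not> s"
    using D.center_commutes[OF d c(1)] as by (auto simp: dihedral_group_simps) presburger
  moreover have "a mod 4 = (- a) mod 4"
    using D.center_commutes[OF d c(2)] as \<open>\<not> s\<close> by (simp add: dihedral_group_simps)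
  ultimately show ?thesis
    using as by (simp add: dihedral_group_simps) presburger
qed

lemma dihedral_4_commutator:
  assumes x: "x \<in> carrier (dihedral_group 4)" and y: "y \<in> carrier (dihedral_group 4)"
  shows "commutator (dihedral_group 4) x y \<in> center (dihedral_group 4)"
proof -
  let ?D = "dihedral_group 4"
  interpret D: group ?D by (rule group_dihedral_group) simp
  have "\<exists>z \<in> {(0, False), (2, False)}. x \<otimes>\<^bsub>?D\<^esub> y = z \<otimes>\<^bsub>?D\<^esub> (y \<otimes>\<^bsub>?D\<^esub> x)"
  proof -
    have car: "d \<in> {0, 1, 2, 3}" if "(d, v) \<in> carrier ?D" for d v
      using that by (auto simp: dihedral_group_simps)
    obtain a s where as: "x = (a, s)" "a \<in> {0, 1, 2, 3}" using car x by (metis surj_pair)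
    obtain b t where bt: "y = (b, t)" "b \<in> {0, 1, 2, 3}" using car y by (metis surj_pair)
    show ?thesis
      unfolding as(1) bt(1) using as(2) bt(2)
      by (cases s; cases t) (auto simp: dihedral_group_simps)
  qed
  then obtain z where z: "z \<in> {(0, False), (2, False)}" "x \<otimes>\<^bsub>?D\<^esub> y = z \<otimes>\<^bsub>?D\<^esub> (y \<otimes>\<^bsub>?D\<^esub> x)" by blast
  have zc: "z \<in> center ?D"
  proof (rule D.centerI)
    show "z \<in> carrier ?D" using z(1) by (auto simp: dihedral_group_simps)
    fix g assume "g \<in> carrier ?D"
    obtain b t where "g = (b, t)" by (metis surj_pair)
    then show "z \<otimes>\<^bsub>?D\<^esub> g = g \<otimes>\<^bsub>?D\<^esub> z"
      using z(1) by (cases t; auto simp: dihedral_group_simps; presburger)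
  qed
  have "commutator ?D x y \<otimes>\<^bsub>?D\<^esub> (y \<otimes>\<^bsub>?D\<^esub> x) = z \<otimes>\<^bsub>?D\<^esub> (y \<otimes>\<^bsub>?D\<^esub> x)"
    using D.mult_eq_commutator[OF x y] z(2) by simp
  then have "commutator ?D x y = z"
    using D.right_cancel[of "y \<otimes>\<^bsub>?D\<^esub> x" "commutator ?D x y" z] x y D.center_closed[OF zc] by simp
  then show ?thesis using zc by simp
qed

text \<open>The first factor is the second center of the product. Its centralizer, which contains the second
  factor, can only be moved along a homomorphism from \<open>K\<close> to the center of the first factor, and
  there are none if the abelianization of \<open>K\<close> has odd order.\<close>

lemma stable_dihedral_times_complete:
  assumes K: "group K" "finite (carrier K)" and cless: "center K = {\<one>\<^bsub>K\<^esub>}"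
    and complete: "complete_group K" and odd: "odd (order (abelianization K))"
  shows "dihedral_group 4 \<times>\<times> K \<cong> AutoGroup (dihedral_group 4 \<times>\<times> K)"
proof -
  let ?D = "dihedral_group 4" and ?W = "dihedral_group 4 \<times>\<times> K"
  have D: "group ?D" by (rule group_dihedral_group) simp
  interpret D: group ?D by (rule D)
  interpret K: group K by (rule K)
  interpret W: group ?W by (rule DirProd_group[OF D K(1)])
  have comm: "commutator ?W (x, y) (x', y') = (commutator ?D x x', commutator K y y')"
    if "x \<in> carrier ?D" "y \<in> carrier K" "x' \<in> carrier ?D" "y' \<in> carrier K" for x y x' y'
    using that D K(1) by (simp add: commutator_def)
  have centerW: "(x, y) \<in> center ?W \<longleftrightarrow> x \<in> center ?D \<and> y \<in> center K" for x y
    unfolding center_def by (auto dest: bspec[of _ _ "(_, \<one>\<^bsub>K\<^esub>)"] bspec[of _ _ "(\<one>\<^bsub>?D\<^esub>, _)"])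
  have charD: "snd (\<alpha> (x, \<one>\<^bsub>K\<^esub>)) = \<one>\<^bsub>K\<^esub>" if \<alpha>: "\<alpha> \<in> auto ?W" and x: "x \<in> carrier ?D" for \<alpha> x
  proof -
    have xW: "(x, \<one>\<^bsub>K\<^esub>) \<in> carrier ?W" using x by simp
    obtain x' k where xk: "\<alpha> (x, \<one>\<^bsub>K\<^esub>) = (x', k)" by (metis surj_pair)
    have xk': "x' \<in> carrier ?D" "k \<in> carrier K" using W.auto_closed[OF \<alpha> xW] xk by simp_all
    have "k \<in> center K"
      unfolding K.center_iff_commutators[OF xk'(2)]
    proof
      fix h assume h: "h \<in> carrier K"
      have hW: "(\<one>\<^bsub>?D\<^esub>, h) \<in> carrier ?W" using h by simp
      obtain w where w: "w \<in> carrier ?W" "(\<one>\<^bsub>?D\<^esub>, h) = \<alpha> w" using \<alpha> hW by (rule W.auto_surj)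
      obtain a b where ab: "w = (a, b)" "a \<in> carrier ?D" "b \<in> carrier K" using w(1) by auto
      have "commutator ?W (x, \<one>\<^bsub>K\<^esub>) w \<in> center ?W"
        unfolding ab(1) comm[OF x K.one_closed ab(2,3)] centerW
        using dihedral_4_commutator[OF x ab(2)] ab(3) K.commutator_center_left[of b "\<one>\<^bsub>K\<^esub>"] by simp
      then have "\<alpha> (commutator ?W (x, \<one>\<^bsub>K\<^esub>) w) \<in> center ?W" by (rule W.center_auto[OF \<alpha>])
      then have "commutator ?W (x', k) (\<one>\<^bsub>?D\<^esub>, h) \<in> center ?W"
        using W.auto_commutator[OF \<alpha> xW w(1)] xk w(2) by simp
      then have "commutator K k h \<in> center K"
        using comm[OF xk' D.one_closed h] centerW by simp
      then show "commutator K k h = \<one>\<^bsub>K\<^esub>" using cless by simp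
    qed
    then show ?thesis using cless xk by simp
  qed
  have charK: "fst (\<alpha> (\<one>\<^bsub>?D\<^esub>, k)) = \<one>\<^bsub>?D\<^esub>" if \<alpha>: "\<alpha> \<in> auto ?W" and k: "k \<in> carrier K" for \<alpha> k
  proof -
    define h where "h y = fst (\<alpha> (\<one>\<^bsub>?D\<^esub>, y))" for y
    have hc: "h y \<in> carrier ?D" if "y \<in> carrier K" for y
      using W.auto_closed[OF \<alpha>, of "(\<one>\<^bsub>?D\<^esub>, y)"] that by (auto simp: h_def)
    have hm: "h (y \<otimes>\<^bsub>K\<^esub> y') = h y \<otimes>\<^bsub>?D\<^esub> h y'" if "y \<in> carrier K" "y' \<in> carrier K" for y y'
      using W.auto_mult[OF \<alpha>, of "(\<one>\<^bsub>?D\<^esub>, y)" "(\<one>\<^bsub>?D\<^esub>, y')"] that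
      by (simp add: h_def mult_DirProd')
    have hom: "h \<in> hom K ?D" using hc hm by (intro homI)
    define a where "a x = fst (\<alpha> (x, \<one>\<^bsub>K\<^esub>))" for x
    have ac: "a x \<in> carrier ?D" if "x \<in> carrier ?D" for x
      using W.auto_closed[OF \<alpha>, of "(x, \<one>\<^bsub>K\<^esub>)"] that by (auto simp: a_def)
    have va: "\<alpha> (x, \<one>\<^bsub>K\<^esub>) = (a x, \<one>\<^bsub>K\<^esub>)" if "x \<in> carrier ?D" for x
      using charD[OF \<alpha> that] by (simp add: a_def prod_eq_iff)
    have "inj_on a (carrier ?D)"
    proof (rule inj_onI)
      fix x x' assume "x \<in> carrier ?D" "x' \<in> carrier ?D" "a x = a x'"
      then show "x = x'"
        using va[of x] va[of x'] W.auto_inj[OF \<alpha>, of "(x, \<one>\<^bsub>K\<^esub>)" "(x', \<one>\<^bsub>K\<^esub>)"] by simp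
    qed
    moreover have finD: "finite (carrier ?D)" by (simp add: dihedral_group_simps)
    ultimately have surj: "a ` carrier ?D = carrier ?D" using ac by (intro endo_inj_surj) auto
    have hZ: "h y \<in> center ?D" if y: "y \<in> carrier K" for y
    proof (rule D.centerI[OF hc[OF y]])
      fix g assume "g \<in> carrier ?D"
      then obtain x where x: "x \<in> carrier ?D" "g = a x" using surj by (metis imageE)
      have "\<alpha> ((\<one>\<^bsub>?D\<^esub>, y) \<otimes>\<^bsub>?W\<^esub> (x, \<one>\<^bsub>K\<^esub>)) = \<alpha> ((x, \<one>\<^bsub>K\<^esub>) \<otimes>\<^bsub>?W\<^esub> (\<one>\<^bsub>?D\<^esub>, y))"
        using x y by simp
      then have "\<alpha> (\<one>\<^bsub>?D\<^esub>, y) \<otimes>\<^bsub>?W\<^esub> \<alpha> (x, \<one>\<^bsub>K\<^esub>) = \<alpha> (x, \<one>\<^bsub>K\<^esub>) \<otimes>\<^bsub>?W\<^esub> \<alpha> (\<one>\<^bsub>?D\<^esub>, y)"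
        using W.auto_mult[OF \<alpha>, of "(\<one>\<^bsub>?D\<^esub>, y)" "(x, \<one>\<^bsub>K\<^esub>)"]
          W.auto_mult[OF \<alpha>, of "(x, \<one>\<^bsub>K\<^esub>)" "(\<one>\<^bsub>?D\<^esub>, y)"] x y by simp
      then show "h y \<otimes>\<^bsub>?D\<^esub> g = g \<otimes>\<^bsub>?D\<^esub> h y"
        by (simp add: mult_DirProd' h_def a_def x(2))
    qed
    have "h k = \<one>\<^bsub>?D\<^esub>"
    proof (rule K.odd_abelianization_hom_trivial[OF K(2) odd hom D _ _ k])
      show "h y \<otimes>\<^bsub>?D\<^esub> h y = \<one>\<^bsub>?D\<^esub>" if "y \<in> carrier K" for y
        by (rule dihedral_4_center[OF hZ[OF that]])
      show "h y \<otimes>\<^bsub>?D\<^esub> h y' = h y' \<otimes>\<^bsub>?D\<^esub> h y" if "y \<in> carrier K" "y' \<in> carrier K" for y y'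
        by (rule D.center_commutes[OF hZ[OF that(1)] hc[OF that(2)]])
    qed
    then show ?thesis by (simp add: h_def)
  qed
  have finD: "finite (carrier ?D)" by (simp add: dihedral_group_simps)
  have "K \<cong> AutoGroup K" using complete by (auto simp: complete_group_def is_iso_def)
  then have "?W \<cong> AutoGroup ?D \<times>\<times> AutoGroup K"
    using D.DirProd_iso_trans Aut_dihedral_4 by blast
  also have "\<dots> \<cong> AutoGroup ?W"
    by (rule AutoGroup_DirProd[OF D finD K]) (fact charD, fact charK)
  finally show ?thesis .
qed

section \<open>Unfolding the hypotheses on the extension\<close>

text \<open>The term with index \<open>1\<close> of the lower central series contains all commutators, and the term with index
  \<open>2\<close> contains their commutators with arbitrary elements.\<close>

lemma nilpotent_class_two_commutators:
  assumes N: "group N" and nil: "nilpotent_of_class N 2"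
  shows "\<And>x y z. x \<in> carrier N \<Longrightarrow> y \<in> carrier N \<Longrightarrow> z \<in> carrier N \<Longrightarrow>
      commutator N x y \<otimes>\<^bsub>N\<^esub> z = z \<otimes>\<^bsub>N\<^esub> commutator N x y"
    and "\<exists>x \<in> carrier N. \<exists>y \<in> carrier N. x \<otimes>\<^bsub>N\<^esub> y \<noteq> y \<otimes>\<^bsub>N\<^esub> x"
proof -
  interpret N: group N by (rule N)
  define \<gamma> where "\<gamma> = lower_central_series N 1"
  have \<gamma>: "\<gamma> = generate N {commutator N x y | x y. x \<in> carrier N \<and> y \<in> carrier N}"
    by (simp add: \<gamma>_def commutator_subgroup_def commutator_def)
  have two: "generate N {commutator N x y | x y. x \<in> \<gamma> \<and> y \<in> carrier N} = {\<one>\<^bsub>N\<^esub>}"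
    using nil by (simp add: nilpotent_of_class_def numeral_2_eq_2 \<gamma>_def commutator_subgroup_def commutator_def)
  show "commutator N x y \<otimes>\<^bsub>N\<^esub> z = z \<otimes>\<^bsub>N\<^esub> commutator N x y"
    if xyz: "x \<in> carrier N" "y \<in> carrier N" "z \<in> carrier N" for x y z
  proof -
    have "commutator N x y \<in> \<gamma>" unfolding \<gamma> using xyz by (intro generate.incl) blast
    then have "commutator N (commutator N x y) z \<in> generate N {commutator N x y | x y. x \<in> \<gamma> \<and> y \<in> carrier N}"
      using xyz(3) by (intro generate.incl) blast
    then have "commutator N (commutator N x y) z = \<one>\<^bsub>N\<^esub>" using two by simp
    then show ?thesis
      using N.commutator_eq_one_iff[OF N.commutator_closed[OF xyz(1,2)] xyz(3)] by blast
  qed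
  show "\<exists>x \<in> carrier N. \<exists>y \<in> carrier N. x \<otimes>\<^bsub>N\<^esub> y \<noteq> y \<otimes>\<^bsub>N\<^esub> x"
  proof (rule ccontr)
    assume "\<not> ?thesis"
    then have "commutator N x y = \<one>\<^bsub>N\<^esub>" if "x \<in> carrier N" "y \<in> carrier N" for x y
      using that N.commutator_eq_one_iff[OF that] by blast
    then have "{commutator N x y | x y. x \<in> carrier N \<and> y \<in> carrier N} \<subseteq> {\<one>\<^bsub>N\<^esub>}"
      by auto
    then have "\<gamma> \<subseteq> {\<one>\<^bsub>N\<^esub>}"
      unfolding \<gamma> by (rule N.generate_subgroup_incl[OF _ N.triv_subgroup])
    moreover have "\<one>\<^bsub>N\<^esub> \<in> \<gamma>" unfolding \<gamma> by (rule generate.one)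
    moreover have "\<gamma> \<noteq> {\<one>\<^bsub>N\<^esub>}"
      using nil one_less_numeral_iff[of "num.Bit0 num.One"] semiring_norm(76)
      unfolding nilpotent_of_class_def \<gamma>_def by blast
    ultimately show False by blast
  qed
qed

text \<open>If the coset of \<open>Inn N\<close> containing the action of \<open>g\<close> is the trivial one, the action of
  \<open>g\<close> is itself inner, because the identity is inner.\<close>

lemma trivial_outer_action_inner:
  assumes N: "group N" and G: "group G" and i: "i \<in> mon N G"
    and normal: "i ` carrier N \<lhd> G"
    and triv: "trivial_outer_action N i G" and g: "g \<in> carrier G"
  shows "\<exists>n \<in> carrier N. \<forall>x \<in> carrier N. g \<otimes>\<^bsub>G\<^esub> i x \<otimes>\<^bsub>G\<^esub> inv\<^bsub>G\<^esub> g = i n \<otimes>\<^bsub>G\<^esub> i x \<otimes>\<^bsub>G\<^esub> inv\<^bsub>G\<^esub> (i n)"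
proof -
  interpret N: group N by (rule N)
  interpret G: group G by (rule G)
  have inj: "inj_on i (carrier N)" and hom: "i \<in> hom N G" using i by (auto simp: mon_def)
  interpret i: group_hom N G i using hom by (simp add: group_hom_def group_hom_axioms_def)
  let ?a = "extension_aut N i G g"
  have conj: "h \<otimes>\<^bsub>G\<^esub> i x \<otimes>\<^bsub>G\<^esub> inv\<^bsub>G\<^esub> h \<in> i ` carrier N" if "h \<in> carrier G" "x \<in> carrier N" for h x
    using normal that by (simp add: G.normal_inv_iff)
  note mem = conj[OF g]
  have ia: "i (?a x) = g \<otimes>\<^bsub>G\<^esub> i x \<otimes>\<^bsub>G\<^esub> inv\<^bsub>G\<^esub> g" if "x \<in> carrier N" for x
    using f_inv_into_f[OF mem[OF that]] that by (simp add: extension_aut_def)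
  have ac: "?a x \<in> carrier N" if "x \<in> carrier N" for x
    using inv_into_into[OF mem[OF that]] that by (simp add: extension_aut_def)
  have aut: "?a \<in> Bij (carrier N)"
  proof -
    have "inj_on ?a (carrier N)"
    proof (rule inj_onI)
      fix x y assume xy: "x \<in> carrier N" "y \<in> carrier N" "?a x = ?a y"
      then have "g \<otimes>\<^bsub>G\<^esub> i x \<otimes>\<^bsub>G\<^esub> inv\<^bsub>G\<^esub> g = g \<otimes>\<^bsub>G\<^esub> i y \<otimes>\<^bsub>G\<^esub> inv\<^bsub>G\<^esub> g" using ia by metis
      then have "i x = i y" using g xy(1,2) by simp
      then show "x = y" using inj xy by (simp add: inj_on_def)
    qed
    moreover have "?a ` carrier N = carrier N"
    proof (intro equalityI subsetI)
      fix y assume y: "y \<in> carrier N"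
      obtain x where x: "x \<in> carrier N" "inv\<^bsub>G\<^esub> g \<otimes>\<^bsub>G\<^esub> i y \<otimes>\<^bsub>G\<^esub> g = i x"
        using conj[OF G.inv_closed[OF g] y] g by auto
      have "g \<otimes>\<^bsub>G\<^esub> i x \<otimes>\<^bsub>G\<^esub> inv\<^bsub>G\<^esub> g = i y"
        unfolding x(2)[symmetric] using g y by (simp add: G.m_assoc)
      then have "i (?a x) = i y" using ia[OF x(1)] by simp
      then have "?a x = y" using inj ac[OF x(1)] y by (simp add: inj_on_def)
      then show "y \<in> ?a ` carrier N" using x(1) by blast
    qed (use ac in auto)
    ultimately show ?thesis by (simp add: Bij_def bij_betw_def extension_aut_def)
  qed
  have "\<one>\<^bsub>AutoGroup N\<^esub> \<in> Inn N"
    using N.conj_aut_eq_one_iff[OF N.one_closed] unfolding Inn_def by (metis N.center_one N.one_closed imageI)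
  then have "\<one>\<^bsub>AutoGroup N\<^esub> \<otimes>\<^bsub>AutoGroup N\<^esub> ?a \<in> Inn N #>\<^bsub>AutoGroup N\<^esub> ?a"
    by (auto simp: r_coset_def)
  also have "Inn N #>\<^bsub>AutoGroup N\<^esub> ?a = Inn N"
    using triv g by (simp add: trivial_outer_action_def outer_action_def OutGroup_def)
  also have "\<one>\<^bsub>AutoGroup N\<^esub> \<otimes>\<^bsub>AutoGroup N\<^esub> ?a = ?a"
    using monoid.l_one[OF group.is_monoid[OF group_BijGroup], of ?a "carrier N"] aut
    by (simp add: AutoGroup_def BijGroup_def)
  finally obtain n where n: "n \<in> carrier N" "?a = conj_aut N n" by (auto simp: Inn_def)
  have "g \<otimes>\<^bsub>G\<^esub> i x \<otimes>\<^bsub>G\<^esub> inv\<^bsub>G\<^esub> g = i n \<otimes>\<^bsub>G\<^esub> i x \<otimes>\<^bsub>G\<^esub> inv\<^bsub>G\<^esub> (i n)" if x: "x \<in> carrier N" for x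
    using ia[OF x] n x by (simp add: N.conj_aut_apply)
  then show ?thesis using n(1) by blast
qed

theorem theorem4p5:
  fixes N :: "('a, 'm) monoid_scheme"
    and G :: "('b, 'n) monoid_scheme"
    and K :: "('c, 'k) monoid_scheme"
    and i :: "'a \<Rightarrow> 'b"
    and p :: "'b \<Rightarrow> 'c"
  assumes "group_extension N i G p K"
    and "finite (carrier N)" "finite (carrier G)" "finite (carrier K)"
    and "trivial_outer_action N i G"
    and "nilpotent_of_class N 2"
    and "centerless K"
  shows "stable_group G \<longleftrightarrow>
    G \<cong> dihedral_group 4 \<times>\<times> K \<and> complete_group K \<and> odd (order (abelianization K))"
proof -
  have grp: "group N" "group G" "group K" and i: "i \<in> mon N G" and p: "p \<in> epi G K"
    and ker: "i ` carrier N = kernel G K p"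
    using assms(1) by (auto simp: group_extension_def)
  interpret N: group N by (rule grp)
  interpret G: group G by (rule grp)
  interpret K: group K by (rule grp)
  interpret p: group_hom G K p using p by (simp add: epi_def group_hom_def group_hom_axioms_def)
  interpret i: group_hom N G i using i by (simp add: mon_def group_hom_def group_hom_axioms_def)
  have cless: "center K = {\<one>\<^bsub>K\<^esub>}" using assms(7) by (simp add: centerless_def)
  show ?thesis
  proof
    assume "stable_group G"
    then obtain \<Phi> where "\<Phi> \<in> iso G (AutoGroup G)" by (auto simp: stable_group_def is_iso_def)
    then have \<Psi>: "inv_into (carrier G) \<Phi> \<in> iso (AutoGroup G) G" by (rule G.iso_set_sym)
    have inj: "inj_on i (carrier N)" using i by (simp add: mon_def)
    have icomm: "i (commutator N x y) = commutator G (i x) (i y)" if "x \<in> carrier N" "y \<in> carrier N" for x y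
      using that by (simp add: commutator_def)
    interpret stable_extension G K p "inv_into (carrier G) \<Phi>"
    proof
      show "finite (carrier G)" by (rule assms(3))
      show "p \<in> hom G K" "p ` carrier G = carrier K" using p by (auto simp: epi_def)
      show "center K = {\<one>\<^bsub>K\<^esub>}" by (rule cless)
      show "inv_into (carrier G) \<Phi> \<in> iso (AutoGroup G) G" by (rule \<Psi>)
      show "\<exists>n \<in> kernel G K p. \<forall>x \<in> kernel G K p.
          g \<otimes>\<^bsub>G\<^esub> x \<otimes>\<^bsub>G\<^esub> inv\<^bsub>G\<^esub> g = n \<otimes>\<^bsub>G\<^esub> x \<otimes>\<^bsub>G\<^esub> inv\<^bsub>G\<^esub> n" if "g \<in> carrier G" for g
        using trivial_outer_action_inner[OF grp(1,2) i _ assms(5) that] p.normal_kernel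
        unfolding ker[symmetric] by blast
      show "commutator G x y \<otimes>\<^bsub>G\<^esub> z = z \<otimes>\<^bsub>G\<^esub> commutator G x y"
        if xyz: "x \<in> kernel G K p" "y \<in> kernel G K p" "z \<in> kernel G K p" for x y z
      proof -
        obtain a b c where abc: "a \<in> carrier N" "b \<in> carrier N" "c \<in> carrier N"
          "x = i a" "y = i b" "z = i c" using xyz unfolding ker[symmetric] by blast
        have "i (commutator N a b \<otimes>\<^bsub>N\<^esub> c) = i (c \<otimes>\<^bsub>N\<^esub> commutator N a b)"
          using nilpotent_class_two_commutators(1)[OF grp(1) assms(6) abc(1,2,3)] by simp
        then show ?thesis using abc icomm[OF abc(1,2)] by simp
      qed
      show "\<exists>x \<in> kernel G K p. \<exists>y \<in> kernel G K p. x \<otimes>\<^bsub>G\<^esub> y \<noteq> y \<otimes>\<^bsub>G\<^esub> x"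
      proof -
        obtain a b where ab: "a \<in> carrier N" "b \<in> carrier N" "a \<otimes>\<^bsub>N\<^esub> b \<noteq> b \<otimes>\<^bsub>N\<^esub> a"
          using nilpotent_class_two_commutators(2)[OF grp(1) assms(6)] by blast
        have "i (a \<otimes>\<^bsub>N\<^esub> b) \<noteq> i (b \<otimes>\<^bsub>N\<^esub> a)"
          using inj_onD[OF inj, of "a \<otimes>\<^bsub>N\<^esub> b" "b \<otimes>\<^bsub>N\<^esub> a"] ab by auto
        then have "i a \<otimes>\<^bsub>G\<^esub> i b \<noteq> i b \<otimes>\<^bsub>G\<^esub> i a" using ab by simp
        then show ?thesis unfolding ker[symmetric] using ab by blast
      qed
    qed
    show "G \<cong> dihedral_group 4 \<times>\<times> K \<and> complete_group K \<and> odd (order (abelianization K))"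
      using G_iso K_complete K_abelianization_odd by blast
  next
    let ?W = "dihedral_group 4 \<times>\<times> K"
    assume r: "G \<cong> ?W \<and> complete_group K \<and> odd (order (abelianization K))"
    have D: "group (dihedral_group 4)" by (rule group_dihedral_group) simp
    have W: "group ?W" by (rule DirProd_group[OF D grp(3)])
    have "?W \<cong> G" using r G.iso_sym by blast
    have "G \<cong> ?W" using r by blast
    also have "?W \<cong> AutoGroup ?W"
      using r stable_dihedral_times_complete[OF grp(3) assms(4) cless] by blast
    also have "AutoGroup ?W \<cong> AutoGroup G" by (rule AutoGroup_iso[OF W grp(2) \<open>?W \<cong> G\<close>])
    finally show "stable_group G" by (simp add: stable_group_def)
  qed
qed

end
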